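(* Let $G$ be a locally compact, Hausdorff, étale groupoid with compact unit space. Suppose that $G$ is minimal, has property (T), is a-T-menable, and that $G^{(0)}$ admits an invariant probability measure. Then $G$ is finite.
   Context: Notation: $r,s$ are the range and source maps, $G^x=r^{-1}(x)$, $G_x=s^{-1}(x)$. Étale means the topology has a basis of open bisections (open sets on which $r$ and $s$ are homeomorphisms onto their images in $G^{(0)}$). Minimal: for every $x\in G^{(0)}$ the orbit $s(G^x)$ is dense in $G^{(0)}$. Invariant probability measure: a Radon probability measure $\mu$ on $G^{(0)}$ with $\int\sum_{g\in G^x}f(g)\,d\mu(x)=\int\sum_{g\in G_x}f(g)\,d\mu(x)$ for all $f\in C_c(G)$. a-T-menable: there is a continuous, proper function $F:G\to[0,\infty)$ of negative type, i.e. $F(x)=0$ for $x\in G^{(0)}$; $F(g^{-1})=F(g)$ for $g\in G$; and for all $g_1,\dots,g_n\in G$ with the same range and all real $a_1,\dots,a_n$ with $\sum_ja_j=0$ one has $\sum_{i,j}a_ia_jF(g_i^{-1}g_j)\le0$. Property (T): $C_c(G)$ is the convolution $*$-algebra, $(f_1f_2)(g)=\sum_{hk=g}f_1(h)f_2(k)$, $f^*(g)=\overline{f(g^{-1})}$, and $\|f\|_I=\max\{\sup_{x}\sum_{g\in G^x}|f(g)|,\sup_x\sum_{g\in G_x}|f(g)|\}$. A representation $(H,\pi)$ is a unital $*$-homomorphism $\pi:C_c(G)\to\mathcal{B}(H)$, $H$ a complex Hilbert space; write $f\xi=\pi(f)\xi$. Put $\Psi:C_c(G)\to C(G^{(0)})$,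 $\Psi(f)(x)=\sum_{g\in G^x}f(g)$. A vector $\xi$ is constant if $f\xi=\Psi(f)\xi$ for all $f$; $H_\pi$ is the orthogonal complement of the space of constant vectors. $G$ has property (T) if there are a compact $K\subseteq G$ and $c>0$ such that for every representation $(H,\pi)$ of $C_c(G)$ and every $\xi\in H_\pi$ there is $f\in C_c(G)$ supported in $K$ with $\|f\|_I\le1$ and $\|f\xi-\Psi(f)\xi\|\ge c\|\xi\|$. *)

theory Defs
  imports "HOL-Probability.Probability"
begin

section \<open>Topological and etale groupoids\<close>

text \<open>
  The underlying set of the groupoid is the whole type \<open>'g\<close>, and the units are elements of it.
  The operation \<open>gmult G\<close> is total, but only its values at composable pairs matter.
\<close>

record 'g groupoid_ops =
  rng :: "'g \<Rightarrow> 'g"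
  src :: "'g \<Rightarrow> 'g"
  gmult :: "'g \<Rightarrow> 'g \<Rightarrow> 'g"
  ginv :: "'g \<Rightarrow> 'g"

definition units :: "'g groupoid_ops \<Rightarrow> 'g set" where
  "units G = range (rng G)"

definition range_fibre :: "'g groupoid_ops \<Rightarrow> 'g \<Rightarrow> 'g set" where
  "range_fibre G x = {g. rng G g = x}"

definition source_fibre :: "'g groupoid_ops \<Rightarrow> 'g \<Rightarrow> 'g set" where
  "source_fibre G x = {g. src G g = x}"

definition composable :: "'g groupoid_ops \<Rightarrow> ('g \<times> 'g) set" where
  "composable G = {(g, h). src G g = rng G h}"

locale groupoid =
  fixes G :: "'g groupoid_ops"
  assumes rng_rng: "rng G (rng G g) = rng G g"
    and src_rng: "src G (rng G g) = rng G g"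
    and rng_src: "rng G (src G g) = src G g"
    and src_src: "src G (src G g) = src G g"
    and rng_mult: "src G g = rng G h \<Longrightarrow> rng G (gmult G g h) = rng G g"
    and src_mult: "src G g = rng G h \<Longrightarrow> src G (gmult G g h) = src G h"
    and mult_assoc: "\<lbrakk>src G g = rng G h; src G h = rng G k\<rbrakk> \<Longrightarrow>
          gmult G (gmult G g h) k = gmult G g (gmult G h k)"
    and rng_mult_left: "gmult G (rng G g) g = g"
    and mult_src_right: "gmult G g (src G g) = g"
    and rng_inv: "rng G (ginv G g) = src G g"
    and src_inv: "src G (ginv G g) = rng G g"
    and mult_inv_right: "gmult G g (ginv G g) = rng G g"
    and mult_inv_left: "gmult G (ginv G g) g = src G g"

locale topological_groupoid = groupoid G for G :: "'g::topological_space groupoid_ops" +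
  assumes continuous_rng: "continuous_on UNIV (rng G)"
    and continuous_src: "continuous_on UNIV (src G)"
    and continuous_mult: "continuous_on (composable G) (\<lambda>(g, h). gmult G g h)"
    and continuous_inv: "continuous_on UNIV (ginv G)"

text \<open>
  The images of a bisection are required to be open in the unit space, so that the range and
  source maps are local homeomorphisms. Given a basis of open sets on which they are merely
  homeomorphisms onto their images, this is equivalent, in the locally compact Hausdorff case,
  to \<open>C\<^sub>c(G)\<close> being closed under convolution: if \<open>f\<close> is supported in such a set \<open>B\<close> and is
  nonzero at \<open>g\<close>, then \<open>f f\<^sup>*\<close> is nonzero at \<open>rng g\<close> and vanishes outside \<open>rng ` B\<close>.
\<close>

definition open_bisection :: "'g::topological_space groupoid_ops \<Rightarrow> 'g set \<Rightarrow> bool" where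
  "open_bisection G B \<longleftrightarrow> open B \<and>
     openin (top_of_set (units G)) (rng G ` B) \<and> (\<exists>t. homeomorphism B (rng G ` B) (rng G) t) \<and>
     openin (top_of_set (units G)) (src G ` B) \<and> (\<exists>t. homeomorphism B (src G ` B) (src G) t)"

locale etale_groupoid = topological_groupoid G for G :: "'g::topological_space groupoid_ops" +
  assumes basis_of_bisections: "topological_basis {B. open_bisection G B}"

definition minimal_groupoid :: "'g::topological_space groupoid_ops \<Rightarrow> bool" where
  "minimal_groupoid G \<longleftrightarrow>
     (\<forall>x\<in>units G. units G \<subseteq> closure (src G ` range_fibre G x))"


section \<open>The convolution algebra\<close>

definition support :: "('g::topological_space \<Rightarrow> complex) \<Rightarrow> 'g set" where
  "support f = closure {g. f g \<noteq> 0}"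

definition Cc :: "('g::topological_space \<Rightarrow> complex) set" where
  "Cc = {f. continuous_on UNIV f \<and> compact (support f)}"

text \<open>
  In an etale groupoid the fibres are closed and discrete, so for functions in \<open>Cc\<close> all the
  following unordered sums have only finitely many nonzero terms.
\<close>

definition conv :: "'g groupoid_ops \<Rightarrow> ('g \<Rightarrow> complex) \<Rightarrow> ('g \<Rightarrow> complex) \<Rightarrow> 'g \<Rightarrow> complex" where
  "conv G f1 f2 g =
     (\<Sum>\<^sub>\<infinity>(h, k)\<in>{(h, k). (h, k) \<in> composable G \<and> gmult G h k = g}. f1 h * f2 k)"

definition star :: "'g groupoid_ops \<Rightarrow> ('g \<Rightarrow> complex) \<Rightarrow> 'g \<Rightarrow> complex" where
  "star G f g = cnj (f (ginv G g))"

definition unit_fun :: "'g groupoid_ops \<Rightarrow> 'g \<Rightarrow> complex" where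
  "unit_fun G = indicator (units G)"

definition I_norm :: "'g groupoid_ops \<Rightarrow> ('g \<Rightarrow> complex) \<Rightarrow> real" where
  "I_norm G f = max (SUP x\<in>units G. \<Sum>\<^sub>\<infinity>g\<in>range_fibre G x. cmod (f g))
                    (SUP x\<in>units G. \<Sum>\<^sub>\<infinity>g\<in>source_fibre G x. cmod (f g))"

text \<open>
  \<open>Psi G f\<close> is a function on the unit space. The unit space being open and closed in an etale
  Hausdorff groupoid, functions on it are regarded as functions on \<open>G\<close> vanishing elsewhere.
\<close>

definition Psi :: "'g groupoid_ops \<Rightarrow> ('g \<Rightarrow> complex) \<Rightarrow> 'g \<Rightarrow> complex" where
  "Psi G f x = (if x \<in> units G then \<Sum>\<^sub>\<infinity>g\<in>range_fibre G x. f g else 0)"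


section \<open>Invariant measures\<close>

definition radon_probability_on :: "'a::t2_space set \<Rightarrow> 'a measure \<Rightarrow> bool" where
  "radon_probability_on X M \<longleftrightarrow> prob_space M \<and> sets M = sets (restrict_space borel X) \<and>
     (\<forall>A\<in>sets M. emeasure M A = (SUP K\<in>{K. compact K \<and> K \<subseteq> A}. emeasure M K))"

definition invariant_probability :: "'g::t2_space groupoid_ops \<Rightarrow> 'g measure \<Rightarrow> bool" where
  "invariant_probability G M \<longleftrightarrow> radon_probability_on (units G) M \<and>
     (\<forall>f\<in>Cc. (LINT x|M. (\<Sum>\<^sub>\<infinity>g\<in>range_fibre G x. f g)) =
              (LINT x|M. (\<Sum>\<^sub>\<infinity>g\<in>source_fibre G x. f g)))"


section \<open>A-T-menability\<close>

definition negative_type :: "'g groupoid_ops \<Rightarrow> ('g \<Rightarrow> real) \<Rightarrow> bool" where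
  "negative_type G F \<longleftrightarrow>
     (\<forall>x\<in>units G. F x = 0) \<and>
     (\<forall>g. F (ginv G g) = F g) \<and>
     (\<forall>(n::nat) (\<gamma> :: nat \<Rightarrow> 'g) (a :: nat \<Rightarrow> real).
        (\<forall>i<n. \<forall>j<n. rng G (\<gamma> i) = rng G (\<gamma> j)) \<longrightarrow> (\<Sum>i<n. a i) = 0 \<longrightarrow>
        (\<Sum>i<n. \<Sum>j<n. a i * a j * F (gmult G (ginv G (\<gamma> i)) (\<gamma> j))) \<le> 0)"

definition aT_menable :: "'g::topological_space groupoid_ops \<Rightarrow> bool" where
  "aT_menable G \<longleftrightarrow> (\<exists>F :: 'g \<Rightarrow> real.
     (\<forall>g. F g \<ge> 0) \<and> continuous_on UNIV F \<and>
     (\<forall>C. compact C \<longrightarrow> C \<subseteq> {0..} \<longrightarrow> compact (F -` C)) \<and>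
     negative_type G F)"


section \<open>Hilbert spaces and representations\<close>

text \<open>
  Hilbert spaces have an explicit carrier, because property (T) quantifies over all of them and
  a formula cannot quantify over types.
\<close>

record 'h hilbert_ops =
  hcarrier :: "'h set"
  hzero :: 'h
  hadd :: "'h \<Rightarrow> 'h \<Rightarrow> 'h"
  hscale :: "complex \<Rightarrow> 'h \<Rightarrow> 'h"
  hinner :: "'h \<Rightarrow> 'h \<Rightarrow> complex"

definition hnorm :: "'h hilbert_ops \<Rightarrow> 'h \<Rightarrow> real" where
  "hnorm H x = sqrt (Re (hinner H x x))"

definition hdiff :: "'h hilbert_ops \<Rightarrow> 'h \<Rightarrow> 'h \<Rightarrow> 'h" where
  "hdiff H x y = hadd H x (hscale H (-1) y)"

locale hilbert_space =
  fixes H :: "'h hilbert_ops"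
  assumes zero_closed: "hzero H \<in> hcarrier H"
    and add_closed: "\<lbrakk>x \<in> hcarrier H; y \<in> hcarrier H\<rbrakk> \<Longrightarrow> hadd H x y \<in> hcarrier H"
    and scale_closed: "x \<in> hcarrier H \<Longrightarrow> hscale H c x \<in> hcarrier H"
    and add_assoc: "\<lbrakk>x \<in> hcarrier H; y \<in> hcarrier H; z \<in> hcarrier H\<rbrakk> \<Longrightarrow>
          hadd H (hadd H x y) z = hadd H x (hadd H y z)"
    and add_commute: "\<lbrakk>x \<in> hcarrier H; y \<in> hcarrier H\<rbrakk> \<Longrightarrow> hadd H x y = hadd H y x"
    and add_zero: "x \<in> hcarrier H \<Longrightarrow> hadd H x (hzero H) = x"
    and add_neg: "x \<in> hcarrier H \<Longrightarrow> hadd H x (hscale H (-1) x) = hzero H"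
    and scale_add: "\<lbrakk>x \<in> hcarrier H; y \<in> hcarrier H\<rbrakk> \<Longrightarrow>
          hscale H c (hadd H x y) = hadd H (hscale H c x) (hscale H c y)"
    and add_scale: "x \<in> hcarrier H \<Longrightarrow>
          hscale H (c + d) x = hadd H (hscale H c x) (hscale H d x)"
    and scale_scale: "x \<in> hcarrier H \<Longrightarrow> hscale H c (hscale H d x) = hscale H (c * d) x"
    and scale_one: "x \<in> hcarrier H \<Longrightarrow> hscale H 1 x = x"
    and inner_add: "\<lbrakk>x \<in> hcarrier H; y \<in> hcarrier H; z \<in> hcarrier H\<rbrakk> \<Longrightarrow>
          hinner H (hadd H x y) z = hinner H x z + hinner H y z"
    and inner_scale: "\<lbrakk>x \<in> hcarrier H; y \<in> hcarrier H\<rbrakk> \<Longrightarrow>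
          hinner H (hscale H c x) y = c * hinner H x y"
    and inner_cnj: "\<lbrakk>x \<in> hcarrier H; y \<in> hcarrier H\<rbrakk> \<Longrightarrow> hinner H y x = cnj (hinner H x y)"
    and inner_nonneg: "x \<in> hcarrier H \<Longrightarrow> 0 \<le> Re (hinner H x x)"
    and inner_definite: "\<lbrakk>x \<in> hcarrier H; hinner H x x = 0\<rbrakk> \<Longrightarrow> x = hzero H"
    and complete: "\<lbrakk>\<And>n. X n \<in> hcarrier H;
          \<And>e. e > 0 \<Longrightarrow> \<exists>N. \<forall>m\<ge>N. \<forall>n\<ge>N. hnorm H (hdiff H (X m) (X n)) < e\<rbrakk> \<Longrightarrow>
          \<exists>x\<in>hcarrier H. (\<lambda>n::nat. hnorm H (hdiff H (X n) x)) \<longlonglongrightarrow> 0"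

definition bounded_operator :: "'h hilbert_ops \<Rightarrow> ('h \<Rightarrow> 'h) \<Rightarrow> bool" where
  "bounded_operator H T \<longleftrightarrow>
     (\<forall>x\<in>hcarrier H. T x \<in> hcarrier H) \<and>
     (\<forall>x\<in>hcarrier H. \<forall>y\<in>hcarrier H. T (hadd H x y) = hadd H (T x) (T y)) \<and>
     (\<forall>c. \<forall>x\<in>hcarrier H. T (hscale H c x) = hscale H c (T x)) \<and>
     (\<exists>C. \<forall>x\<in>hcarrier H. hnorm H (T x) \<le> C * hnorm H x)"

locale representation = hilbert_space H for H :: "'h hilbert_ops" +
  fixes G :: "'g::topological_space groupoid_ops"
    and \<pi> :: "('g \<Rightarrow> complex) \<Rightarrow> 'h \<Rightarrow> 'h"
  assumes bounded: "f \<in> Cc \<Longrightarrow> bounded_operator H (\<pi> f)"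
    and rep_add: "\<lbrakk>f1 \<in> Cc; f2 \<in> Cc; x \<in> hcarrier H\<rbrakk> \<Longrightarrow>
          \<pi> (\<lambda>g. f1 g + f2 g) x = hadd H (\<pi> f1 x) (\<pi> f2 x)"
    and rep_scale: "\<lbrakk>f \<in> Cc; x \<in> hcarrier H\<rbrakk> \<Longrightarrow> \<pi> (\<lambda>g. c * f g) x = hscale H c (\<pi> f x)"
    and rep_conv: "\<lbrakk>f1 \<in> Cc; f2 \<in> Cc; x \<in> hcarrier H\<rbrakk> \<Longrightarrow> \<pi> (conv G f1 f2) x = \<pi> f1 (\<pi> f2 x)"
    and rep_star: "\<lbrakk>f \<in> Cc; x \<in> hcarrier H; y \<in> hcarrier H\<rbrakk> \<Longrightarrow>
          hinner H (\<pi> (star G f) x) y = hinner H x (\<pi> f y)"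
    and rep_unit: "x \<in> hcarrier H \<Longrightarrow> \<pi> (unit_fun G) x = x"

definition constant_vectors ::
  "'h hilbert_ops \<Rightarrow> 'g::topological_space groupoid_ops \<Rightarrow>
     (('g \<Rightarrow> complex) \<Rightarrow> 'h \<Rightarrow> 'h) \<Rightarrow> 'h set" where
  "constant_vectors H G \<pi> = {\<xi>\<in>hcarrier H. \<forall>f\<in>Cc. \<pi> f \<xi> = \<pi> (Psi G f) \<xi>}"

definition nonconstant_part ::
  "'h hilbert_ops \<Rightarrow> 'g::topological_space groupoid_ops \<Rightarrow>
     (('g \<Rightarrow> complex) \<Rightarrow> 'h \<Rightarrow> 'h) \<Rightarrow> 'h set" where
  "nonconstant_part H G \<pi> =
     {\<xi>\<in>hcarrier H. \<forall>\<eta>\<in>constant_vectors H G \<pi>. hinner H \<xi> \<eta> = 0}"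


section \<open>Property (T)\<close>

text \<open>\<open>K\<close> and \<open>c\<close> are as in property (T), for all Hilbert spaces with carrier in the type \<open>'h\<close>.\<close>

definition kazhdan_pair ::
  "'h itself \<Rightarrow> 'g::topological_space groupoid_ops \<Rightarrow> 'g set \<Rightarrow> real \<Rightarrow> bool" where
  "kazhdan_pair _ G K c \<longleftrightarrow> compact K \<and> c > 0 \<and>
     (\<forall>(H :: 'h hilbert_ops) \<pi>. representation H G \<pi> \<longrightarrow>
        (\<forall>\<xi>\<in>nonconstant_part H G \<pi>. \<exists>f\<in>Cc. support f \<subseteq> K \<and> I_norm G f \<le> 1 \<and>
           hnorm H (hdiff H (\<pi> f \<xi>) (\<pi> (Psi G f) \<xi>)) \<ge> c * hnorm H \<xi>))"

text \<open>
  The type \<open>nat \<Rightarrow> 'g \<Rightarrow> complex\<close> is large enough to contain a copy of every cyclic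
  representation. Hence nothing is lost by this choice: for an etale Hausdorff groupoid with
  compact unit space the theorem \<open>kazhdan_pair_universal\<close>
  below shows that the same \<open>K\<close> and \<open>c\<close> then work for Hilbert spaces in every type.
\<close>

definition property_T :: "'g::topological_space groupoid_ops \<Rightarrow> bool" where
  "property_T G \<longleftrightarrow> (\<exists>K c. kazhdan_pair TYPE(nat \<Rightarrow> 'g \<Rightarrow> complex) G K c)"


section \<open>Independence of the universe of Hilbert spaces\<close>

lemma (in topological_groupoid) star_Cc:
  assumes "f \<in> Cc" shows "star G f \<in> Cc"
proof -
  have inv_inv: "ginv G (ginv G g) = g" for g
  proof -
    have "ginv G (ginv G g) = gmult G (gmult G g (ginv G g)) (ginv G (ginv G g))"
      using rng_mult_left[of "ginv G (ginv G g)"] by (simp add: mult_inv_right rng_inv src_inv)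
    also have "\<dots> = gmult G g (gmult G (ginv G g) (ginv G (ginv G g)))"
      by (simp add: mult_assoc rng_inv src_inv)
    also have "\<dots> = g" by (simp add: mult_inv_right rng_inv mult_src_right)
    finally show ?thesis .
  qed
  have c: "continuous_on UNIV f" "compact (support f)"
    using assms by (auto simp: Cc_def)
  have "continuous_on UNIV (\<lambda>g. f (ginv G g))"
    using continuous_on_compose2[OF c(1) continuous_inv] by simp
  then have "continuous_on UNIV (star G f)"
    unfolding star_def by (intro continuous_intros)
  moreover have "compact (support (star G f))"
  proof -
    have eq: "ginv G ` support f = ginv G -` support f"
    proof (intro set_eqI iffI)
      fix g assume "g \<in> ginv G -` support f"
      then have "ginv G (ginv G g) \<in> ginv G ` support f" by (intro imageI) simp
      then show "g \<in> ginv G ` support f" by (simp only: inv_inv)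
    qed (auto simp: inv_inv)
    have "closed (ginv G ` support f)"
      unfolding eq using continuous_inv by (intro closed_vimage) (auto simp: support_def)
    moreover have "{g. star G f g \<noteq> 0} \<subseteq> ginv G ` support f"
    proof
      fix g assume "g \<in> {g. star G f g \<noteq> 0}"
      then have "ginv G g \<in> {g. f g \<noteq> 0}" by (simp add: star_def)
      then show "g \<in> ginv G ` support f"
        unfolding eq using closure_subset[of "{g. f g \<noteq> 0}"] by (auto simp: support_def)
    qed
    ultimately have "support (star G f) \<subseteq> ginv G ` support f"
      unfolding support_def[of "star G f"] by (rule closure_minimal[rotated])
    moreover have "compact (ginv G ` support f)"
      using c(2) by (intro compact_continuous_image continuous_on_subset[OF continuous_inv]) auto
    ultimately show ?thesis
      using compact_Int_closed[of "ginv G ` support f" "support (star G f)"]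
      by (simp add: Int_absorb1 support_def)
  qed
  ultimately show ?thesis by (simp add: Cc_def)
qed

lemma units_alt:
  assumes "groupoid G" shows "units G = {x. rng G x = x}"
  proof (intro set_eqI iffI)
  fix x assume "x \<in> {x. rng G x = x}"
  then have "rng G x = x" by simp
  then show "x \<in> units G" unfolding units_def by (metis rangeI)
qed (auto simp: units_def groupoid.rng_rng[OF assms])

lemma open_units:
  assumes "etale_groupoid G" shows "open (units G)"
proof -
  interpret etale_groupoid G by fact
  have "\<exists>V. open V \<and> u \<in> V \<and> V \<subseteq> units G" if u: "u \<in> units G" for u
  proof -
    obtain B where B: "open_bisection G B" "u \<in> B"
      using topological_basisE[OF basis_of_bisections open_UNIV, of u] by auto
    then have inj: "inj_on (rng G) B"
      unfolding open_bisection_def homeomorphism_def by (metis inj_onI)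
    have oB: "open B" using B by (simp add: open_bisection_def)
    have "open (rng G -` B)" by (rule open_vimage[OF oB continuous_rng])
    then have "open (B \<inter> rng G -` B)" using oB by (rule open_Int[rotated])
    moreover have "u \<in> B \<inter> rng G -` B"
      using u B units_alt[OF groupoid_axioms] by simp
    moreover have "B \<inter> rng G -` B \<subseteq> units G"
    proof
      fix g assume "g \<in> B \<inter> rng G -` B"
      then have "rng G g = g" using inj_onD[OF inj, of "rng G g" g] by (simp add: rng_rng)
      then show "g \<in> units G" using units_alt[OF groupoid_axioms] by simp
    qed
    ultimately show ?thesis by (rule_tac exI) (intro conjI)
  qed
  then show ?thesis by (subst open_subopen) simp
qed

lemma Psi_Cc:
  fixes G :: "'g::t2_space groupoid_ops"
  assumes f: "f \<in> Cc" and "etale_groupoid G" and cpt: "compact (units G)"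
  shows "Psi G f \<in> Cc"
proof -
  interpret etale_groupoid G by fact
  have ou: "open (units G)" by (rule open_units) fact
  have cl: "closed (units G)" using cpt by (rule compact_imp_closed)
  have fc: "continuous_on UNIV f" and fs: "compact (support f)"
    using f by (auto simp: Cc_def)
  have fsupp: "g \<in> support f" if "f g \<noteq> 0" for g
    using that closure_subset[of "{g. f g \<noteq> 0}"] by (auto simp: support_def)
  have "(Psi G f \<longlongrightarrow> Psi G f x) (nhds x)" if x: "x \<in> units G" for x
  proof -
    define S where "S = support f \<inter> range_fibre G x"
    have "closed (range_fibre G x)"
      using continuous_rng by (simp add: range_fibre_def closed_Collect_eq)
    then have Sc: "compact S" unfolding S_def using fs by (rule compact_Int_closed[rotated])
    have "\<forall>g. \<exists>B t. open_bisection G B \<and> g \<in> B \<and> homeomorphism B (rng G ` B) (rng G) t"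
    proof
      fix g
      obtain B where "open_bisection G B" "g \<in> B"
        using topological_basisE[OF basis_of_bisections open_UNIV, of g] by auto
      then show "\<exists>B t. open_bisection G B \<and> g \<in> B \<and> homeomorphism B (rng G ` B) (rng G) t"
        unfolding open_bisection_def by blast
    qed
    then obtain B t where B: "\<And>g. open_bisection G (B g)" "\<And>g. g \<in> B g"
      and t: "\<And>g. homeomorphism (B g) (rng G ` B g) (rng G) (t g)"
      by metis
    have oB: "open (B g)" and orB: "open (rng G ` B g)" for g
      using B(1)[of g] ou by (auto simp: open_bisection_def openin_open_eq)
    have tr: "t g (rng G h) = h" if "h \<in> B g" for g h
      using t[of g] that by (simp add: homeomorphism_def)
    have rt: "rng G (t g y) = y" "t g y \<in> B g" if "y \<in> rng G ` B g" for g y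
      using t[of g] that by (auto simp: homeomorphism_def)
    have xB: "x \<in> rng G ` B g" if "g \<in> S" for g
      using that B(2)[of g] by (auto simp: S_def range_fibre_def)
    have tx: "t g x = g" if "g \<in> S" for g
      using tr[OF B(2)[of g]] that by (simp add: S_def range_fibre_def)
    have "finite S"
    proof -
      obtain D where D: "D \<subseteq> S" "finite D" "S \<subseteq> (\<Union>g\<in>D. B g)"
        using compactE_image[OF Sc, of S B] oB B(2) by (metis UN_I subsetI)
      have "S \<subseteq> D"
      proof
        fix h assume h: "h \<in> S"
        then obtain g where g: "g \<in> D" "h \<in> B g" using D by blast
        then have "t g x = h" using tr[OF g(2)] h by (simp add: S_def range_fibre_def)
        then show "h \<in> D" using tx g D by auto
      qed
      then show ?thesis using D finite_subset by blast
    qed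
    have lim: "(t g \<longlongrightarrow> g) (nhds x)" if g: "g \<in> S" for g
    proof -
      have "isCont (t g) x"
        using t[of g] orB xB[OF g] unfolding homeomorphism_def
        by (metis continuous_on_eq_continuous_at)
      then show ?thesis
        using tx[OF g] tendsto_at_iff_tendsto_nhds[of "t g" x] by (simp add: isCont_def)
    qed
    have ev1: "\<forall>\<^sub>F y in nhds x. t g y \<noteq> t h y" if gh: "g \<in> S" "h \<in> S" "g \<noteq> h" for g h
    proof -
      obtain U V where UV: "open U" "open V" "g \<in> U" "h \<in> V" "U \<inter> V = {}"
        using hausdorff[OF gh(3)] by blast
      have "\<forall>\<^sub>F y in nhds x. t g y \<in> U" "\<forall>\<^sub>F y in nhds x. t h y \<in> V"
        using topological_tendstoD[OF lim[OF gh(1)] UV(1,3)]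
          topological_tendstoD[OF lim[OF gh(2)] UV(2,4)] by auto
      then show ?thesis by eventually_elim (use UV in auto)
    qed
    have ev_inj: "\<forall>\<^sub>F y in nhds x. \<forall>g\<in>S. \<forall>h\<in>S. g \<noteq> h \<longrightarrow> t g y \<noteq> t h y"
      using \<open>finite S\<close> ev1 by (simp add: eventually_ball_finite_distrib eventually_mono)
    have ev_dom: "\<forall>\<^sub>F y in nhds x. \<forall>g\<in>S. y \<in> rng G ` B g"
      using \<open>finite S\<close> orB xB by (simp add: eventually_ball_finite_distrib eventually_nhds_in_open)
    define L where "L = support f - (\<Union>g\<in>S. B g)"
    have "compact L" unfolding L_def using fs oB by (intro compact_diff) auto
    then have "closed (rng G ` L)"
      by (intro compact_imp_closed compact_continuous_image continuous_on_subset[OF continuous_rng]) auto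
    moreover have "x \<notin> rng G ` L"
      using B(2) by (auto simp: L_def S_def range_fibre_def)
    ultimately have ev_L: "\<forall>\<^sub>F y in nhds x. y \<in> - rng G ` L"
      by (intro eventually_nhds_in_open) auto
    have ev_u: "\<forall>\<^sub>F y in nhds x. y \<in> units G"
      using ou x by (rule eventually_nhds_in_open)
    have ev: "\<forall>\<^sub>F y in nhds x. (\<Sum>g\<in>S. f (t g y)) = Psi G f y"
      using ev_inj ev_dom ev_L ev_u
    proof eventually_elim
      case (elim y)
      have "Psi G f y = (\<Sum>\<^sub>\<infinity>g\<in>range_fibre G y. f g)" using elim by (simp add: Psi_def)
      also have "\<dots> = (\<Sum>\<^sub>\<infinity>g\<in>(\<lambda>g. t g y) ` S. f g)"
      proof (rule infsum_cong_neutral)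
        fix h assume h: "h \<in> range_fibre G y - (\<lambda>g. t g y) ` S"
        show "f h = 0"
        proof (rule ccontr)
          assume "f h \<noteq> 0"
          then have "h \<in> support f" by (rule fsupp)
          moreover have "rng G h = y" using h by (simp add: range_fibre_def)
          ultimately obtain g where "g \<in> S" "h \<in> B g" using elim(3) by (auto simp: L_def)
          then show False using tr[of h g] \<open>rng G h = y\<close> h by auto
        qed
      qed (use elim rt in \<open>auto simp: range_fibre_def\<close>)
      also have "\<dots> = sum f ((\<lambda>g. t g y) ` S)" using \<open>finite S\<close> by simp
      also have "\<dots> = (\<Sum>g\<in>S. f (t g y))"
        using elim(1) by (subst sum.reindex) (auto simp: inj_on_def)
      finally show ?case by simp
    qed
    have "((\<lambda>y. \<Sum>g\<in>S. f (t g y)) \<longlongrightarrow> (\<Sum>g\<in>S. f g)) (nhds x)"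
    proof (intro tendsto_sum)
      fix g assume g: "g \<in> S"
      have "isCont f g" using fc by (simp add: continuous_on_eq_continuous_at)
      then show "((\<lambda>y. f (t g y)) \<longlongrightarrow> f g) (nhds x)"
        using lim[OF g] by (rule isCont_tendsto_compose)
    qed
    moreover have "(\<Sum>g\<in>S. f g) = Psi G f x"
      using eventually_nhds_x_imp_x[OF ev] tx by simp
    ultimately show ?thesis using ev by (simp add: tendsto_cong)
  qed
  moreover have "(Psi G f \<longlongrightarrow> Psi G f x) (nhds x)" if "x \<notin> units G" for x
  proof -
    have "\<forall>\<^sub>F y in nhds x. y \<in> - units G"
      using cl that by (intro eventually_nhds_in_open) auto
    then have "\<forall>\<^sub>F y in nhds x. Psi G f y = Psi G f x"
      by eventually_elim (use that in \<open>simp add: Psi_def\<close>)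
    then show ?thesis by (rule tendsto_eventually)
  qed
  ultimately have "continuous_on UNIV (Psi G f)"
    by (auto simp: continuous_on_eq_continuous_at isCont_def tendsto_at_iff_tendsto_nhds)
  moreover have "support (Psi G f) \<subseteq> units G"
    unfolding support_def using cl by (intro closure_minimal) (auto simp: Psi_def split: if_splits)
  then have "compact (support (Psi G f))"
    using compact_Int_closed[OF cpt, of "support (Psi G f)"]
    by (simp add: Int_absorb1 support_def)
  ultimately show ?thesis by (simp add: Cc_def)
qed

context hilbert_space
begin

lemma inner_add_right:
  "\<lbrakk>x \<in> hcarrier H; y \<in> hcarrier H; z \<in> hcarrier H\<rbrakk> \<Longrightarrow>
     hinner H x (hadd H y z) = hinner H x y + hinner H x z"
  unfolding inner_cnj[OF add_closed, of y z x] inner_cnj[of y x] inner_cnj[of z x]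
  by (simp only: inner_add complex_cnj_add)

lemma inner_scale_right:
  "\<lbrakk>x \<in> hcarrier H; y \<in> hcarrier H\<rbrakk> \<Longrightarrow> hinner H x (hscale H c y) = cnj c * hinner H x y"
  unfolding inner_cnj[OF scale_closed, of y x c] inner_cnj[of y x]
  by (simp only: inner_scale complex_cnj_mult)

lemma inner_self: "x \<in> hcarrier H \<Longrightarrow> hinner H x x = complex_of_real ((hnorm H x)\<^sup>2)"
  using arg_cong[OF inner_cnj[of x x], of Im] inner_nonneg[of x]
  by (intro complex_eqI) (simp_all add: hnorm_def)

lemma diff_closed: "\<lbrakk>x \<in> hcarrier H; y \<in> hcarrier H\<rbrakk> \<Longrightarrow> hdiff H x y \<in> hcarrier H"
  by (simp add: hdiff_def add_closed scale_closed)

lemmas inner_simps = inner_add inner_scale inner_add_right inner_scale_right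
  add_closed scale_closed diff_closed

lemma norm_nonneg: "x \<in> hcarrier H \<Longrightarrow> 0 \<le> hnorm H x"
  by (simp add: hnorm_def inner_nonneg)

lemma norm_eqI:
  "hinner H x x = hinner H y y \<Longrightarrow> hnorm H x = hnorm H y"
  by (simp add: hnorm_def)

lemma norm_scale:
  assumes "x \<in> hcarrier H" shows "hnorm H (hscale H c x) = cmod c * hnorm H x"
proof -
  have "hinner H (hscale H c x) (hscale H c x) = (c * cnj c) * hinner H x x"
    using assms by (simp add: inner_simps)
  also have "\<dots> = complex_of_real ((cmod c)\<^sup>2 * (hnorm H x)\<^sup>2)"
    using assms by (simp add: inner_self flip: complex_norm_square)
  finally have "hinner H (hscale H c x) (hscale H c x) = \<dots>" .
  then show ?thesis
    unfolding hnorm_def[of H "hscale H c x"] using norm_nonneg[OF assms]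
    by (simp add: real_sqrt_mult del: of_real_mult of_real_power)
qed

lemma norm_triangle:
  assumes x: "x \<in> hcarrier H" and y: "y \<in> hcarrier H"
  shows "hnorm H (hadd H x y) \<le> hnorm H x + hnorm H y"
proof -
  define r where "r = Re (hinner H x y)"
  have exp: "Re (hinner H (hadd H x (hscale H (of_real t) y)) (hadd H x (hscale H (of_real t) y)))
             = (hnorm H x)\<^sup>2 + 2 * t * r + t\<^sup>2 * (hnorm H y)\<^sup>2" for t :: real
    using x y inner_cnj[OF x y] inner_self[OF x] inner_self[OF y]
    by (simp add: inner_simps r_def algebra_simps power2_eq_square)
  have pos: "0 \<le> (hnorm H x)\<^sup>2 + 2 * t * r + t\<^sup>2 * (hnorm H y)\<^sup>2" for t :: real
    unfolding exp[symmetric] using x y by (intro inner_nonneg) (simp add: inner_simps)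
  have r: "r \<le> hnorm H x * hnorm H y"
  proof (cases "hnorm H y = 0")
    case True
    have "r = 0"
    proof (rule ccontr)
      assume "r \<noteq> 0"
      have "0 \<le> (hnorm H x)\<^sup>2 + 2 * (- ((hnorm H x)\<^sup>2 + 1) / (2 * r)) * r"
        using pos[of "- ((hnorm H x)\<^sup>2 + 1) / (2 * r)"] True by simp
      moreover have "2 * (- ((hnorm H x)\<^sup>2 + 1) / (2 * r)) * r = - ((hnorm H x)\<^sup>2 + 1)"
        using \<open>r \<noteq> 0\<close> by simp
      ultimately show False by linarith
    qed
    then show ?thesis using True by simp
  next
    case False
    let ?n = "hnorm H x" and ?m = "hnorm H y"
    have m: "?m > 0" using False norm_nonneg[OF y] by simp
    have "0 \<le> ?n\<^sup>2 + 2 * (- r / ?m\<^sup>2) * r + (- r / ?m\<^sup>2)\<^sup>2 * ?m\<^sup>2" by (rule pos)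
    also have "\<dots> = ?n\<^sup>2 - r\<^sup>2 / ?m\<^sup>2"
      using m by (simp add: field_simps power2_eq_square)
    finally have "r\<^sup>2 \<le> (?n * ?m)\<^sup>2"
      using m by (simp add: field_simps power_mult_distrib)
    then show ?thesis
      using norm_nonneg[OF x] m by (intro power2_le_imp_le[of r "?n * ?m"]) auto
  qed
  have "(hnorm H (hadd H x y))\<^sup>2 = (hnorm H x)\<^sup>2 + 2 * r + (hnorm H y)\<^sup>2"
    using x y inner_cnj[OF x y] inner_self[OF x] inner_self[OF y] inner_self[of "hadd H x y"]
    by (simp add: inner_simps r_def complex_eq_iff)
  also have "\<dots> \<le> (hnorm H x + hnorm H y)\<^sup>2"
    using r by (simp add: power2_sum)
  finally show ?thesis
    by (rule power2_le_imp_le) (simp add: norm_nonneg x y)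
qed

abbreviation hdist where "hdist x y \<equiv> hnorm H (hdiff H x y)"

lemma dist_triangle:
  assumes "x \<in> hcarrier H" "y \<in> hcarrier H" "z \<in> hcarrier H"
  shows "hdist x z \<le> hdist x y + hdist y z"
proof -
  have "hdist x z = hnorm H (hadd H (hdiff H x y) (hdiff H y z))"
    by (rule norm_eqI) (use assms in \<open>simp add: hdiff_def inner_simps\<close>)
  then show ?thesis using norm_triangle assms by (simp add: diff_closed)
qed

lemma dist_commute:
  assumes "x \<in> hcarrier H" "y \<in> hcarrier H" shows "hdist x y = hdist y x"
  by (rule norm_eqI) (use assms in \<open>simp add: hdiff_def inner_simps\<close>)

lemma dist_add:
  assumes "x \<in> hcarrier H" "y \<in> hcarrier H" "x' \<in> hcarrier H" "y' \<in> hcarrier H"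
  shows "hdist (hadd H x y) (hadd H x' y') \<le> hdist x x' + hdist y y'"
proof -
  have "hdist (hadd H x y) (hadd H x' y') = hnorm H (hadd H (hdiff H x x') (hdiff H y y'))"
    by (rule norm_eqI) (use assms in \<open>simp add: hdiff_def inner_simps\<close>)
  then show ?thesis using norm_triangle assms by (simp add: diff_closed)
qed

lemma dist_scale:
  assumes "x \<in> hcarrier H" "y \<in> hcarrier H"
  shows "hdist (hscale H c x) (hscale H c y) = cmod c * hdist x y"
proof -
  have "hdist (hscale H c x) (hscale H c y) = hnorm H (hscale H c (hdiff H x y))"
    by (rule norm_eqI) (use assms in \<open>simp add: hdiff_def inner_simps algebra_simps\<close>)
  then show ?thesis using norm_scale assms by (simp add: diff_closed)
qed

lemma dist_bounded:
  assumes "bounded_operator H T"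
  obtains C where "C > 0"
    "\<And>x y. x \<in> hcarrier H \<Longrightarrow> y \<in> hcarrier H \<Longrightarrow> hdist (T x) (T y) \<le> C * hdist x y"
proof -
  obtain C where C: "\<And>x. x \<in> hcarrier H \<Longrightarrow> hnorm H (T x) \<le> C * hnorm H x"
    using assms unfolding bounded_operator_def by blast
  have "hdist (T x) (T y) \<le> max C 1 * hdist x y" if "x \<in> hcarrier H" "y \<in> hcarrier H" for x y
  proof -
    have "hdiff H (T x) (T y) = T (hdiff H x y)"
      using assms that by (simp add: hdiff_def bounded_operator_def scale_closed)
    then have "hdist (T x) (T y) \<le> C * hdist x y"
      using C diff_closed that by simp
    also have "\<dots> \<le> max C 1 * hdist x y"
      using norm_nonneg diff_closed that by (simp add: mult_right_mono)
    finally show ?thesis .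
  qed
  then show ?thesis by (intro that[of "max C 1"]) auto
qed

lemma dist_self: "x \<in> hcarrier H \<Longrightarrow> hdist x x = 0"
  by (simp add: hnorm_def hdiff_def inner_simps)

lemma dist_zeroD:
  assumes x: "x \<in> hcarrier H" and y: "y \<in> hcarrier H" and "hdist x y = 0"
  shows "x = y"
proof -
  have "hinner H (hdiff H x y) (hdiff H x y) = 0"
    using assms inner_self[OF diff_closed[OF x y]] by simp
  then have z: "hadd H x (hscale H (-1) y) = hzero H"
    using inner_definite diff_closed x y unfolding hdiff_def by blast
  have "x = hadd H x (hadd H (hscale H (-1) y) y)"
    using x y add_commute[of "hscale H (-1) y" y] by (simp add: add_neg add_zero scale_closed)
  also have "\<dots> = hadd H (hadd H x (hscale H (-1) y)) y"
    using x y by (simp add: add_assoc scale_closed)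
  also have "\<dots> = y"
    unfolding z using y add_commute[OF zero_closed y] by (simp add: add_zero)
  finally show ?thesis .
qed

end

text \<open>\<open>transport M \<phi> H\<close> is the subspace \<open>M\<close> of \<open>H\<close>, moved to another type along an injection.\<close>

definition transport :: "'h set \<Rightarrow> ('h \<Rightarrow> 'k) \<Rightarrow> 'h hilbert_ops \<Rightarrow> 'k hilbert_ops" where
  "transport M \<phi> H = (let \<psi> = inv_into M \<phi> in
     \<lparr>hcarrier = \<phi> ` M, hzero = \<phi> (hzero H), hadd = (\<lambda>x y. \<phi> (hadd H (\<psi> x) (\<psi> y))),
      hscale = (\<lambda>c x. \<phi> (hscale H c (\<psi> x))), hinner = (\<lambda>x y. hinner H (\<psi> x) (\<psi> y))\<rparr>)"

context representation
begin

definition invariant_subspace :: "'h set \<Rightarrow> bool" where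
  "invariant_subspace M \<longleftrightarrow> M \<subseteq> hcarrier H \<and> hzero H \<in> M \<and>
     (\<forall>x\<in>M. \<forall>y\<in>M. hadd H x y \<in> M) \<and> (\<forall>c. \<forall>x\<in>M. hscale H c x \<in> M) \<and>
     (\<forall>f\<in>Cc. \<forall>x\<in>M. \<pi> f x \<in> M) \<and>
     (\<forall>x\<in>hcarrier H. (\<forall>e>0. \<exists>y\<in>M. hdist y x < e) \<longrightarrow> x \<in> M)"

lemma representation_transport:
  fixes \<phi> :: "'h \<Rightarrow> 'k"
  assumes "topological_groupoid G" and M: "invariant_subspace M" and inj: "inj_on \<phi> M"
  shows "representation (transport M \<phi> H) G (\<lambda>f x. \<phi> (\<pi> f (inv_into M \<phi> x)))"
proof -
  let ?H = "transport M \<phi> H"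
  define \<psi> where "\<psi> = inv_into M \<phi>"
  have psi: "\<psi> (\<phi> x) = x" if "x \<in> M" for x
    using inj that by (simp add: \<psi>_def)
  have sel: "hcarrier ?H = \<phi> ` M" "hzero ?H = \<phi> (hzero H)"
    "hadd ?H = (\<lambda>x y. \<phi> (hadd H (\<psi> x) (\<psi> y)))"
    "hscale ?H = (\<lambda>c x. \<phi> (hscale H c (\<psi> x)))" "hinner ?H = (\<lambda>x y. hinner H (\<psi> x) (\<psi> y))"
    by (simp_all add: transport_def Let_def \<psi>_def)
  have MH: "x \<in> hcarrier H" if "x \<in> M" for x
    using M that by (auto simp: invariant_subspace_def)
  have z: "hzero H \<in> M" and a: "\<And>x y. \<lbrakk>x \<in> M; y \<in> M\<rbrakk> \<Longrightarrow> hadd H x y \<in> M"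
    and s: "\<And>c x. x \<in> M \<Longrightarrow> hscale H c x \<in> M" and p: "\<And>f x. \<lbrakk>f \<in> Cc; x \<in> M\<rbrakk> \<Longrightarrow> \<pi> f x \<in> M"
    and cl: "\<And>x. x \<in> hcarrier H \<Longrightarrow> (\<And>e. e > 0 \<Longrightarrow> \<exists>y\<in>M. hdist y x < e) \<Longrightarrow> x \<in> M"
    using M by (auto simp: invariant_subspace_def)
  have d: "hnorm ?H (hdiff ?H x y) = hdist (\<psi> x) (\<psi> y)" if "x \<in> \<phi> ` M" "y \<in> \<phi> ` M" for x y
    using that by (auto simp: hnorm_def hdiff_def sel psi a s)
  have nrm: "hnorm ?H x = hnorm H (\<psi> x)" for x
    by (simp add: hnorm_def sel)
  note [simp] = sel psi z a s p MH
  have hs: "hilbert_space ?H"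
  proof (unfold_locales, goal_cases)
    case (17 X)
    have X: "\<psi> (X n) \<in> M" "X n \<in> \<phi> ` M" for n
      using 17(1)[of n] by auto
    have "\<exists>x\<in>hcarrier H. (\<lambda>n. hdist (\<psi> (X n)) x) \<longlonglongrightarrow> 0"
      by (rule complete) (use 17(2) X in \<open>auto simp: d\<close>)
    then obtain x where x: "x \<in> hcarrier H" "(\<lambda>n. hdist (\<psi> (X n)) x) \<longlonglongrightarrow> 0" by blast
    have "x \<in> M"
    proof (rule cl[OF x(1)])
      fix e :: real assume "e > 0"
      then obtain n where "hdist (\<psi> (X n)) x < e"
        using order_tendstoD(2)[OF x(2)] by (auto simp: eventually_sequentially)
      then show "\<exists>y\<in>M. hdist y x < e" using X by blast
    qed
    with x(2) X have "\<phi> x \<in> hcarrier ?H" "(\<lambda>n. hnorm ?H (hdiff ?H (X n) (\<phi> x))) \<longlonglongrightarrow> 0"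
      by (simp_all add: d)
    then show ?case by blast
  qed (auto simp: add_assoc add_zero add_neg scale_add add_scale scale_scale scale_one
        inner_add inner_scale inner_nonneg
        intro!: arg_cong[where f=\<phi>] intro: add_commute inner_cnj inner_definite)
  have b: "bounded_operator H (\<pi> f)" if "f \<in> Cc" for f
    using bounded that .
  have "representation_axioms ?H G (\<lambda>f x. \<phi> (\<pi> f (\<psi> x)))"
  proof (unfold_locales, goal_cases)
    case (1 f)
    obtain C where "\<forall>x\<in>hcarrier H. hnorm H (\<pi> f x) \<le> C * hnorm H x"
      using b[OF 1] unfolding bounded_operator_def by blast
    then have "\<exists>C. \<forall>x\<in>hcarrier ?H. hnorm ?H (\<phi> (\<pi> f (\<psi> x))) \<le> C * hnorm ?H x"
      using 1 by (intro exI[of _ C]) (auto simp: nrm)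
    with b[OF 1] 1 show ?case
      unfolding bounded_operator_def by auto
  qed (auto simp: rep_add rep_scale rep_conv rep_star rep_unit
        topological_groupoid.star_Cc[OF assms(1)])
  then show ?thesis
    using hs by (simp add: representation_def \<psi>_def)
qed

inductive_set algebraic_span :: "'h \<Rightarrow> 'h set" for \<xi> where
  span_base: "\<xi> \<in> algebraic_span \<xi>"
| span_comb: "\<lbrakk>x \<in> algebraic_span \<xi>; y \<in> algebraic_span \<xi>\<rbrakk> \<Longrightarrow>
    hadd H (hscale H c x) (hscale H d y) \<in> algebraic_span \<xi>"
| span_rep: "\<lbrakk>f \<in> Cc; x \<in> algebraic_span \<xi>\<rbrakk> \<Longrightarrow> \<pi> f x \<in> algebraic_span \<xi>"

definition cyclic_subspace :: "'h \<Rightarrow> 'h set" where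
  "cyclic_subspace \<xi> = {x\<in>hcarrier H. \<forall>e>0. \<exists>y\<in>algebraic_span \<xi>. hdist y x < e}"

lemma algebraic_span_closed:
  assumes "\<xi> \<in> hcarrier H" "x \<in> algebraic_span \<xi>" shows "x \<in> hcarrier H"
  using assms(2,1)
proof induction
  case (span_rep f x)
  then show ?case using bounded[of f] by (auto simp: bounded_operator_def)
qed (auto intro: add_closed scale_closed)

lemma algebraic_span_add:
  assumes "\<xi> \<in> hcarrier H" "x \<in> algebraic_span \<xi>" "y \<in> algebraic_span \<xi>"
  shows "hadd H x y \<in> algebraic_span \<xi>"
  using span_comb[OF assms(2,3), of 1 1] algebraic_span_closed[OF assms(1)] assms
  by (simp add: scale_one)

lemma algebraic_span_scale:
  assumes "\<xi> \<in> hcarrier H" "x \<in> algebraic_span \<xi>"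
  shows "hscale H c x \<in> algebraic_span \<xi>"
  using span_comb[OF assms(2,2), of c 0] algebraic_span_closed[OF assms]
  by (simp flip: add_scale)

lemma cyclic_subspaceI:
  assumes "x \<in> hcarrier H" "\<And>e. e > 0 \<Longrightarrow> \<exists>y\<in>algebraic_span \<xi>. hdist y x < e"
  shows "x \<in> cyclic_subspace \<xi>"
  using assms by (simp add: cyclic_subspace_def)

lemma cyclic_subspaceD:
  assumes "x \<in> cyclic_subspace \<xi>" "e > 0"
  obtains y where "y \<in> algebraic_span \<xi>" "hdist y x < e"
  using assms by (auto simp: cyclic_subspace_def)

lemma span_subset_cyclic:
  assumes "\<xi> \<in> hcarrier H" shows "algebraic_span \<xi> \<subseteq> cyclic_subspace \<xi>"
proof
  fix x assume x: "x \<in> algebraic_span \<xi>"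
  then have "x \<in> hcarrier H" by (rule algebraic_span_closed[OF assms])
  with x show "x \<in> cyclic_subspace \<xi>"
    by (metis cyclic_subspaceI dist_self)
qed

lemma invariant_cyclic_subspace:
  assumes xi: "\<xi> \<in> hcarrier H" shows "invariant_subspace (cyclic_subspace \<xi>)"
proof -
  note sp = algebraic_span_closed[OF xi]
  have H: "x \<in> hcarrier H" if "x \<in> cyclic_subspace \<xi>" for x
    using that by (simp add: cyclic_subspace_def)
  have "hscale H 0 \<xi> \<in> algebraic_span \<xi>"
    using xi by (intro algebraic_span_scale span_base)
  moreover have "hscale H 0 \<xi> = hzero H"
    using add_scale[OF xi, of 1 "-1"] add_neg[OF xi] xi by (simp add: scale_one)
  ultimately have z: "hzero H \<in> cyclic_subspace \<xi>"
    using span_subset_cyclic[OF xi] by auto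
  have a: "hadd H x y \<in> cyclic_subspace \<xi>"
    if x: "x \<in> cyclic_subspace \<xi>" and y: "y \<in> cyclic_subspace \<xi>" for x y
  proof (rule cyclic_subspaceI)
    fix e :: real assume "e > 0"
    then obtain x' y' where *: "x' \<in> algebraic_span \<xi>" "hdist x' x < e/2"
      "y' \<in> algebraic_span \<xi>" "hdist y' y < e/2"
      using x y by (meson cyclic_subspaceD half_gt_zero)
    then have "hdist (hadd H x' y') (hadd H x y) < e"
      using dist_add[of x' y' x y] sp H x y by fastforce
    then show "\<exists>w\<in>algebraic_span \<xi>. hdist w (hadd H x y) < e"
      using algebraic_span_add[OF xi] * by blast
  qed (use x y H add_closed in auto)
  have s: "hscale H c x \<in> cyclic_subspace \<xi>" if x: "x \<in> cyclic_subspace \<xi>" for c x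
  proof (rule cyclic_subspaceI)
    fix e :: real assume "e > 0"
    then have "e / (cmod c + 1) > 0" by (simp add: add_nonneg_pos)
    with x obtain x' where *: "x' \<in> algebraic_span \<xi>" "hdist x' x < e / (cmod c + 1)"
      by (rule cyclic_subspaceD)
    have n: "0 \<le> hdist x' x" using * sp H x by (simp add: norm_nonneg diff_closed)
    have "hdist (hscale H c x') (hscale H c x) = cmod c * hdist x' x"
      using * sp H x by (simp add: dist_scale)
    also have "\<dots> \<le> (cmod c + 1) * hdist x' x" using n by (simp add: algebra_simps)
    also have "\<dots> < e"
      using *(2) by (simp add: pos_less_divide_eq add_nonneg_pos mult.commute)
    finally show "\<exists>w\<in>algebraic_span \<xi>. hdist w (hscale H c x) < e"
      using algebraic_span_scale[OF xi] * by blast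
  qed (use x H scale_closed in auto)
  have p: "\<pi> f x \<in> cyclic_subspace \<xi>" if f: "f \<in> Cc" and x: "x \<in> cyclic_subspace \<xi>" for f x
  proof (rule cyclic_subspaceI)
    show "\<pi> f x \<in> hcarrier H"
      using bounded[OF f] H[OF x] by (simp add: bounded_operator_def)
    fix e :: real assume "e > 0"
    obtain C where C: "C > 0"
      "\<And>x y. x \<in> hcarrier H \<Longrightarrow> y \<in> hcarrier H \<Longrightarrow> hdist (\<pi> f x) (\<pi> f y) \<le> C * hdist x y"
      using dist_bounded[OF bounded[OF f]] by blast
    have "e / C > 0" using \<open>e > 0\<close> C by simp
    with x obtain x' where *: "x' \<in> algebraic_span \<xi>" "hdist x' x < e / C"
      by (rule cyclic_subspaceD)
    have "hdist (\<pi> f x') (\<pi> f x) \<le> C * hdist x' x" using C * sp H x by blast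
    also have "\<dots> < e" using *(2) C by (simp add: field_simps)
    finally show "\<exists>w\<in>algebraic_span \<xi>. hdist w (\<pi> f x) < e"
      using span_rep[OF f] * by blast
  qed
  have c: "x \<in> cyclic_subspace \<xi>"
    if x: "x \<in> hcarrier H" and ap: "\<And>e. e > 0 \<Longrightarrow> \<exists>y\<in>cyclic_subspace \<xi>. hdist y x < e" for x
  proof (rule cyclic_subspaceI[OF x])
    fix e :: real assume "e > 0"
    then obtain y where y: "y \<in> cyclic_subspace \<xi>" "hdist y x < e/2" using ap half_gt_zero by blast
    obtain w where w: "w \<in> algebraic_span \<xi>" "hdist w y < e/2"
      using cyclic_subspaceD[OF y(1) half_gt_zero[OF \<open>e > 0\<close>]] by blast
    have "hdist w x < e"
      using dist_triangle[of w y x] w y sp H x by fastforce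
    then show "\<exists>w\<in>algebraic_span \<xi>. hdist w x < e" using w by blast
  qed
  show ?thesis
    unfolding invariant_subspace_def using H z a s p c by blast
qed

lemma algebraic_span_card:
  includes cardinal_syntax
  shows "|algebraic_span \<xi>| \<le>o |UNIV :: ('g \<Rightarrow> complex) set|"
proof -
  let ?U = "UNIV :: ('g \<Rightarrow> complex) set"
  define step where "step W = (\<lambda>(c, d, x, y). hadd H (hscale H c x) (hscale H d y)) `
     (UNIV \<times> UNIV \<times> W \<times> W) \<union> (\<lambda>(f, x). \<pi> f x) ` (Cc \<times> W) \<union> W" for W
  define W where "W n = (step ^^ n) {\<xi>}" for n :: nat
  have injc: "inj (\<lambda>(c::complex) (_::'g). c)" by (auto simp: inj_def fun_eq_iff)
  have cU: "|UNIV :: complex set| \<le>o |?U|"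
    using injc by (meson card_of_ordLeq subset_UNIV)
  have inf: "infinite ?U"
    using injc by (metis finite_imageD finite_subset infinite_UNIV_char_0 subset_UNIV)
  note tim = card_of_Times_ordLeq_infinite_Field[OF _ _ _ card_of_Card_order, of ?U,
      unfolded Field_card_of, OF inf]
  note un = card_of_Un_ordLeq_infinite_Field[OF _ _ _ card_of_Card_order, of ?U,
      unfolded Field_card_of, OF inf]
  have U1: "|{\<xi>}| \<le>o |?U|" by (metis UNIV_not_empty card_of_singl_ordLeq)
  have Wc: "|W n| \<le>o |?U|" for n
  proof (induction n)
    case 0
    then show ?case using U1 by (simp add: W_def)
  next
    case (Suc n)
    have "|Cc :: ('g \<Rightarrow> complex) set| \<le>o |?U|" by (simp add: card_of_mono1)
    then have "|(Cc :: ('g \<Rightarrow> complex) set) \<times> W n| \<le>o |?U|"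
      using Suc by (intro tim)
    moreover have "|(UNIV :: complex set) \<times> (UNIV :: complex set) \<times> W n \<times> W n| \<le>o |?U|"
      using Suc cU by (intro tim)
    ultimately have "|step (W n)| \<le>o |?U|"
      unfolding step_def using Suc by (intro un ordLeq_transitive[OF card_of_image])
    then show ?case by (simp add: W_def)
  qed
  have "|\<Union>n. W n| \<le>o |?U|"
    using inf Wc by (intro card_of_UNION_ordLeq_infinite) (auto simp: infinite_iff_card_of_nat)
  moreover have "algebraic_span \<xi> \<subseteq> (\<Union>n. W n)"
  proof
    have mono: "W m \<subseteq> W n" if "m \<le> n" for m n
      by (rule lift_Suc_mono_le[OF _ that]) (auto simp: W_def step_def)
    fix x assume "x \<in> algebraic_span \<xi>"
    then show "x \<in> (\<Union>n. W n)"
    proof induction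
      case span_base
      have "\<xi> \<in> W 0" by (simp add: W_def)
      then show ?case by blast
    next
      case (span_comb x y c d)
      then obtain m n where mn: "x \<in> W m" "y \<in> W n" by blast
      then have "x \<in> W (max m n)" "y \<in> W (max m n)"
        using mono by (meson max.cobounded1 max.cobounded2 subsetD)+
      then have "hadd H (hscale H c x) (hscale H d y) \<in> W (Suc (max m n))"
        by (force simp: W_def step_def)
      then show ?case by blast
    next
      case (span_rep f x)
      then obtain n where "x \<in> W n" by blast
      then have "\<pi> f x \<in> W (Suc n)" using span_rep by (force simp: W_def step_def)
      then show ?case by blast
    qed
  qed
  ultimately show ?thesis
    using card_of_mono1 ordLeq_transitive by blast
qed

lemma cyclic_subspace_inj:
  assumes xi: "\<xi> \<in> hcarrier H"
  obtains \<phi> :: "'h \<Rightarrow> nat \<Rightarrow> 'g \<Rightarrow> complex" where "inj_on \<phi> (cyclic_subspace \<xi>)"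
proof -
  obtain j :: "'h \<Rightarrow> 'g \<Rightarrow> complex" where j: "inj_on j (algebraic_span \<xi>)"
    using algebraic_span_card card_of_ordLeq by metis
  have "\<forall>x\<in>cyclic_subspace \<xi>. \<forall>n::nat. \<exists>y\<in>algebraic_span \<xi>. hdist y x < 1 / real (Suc n)"
    by (simp add: cyclic_subspace_def)
  then obtain X where X: "\<And>x n. x \<in> cyclic_subspace \<xi> \<Longrightarrow> X x n \<in> algebraic_span \<xi>"
    "\<And>x n. x \<in> cyclic_subspace \<xi> \<Longrightarrow> hdist (X x n) x < 1 / real (Suc n)"
    by metis
  have "inj_on (\<lambda>x n. j (X x n)) (cyclic_subspace \<xi>)"
  proof (rule inj_onI)
    fix x y assume x: "x \<in> cyclic_subspace \<xi>" and y: "y \<in> cyclic_subspace \<xi>"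
      and "(\<lambda>n. j (X x n)) = (\<lambda>n. j (X y n))"
    then have eq: "X x n = X y n" for n
      using j X(1) by (meson inj_onD fun_cong)
    have H: "x \<in> hcarrier H" "y \<in> hcarrier H" "X x n \<in> hcarrier H" for n
      using x y X(1) algebraic_span_closed[OF xi] by (auto simp: cyclic_subspace_def)
    have le: "hdist x y \<le> 2 / real (Suc n)" for n
    proof -
      have "hdist x y \<le> hdist (X x n) x + hdist (X x n) y"
        using dist_triangle[of x "X x n" y] dist_commute[of x "X x n"] H by simp
      also have "\<dots> \<le> 2 / real (Suc n)"
        using X(2)[OF x, of n] X(2)[OF y, of n] unfolding eq[symmetric] by simp
      finally show ?thesis .
    qed
    have "(\<lambda>n. 2 / real (Suc n)) \<longlonglongrightarrow> 0"
      by (intro tendsto_divide_0[OF tendsto_const] filterlim_compose[OF filterlim_real_sequentially filterlim_Suc]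
          filterlim_at_top_imp_at_infinity)
    then have "hdist x y \<le> 0"
      by (rule LIMSEQ_le_const) (use le in blast)
    then show "x = y"
      using dist_zeroD[of x y] norm_nonneg[of "hdiff H x y"] diff_closed H by force
  qed
  then show ?thesis by (rule that)
qed

end

theorem kazhdan_pair_universal:
  fixes G :: "'g::t2_space groupoid_ops"
  assumes "etale_groupoid G" and "compact (units G)"
    and kp: "kazhdan_pair TYPE(nat \<Rightarrow> 'g \<Rightarrow> complex) G K c"
  shows "kazhdan_pair TYPE('h) G K c"
proof -
  interpret etale_groupoid G by fact
  note Psi_Cc = Psi_Cc[OF _ assms(1,2)]
  have "\<exists>f\<in>Cc. support f \<subseteq> K \<and> I_norm G f \<le> 1 \<and>
          hnorm H (hdiff H (\<pi> f \<xi>) (\<pi> (Psi G f) \<xi>)) \<ge> c * hnorm H \<xi>"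
    if rep: "representation H G \<pi>" and xi: "\<xi> \<in> nonconstant_part H G \<pi>"
    for H :: "'h hilbert_ops" and \<pi> \<xi>
  proof -
    interpret representation H G \<pi> by fact
    have xH: "\<xi> \<in> hcarrier H" using xi by (simp add: nonconstant_part_def)
    let ?M = "cyclic_subspace \<xi>"
    obtain \<phi> :: "'h \<Rightarrow> nat \<Rightarrow> 'g \<Rightarrow> complex" where inj: "inj_on \<phi> ?M"
      using cyclic_subspace_inj[OF xH] .
    let ?\<psi> = "inv_into ?M \<phi>" and ?H = "transport ?M \<phi> H"
    let ?\<pi> = "\<lambda>f x. \<phi> (\<pi> f (?\<psi> x))"
    have inv: "invariant_subspace ?M" by (rule invariant_cyclic_subspace[OF xH])
    have rep': "representation ?H G ?\<pi>"
      by (rule representation_transport[OF topological_groupoid_axioms inv inj])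
    have xM: "\<xi> \<in> ?M" using span_subset_cyclic[OF xH] span_base by blast
    have psi: "?\<psi> (\<phi> x) = x" if "x \<in> ?M" for x using inj that by simp
    have pM: "\<pi> f x \<in> ?M" if "f \<in> Cc" "x \<in> ?M" for f x
      using inv that by (auto simp: invariant_subspace_def)
    have "\<phi> \<xi> \<in> nonconstant_part ?H G ?\<pi>"
      unfolding nonconstant_part_def
    proof (intro CollectI conjI ballI)
      show "\<phi> \<xi> \<in> hcarrier ?H" using xM by (simp add: transport_def Let_def)
      fix \<eta> assume eta: "\<eta> \<in> constant_vectors ?H G ?\<pi>"
      then obtain y where y: "\<eta> = \<phi> y" "y \<in> ?M"
        by (auto simp: constant_vectors_def transport_def Let_def)
      have "\<pi> f y = \<pi> (Psi G f) y" if "f \<in> Cc" for f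
        using eta that inj pM Psi_Cc y psi by (auto simp: constant_vectors_def dest: inj_onD)
      moreover have "y \<in> hcarrier H" using y by (simp add: cyclic_subspace_def)
      ultimately have "y \<in> constant_vectors H G \<pi>"
        by (simp add: constant_vectors_def)
      then have "hinner H \<xi> y = 0" using xi by (simp add: nonconstant_part_def)
      then show "hinner ?H (\<phi> \<xi>) \<eta> = 0"
        using xM y psi by (simp add: transport_def Let_def)
    qed
    then obtain f where f: "f \<in> Cc" "support f \<subseteq> K" "I_norm G f \<le> 1"
      and le: "hnorm ?H (hdiff ?H (?\<pi> f (\<phi> \<xi>)) (?\<pi> (Psi G f) (\<phi> \<xi>))) \<ge> c * hnorm ?H (\<phi> \<xi>)"
      using kp rep' unfolding kazhdan_pair_def by blast
    have "hnorm ?H (\<phi> \<xi>) = hnorm H \<xi>"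
      using psi xM by (simp add: hnorm_def transport_def Let_def)
    moreover have "hnorm ?H (hdiff ?H (?\<pi> f (\<phi> \<xi>)) (?\<pi> (Psi G f) (\<phi> \<xi>))) =
        hnorm H (hdiff H (\<pi> f \<xi>) (\<pi> (Psi G f) \<xi>))"
      using psi xM pM f(1) Psi_Cc inv
      by (simp add: hnorm_def hdiff_def transport_def Let_def invariant_subspace_def)
    ultimately show ?thesis using f le by auto
  qed
  then show ?thesis
    using kp unfolding kazhdan_pair_def by blast
qed

end

theory Submission
  imports Defs
begin

text \<open>
  Let \<open>F\<close> be proper and of negative type. By Schoenberg's theorem \<open>\<phi> = exp (- t F)\<close> is of positive
  type, and with the invariant measure \<open>\<mu>\<close> the functional \<open>f \<mapsto> \<integral> \<Sum>\<^sub>g f(g) \<phi>(g)\<close> is a state on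
  the convolution algebra, whose GNS vector \<open>\<xi>\<close> is almost constant when \<open>t\<close> is small. Property (T)
  then puts \<open>\<xi>\<close> close to the constant vectors, so that \<open>\<integral> \<Sum>\<^sub>g f(g) (1 - \<phi>(g))\<close> is small
  for every \<open>f \<ge> 0\<close> with range and source sums at most \<open>1\<close>. But \<open>\<phi> \<le> 1/2\<close> outside a compact set,
  which meets all fibres in boundedly many points. If all fibres were infinite, one could spread \<open>f\<close>
  so thinly that this compact set carries little of its mass, although the total mass is at least
  \<open>1/2\<close>: a contradiction. So some fibre is finite; by minimality its finite orbit is the whole
  unit space, and \<open>G\<close> is finite.
\<close>

section \<open>Positive semidefinite kernels\<close>

text \<open>Property (T) only tests functions supported in \<open>K\<close>, whereas the
  contradiction needs functions spread over whole fibres. The bridge is that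
  \<open>f \<xi> - Psi(f) \<xi>\<close> does not change when a constant vector is subtracted from
  \<open>\<xi>\<close>: for every \<open>f\<close> it can be computed from the nonconstant part of
  \<open>\<xi>\<close>, whose norm is bounded by means of \<open>K\<close> alone. Moving
  \<open>f - Psi f\<close> to the other side of the inner product leaves its adjoint, and the GNS
  norm is controlled by sums over range fibres, so the bound involves the source sums of
  \<open>f\<close>. A function spread out along range fibres may have large source sums; this is why
  it is symmetrised before use. The GNS space is completed without forming a quotient: its elements
  are functionals, of type \<open>('g \<Rightarrow> complex) \<Rightarrow> complex\<close>. Property
  (T) is stated for another type, and \<open>kazhdan_pair_universal\<close> carries \<open>K\<close>
  and \<open>c\<close> over.\<close>

definition psd_kernel :: "'i set \<Rightarrow> ('i \<Rightarrow> 'i \<Rightarrow> real) \<Rightarrow> bool" where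
  "psd_kernel A K \<longleftrightarrow> (\<forall>i\<in>A. \<forall>j\<in>A. K i j = K j i) \<and>
     (\<forall>c. 0 \<le> (\<Sum>i\<in>A. \<Sum>j\<in>A. c i * c j * K i j))"

lemma psd_kernel_subset:
  assumes "psd_kernel A K" "B \<subseteq> A" "finite A"
  shows "psd_kernel B K"
  unfolding psd_kernel_def
proof (intro conjI allI)
  fix c :: "'a \<Rightarrow> real"
  let ?c = "\<lambda>i. if i \<in> B then c i else 0"
  have "0 \<le> (\<Sum>i\<in>A. \<Sum>j\<in>A. ?c i * ?c j * K i j)"
    using assms(1) by (simp only: psd_kernel_def)
  also have "\<dots> = (\<Sum>i\<in>B. \<Sum>j\<in>A. ?c i * ?c j * K i j)"
    using assms by (intro sum.mono_neutral_right) auto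
  also have "\<dots> = (\<Sum>i\<in>B. \<Sum>j\<in>B. ?c i * ?c j * K i j)"
    using assms by (intro sum.cong refl sum.mono_neutral_right) auto
  also have "\<dots> = (\<Sum>i\<in>B. \<Sum>j\<in>B. c i * c j * K i j)"
    by (intro sum.cong refl) auto
  finally show "0 \<le> (\<Sum>i\<in>B. \<Sum>j\<in>B. c i * c j * K i j)" .
qed (use assms in \<open>auto simp: psd_kernel_def\<close>)

lemma quadratic_form_insert:
  fixes K :: "'i \<Rightarrow> 'i \<Rightarrow> real"
  assumes "finite A" "a \<notin> A" "\<And>i. i \<in> A \<Longrightarrow> K i a = K a i"
  shows "(\<Sum>i\<in>insert a A. \<Sum>j\<in>insert a A. c i * c j * K i j) =
    (c a)\<^sup>2 * K a a + 2 * c a * (\<Sum>i\<in>A. c i * K a i) + (\<Sum>i\<in>A. \<Sum>j\<in>A. c i * c j * K i j)"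
  using assms
  by (simp add: sum.distrib sum_distrib_left power2_eq_square algebra_simps)

text \<open>Splitting off the rank one kernel of the first row leaves a kernel that is positive
  semidefinite on the remaining indices (the Schur complement).\<close>

lemma psd_kernel_mult:
  assumes "finite A" "psd_kernel A K" "psd_kernel A M"
  shows "psd_kernel A (\<lambda>i j. K i j * M i j)"
  using assms
proof (induction A arbitrary: K rule: finite_induct)
  case empty
  then show ?case by (simp add: psd_kernel_def)
next
  case (insert a A)
  have symK: "K i j = K j i" and symM: "M i j = M j i" if "i \<in> insert a A" "j \<in> insert a A" for i j
    using insert.prems that by (auto simp: psd_kernel_def)
  \<comment> \<open>\<open>b\<close> is the first row normalised so that
    \<open>K a i = K a a * b i\<close>. If the pivot \<open>K a a\<close> is zero, the whole row
    vanishes and the default \<open>0\<close> is correct.\<close>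
  define b where "b i = (if K a a = 0 then 0 else K a i / K a a)" for i
  define K' where "K' i j = K i j - K a a * b i * b j" for i j
  have q: "0 \<le> t\<^sup>2 * K a a + 2 * t * (\<Sum>i\<in>A. c i * K a i) + (\<Sum>i\<in>A. \<Sum>j\<in>A. c i * c j * K i j)" for t c
  proof -
    let ?c = "c(a := t)"
    have "0 \<le> (\<Sum>i\<in>insert a A. \<Sum>j\<in>insert a A. ?c i * ?c j * K i j)"
      using insert.prems(1) by (simp only: psd_kernel_def)
    also have "\<dots> = (?c a)\<^sup>2 * K a a + 2 * ?c a * (\<Sum>i\<in>A. ?c i * K a i) + (\<Sum>i\<in>A. \<Sum>j\<in>A. ?c i * ?c j * K i j)"
      using insert.hyps symK by (intro quadratic_form_insert) auto
    also have "(\<Sum>i\<in>A. ?c i * K a i) = (\<Sum>i\<in>A. c i * K a i)"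
      using insert.hyps by (intro sum.cong) auto
    also have "(\<Sum>i\<in>A. \<Sum>j\<in>A. ?c i * ?c j * K i j) = (\<Sum>i\<in>A. \<Sum>j\<in>A. c i * c j * K i j)"
      using insert.hyps by (intro sum.cong refl) auto
    finally show ?thesis by simp
  qed
  have Kaa: "0 \<le> K a a"
    using q[of 1 "\<lambda>_. 0"] by simp
  have row: "K a i = K a a * b i" if i: "i \<in> insert a A" for i
  proof (cases "K a a = 0 \<and> i \<in> A")
    case True
    let ?c = "\<lambda>j. if j = i then 1 else 0 :: real"
    have "K a i = 0"
    proof (rule ccontr)
      assume nz: "K a i \<noteq> 0"
      have lin: "(\<Sum>j\<in>A. ?c j * K a j) = K a i"
        using insert.hyps True by (simp add: if_distrib[where f="\<lambda>x. x * _"] sum.delta cong: if_cong)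
      \<comment> \<open>With a zero pivot the form is affine in \<open>t\<close>; staying
        nonnegative for all \<open>t\<close> forces slope zero.\<close>
      have "0 \<le> 2 * t * K a i + (\<Sum>i\<in>A. \<Sum>j\<in>A. ?c i * ?c j * K i j)" for t
        using q[of t ?c] True unfolding lin by simp
      from this[of "- ((\<Sum>i\<in>A. \<Sum>j\<in>A. ?c i * ?c j * K i j) + 1) / (2 * K a i)"] show False
        using nz by (simp add: field_simps)
    qed
    with True show ?thesis by simp
  qed (use i in \<open>auto simp: b_def\<close>)
  have "psd_kernel A K'"
    unfolding psd_kernel_def
  proof (intro conjI allI ballI)
    fix c :: "'a \<Rightarrow> real"
    let ?s = "\<Sum>i\<in>A. c i * b i"
    have "(\<Sum>i\<in>A. c i * K a i) = K a a * ?s"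
      unfolding sum_distrib_left
      by (intro sum.cong refl) (metis row insertCI mult.left_commute)
    \<comment> \<open>The value \<open>- ?s\<close> for the coefficient at \<open>a\<close>
      minimises the form in that coefficient.\<close>
    then have "0 \<le> (\<Sum>i\<in>A. \<Sum>j\<in>A. c i * c j * K i j) - K a a * ?s\<^sup>2"
      using q[of "- ?s" c] by (simp add: power2_eq_square algebra_simps)
    also have "\<dots> = (\<Sum>i\<in>A. \<Sum>j\<in>A. c i * c j * K' i j)"
    proof -
      have "K a a * ?s\<^sup>2 = (\<Sum>i\<in>A. \<Sum>j\<in>A. c i * c j * (K a a * b i * b j))"
        unfolding power2_eq_square sum_product unfolding sum_distrib_left by (intro sum.cong refl) simp
      then show ?thesis by (simp add: K'_def right_diff_distrib sum_subtractf)
    qed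
    finally show "0 \<le> (\<Sum>i\<in>A. \<Sum>j\<in>A. c i * c j * K' i j)" .
  qed (use symK in \<open>auto simp: K'_def\<close>)
  moreover have "psd_kernel A M"
    using psd_kernel_subset[OF insert.prems(2)] insert.hyps by blast
  ultimately have IH: "psd_kernel A (\<lambda>i j. K' i j * M i j)"
    by (rule insert.IH)
  show ?case
    unfolding psd_kernel_def
  proof (intro conjI allI ballI)
    fix c :: "'a \<Rightarrow> real"
    have K'0: "K' a j = 0" "K' j a = 0" if "j \<in> insert a A" for j
    proof -
      have "K a a * b a = K a a" by (simp add: b_def)
      then have "K a a * b a * b j = K a j" "K a a * b j * b a = K a j"
        using row[OF that] by (metis mult.commute mult.left_commute)+
      then show "K' a j = 0" "K' j a = 0"
        using symK[of j a] that by (simp_all add: K'_def)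
    qed
    \<comment> \<open>The rank one part of \<open>K\<close>, multiplied by \<open>M\<close>, gives
      the form of \<open>M\<close> at the coefficients \<open>c i * b i\<close>. The rest vanishes
      in the row and column of \<open>a\<close>, so the induction hypothesis covers it.\<close>
    have "(\<Sum>i\<in>insert a A. \<Sum>j\<in>insert a A. c i * c j * (K i j * M i j)) =
      (\<Sum>i\<in>insert a A. \<Sum>j\<in>insert a A. c i * c j * (K' i j * M i j)) +
      K a a * (\<Sum>i\<in>insert a A. \<Sum>j\<in>insert a A. (c i * b i) * (c j * b j) * M i j)"
      unfolding sum_distrib_left sum.distrib[symmetric]
      by (intro sum.cong refl) (simp add: K'_def algebra_simps)
    also have "(\<Sum>i\<in>insert a A. \<Sum>j\<in>insert a A. c i * c j * (K' i j * M i j)) =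
        (\<Sum>i\<in>A. \<Sum>j\<in>A. c i * c j * (K' i j * M i j))"
      using insert.hyps K'0 by simp
    also have "\<dots> + K a a * (\<Sum>i\<in>insert a A. \<Sum>j\<in>insert a A. (c i * b i) * (c j * b j) * M i j) \<ge> 0"
      using IH insert.prems(2) Kaa unfolding psd_kernel_def
      by (intro add_nonneg_nonneg mult_nonneg_nonneg) (simp_all only:)
    finally show "0 \<le> (\<Sum>i\<in>insert a A. \<Sum>j\<in>insert a A. c i * c j * (K i j * M i j))" .
  qed (use symK symM in metis)
qed

lemma psd_kernel_one: "psd_kernel A (\<lambda>i j. 1)"
proof -
  have "(\<Sum>i\<in>A. \<Sum>j\<in>A. c i * c j * 1) = (sum c A)\<^sup>2" for c :: "'a \<Rightarrow> real"
    by (simp add: power2_eq_square sum_product)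
  then show ?thesis by (simp add: psd_kernel_def)
qed

text \<open>Pointwise powers of \<open>K\<close> are positive semidefinite by repeated Schur
  products. The exponential series has positive coefficients, and nonnegativity of a quadratic form
  survives the limit of the partial sums.\<close>

lemma psd_kernel_exp:
  assumes A: "finite A" and K: "psd_kernel A K"
  shows "psd_kernel A (\<lambda>i j. exp (K i j))"
  unfolding psd_kernel_def
proof (intro conjI allI)
  fix c :: "'a \<Rightarrow> real"
  have pw: "psd_kernel A (\<lambda>i j. K i j ^ n)" for n
    by (induction n) (auto intro!: psd_kernel_one psd_kernel_mult A K)
  let ?p = "\<lambda>m i j. \<Sum>n<m. K i j ^ n /\<^sub>R fact n"
  have "0 \<le> (\<Sum>i\<in>A. \<Sum>j\<in>A. c i * c j * ?p m i j)" for m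
  proof -
    have "(\<Sum>i\<in>A. \<Sum>j\<in>A. c i * c j * ?p m i j) = (\<Sum>i\<in>A. \<Sum>n<m. \<Sum>j\<in>A. c i * c j * K i j ^ n /\<^sub>R fact n)"
      unfolding sum_distrib_left mult_scaleR_right by (intro sum.cong refl sum.swap)
    also have "\<dots> = (\<Sum>n<m. \<Sum>i\<in>A. \<Sum>j\<in>A. c i * c j * K i j ^ n /\<^sub>R fact n)"
      by (rule sum.swap)
    also have "\<dots> = (\<Sum>n<m. (\<Sum>i\<in>A. \<Sum>j\<in>A. c i * c j * K i j ^ n) /\<^sub>R fact n)"
      by (simp only: scaleR_sum_right)
    also have "\<dots> \<ge> 0"
      using pw by (intro sum_nonneg) (auto simp: psd_kernel_def)
    finally show ?thesis .
  qed
  moreover have "(\<lambda>m. \<Sum>i\<in>A. \<Sum>j\<in>A. c i * c j * ?p m i j) \<longlonglongrightarrow> (\<Sum>i\<in>A. \<Sum>j\<in>A. c i * c j * exp (K i j))"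
    by (intro tendsto_intros exp_converges[unfolded sums_def])
  ultimately show "0 \<le> (\<Sum>i\<in>A. \<Sum>j\<in>A. c i * c j * exp (K i j))"
    by (intro LIMSEQ_le_const) auto
qed (use K in \<open>auto simp: psd_kernel_def\<close>)

text \<open>Schoenberg's theorem, with \<open>d i\<close> the distance from \<open>i\<close> to a base point.\<close>

lemma psd_kernel_exp_neg:
  assumes A: "finite A" and sym: "\<And>i j. i \<in> A \<Longrightarrow> j \<in> A \<Longrightarrow> D i j = D j i"
    and neg: "\<And>c. (\<Sum>i\<in>A. \<Sum>j\<in>A. c i * c j * D i j) \<le> 2 * (\<Sum>i\<in>A. c i) * (\<Sum>i\<in>A. c i * d i)"
    and t: "0 \<le> t"
  shows "psd_kernel A (\<lambda>i j. exp (- t * D i j))"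
proof -
  \<comment> \<open>If \<open>D\<close> is a squared Hilbert space distance, this kernel is
    \<open>2 * t\<close> times the Gram matrix of the vectors from the base point.\<close>
  have "psd_kernel A (\<lambda>i j. t * (d i + d j - D i j))"
    unfolding psd_kernel_def
  proof (intro conjI allI ballI)
    fix c :: "'a \<Rightarrow> real"
    have "(\<Sum>i\<in>A. \<Sum>j\<in>A. c i * c j * (t * (d i + d j - D i j))) =
       t * ((\<Sum>i\<in>A. \<Sum>j\<in>A. c i * d i * c j) + (\<Sum>i\<in>A. \<Sum>j\<in>A. c i * (c j * d j))
         - (\<Sum>i\<in>A. \<Sum>j\<in>A. c i * c j * D i j))"
      unfolding sum_distrib_left sum.distrib[symmetric] sum_subtractf[symmetric]
      by (intro sum.cong refl) (simp add: algebra_simps)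
    also have "\<dots> = t * (2 * (\<Sum>i\<in>A. c i) * (\<Sum>i\<in>A. c i * d i) - (\<Sum>i\<in>A. \<Sum>j\<in>A. c i * c j * D i j))"
      by (simp add: sum_product[symmetric])
    also have "\<dots> \<ge> 0" using neg[of c] t by simp
    finally show "0 \<le> (\<Sum>i\<in>A. \<Sum>j\<in>A. c i * c j * (t * (d i + d j - D i j)))" .
  qed (simp add: sym)
  then have psd: "psd_kernel A (\<lambda>i j. exp (t * (d i + d j - D i j)))"
    by (rule psd_kernel_exp[OF A])
  show ?thesis
    unfolding psd_kernel_def
  proof (intro conjI allI ballI)
    fix c :: "'a \<Rightarrow> real"
    \<comment> \<open>Rescaling the coefficients removes the factors \<open>exp (t * d i)\<close>
      and \<open>exp (t * d j)\<close>, which depend on one index each.\<close>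
    let ?c = "\<lambda>i. c i * exp (- t * d i)"
    have "0 \<le> (\<Sum>i\<in>A. \<Sum>j\<in>A. ?c i * ?c j * exp (t * (d i + d j - D i j)))"
      using psd by (simp only: psd_kernel_def)
    also have "\<dots> = (\<Sum>i\<in>A. \<Sum>j\<in>A. c i * c j * exp (- t * D i j))"
    proof (intro sum.cong refl)
      fix i j
      have "exp (- t * D i j) = exp (- t * d i) * exp (- t * d j) * exp (t * (d i + d j - D i j))"
        by (simp add: exp_add[symmetric] algebra_simps)
      then show "?c i * ?c j * exp (t * (d i + d j - D i j)) = c i * c j * exp (- t * D i j)"
        by simp
    qed
    finally show "0 \<le> (\<Sum>i\<in>A. \<Sum>j\<in>A. c i * c j * exp (- t * D i j))" .
  qed (simp add: sym)
qed

text \<open>The kernel is real, so the real part separates into the forms of the real and of the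
  imaginary parts of \<open>z\<close>.\<close>

lemma psd_kernel_complex:
  fixes z :: "'i \<Rightarrow> complex"
  assumes "psd_kernel A K"
  shows "0 \<le> Re (\<Sum>i\<in>A. \<Sum>j\<in>A. cnj (z i) * z j * of_real (K i j))"
proof -
  have "Re (\<Sum>i\<in>A. \<Sum>j\<in>A. cnj (z i) * z j * of_real (K i j)) =
    (\<Sum>i\<in>A. \<Sum>j\<in>A. Re (z i) * Re (z j) * K i j) + (\<Sum>i\<in>A. \<Sum>j\<in>A. Im (z i) * Im (z j) * K i j)"
    by (simp add: Re_sum sum.distrib[symmetric] algebra_simps)
  also have "\<dots> \<ge> 0" using assms by (simp add: psd_kernel_def)
  finally show ?thesis .
qed

section \<open>Completion of a semi-inner product space\<close>

text \<open>The vectors are functions with pointwise operations, and \<open>B\<close> may have null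
  vectors. The locale is used twice: for \<open>Cc\<close> with the GNS form, and for the completion
  itself, whose elements are again functions.\<close>

locale pre_hilbert =
  fixes V :: "('a \<Rightarrow> complex) set" and B :: "('a \<Rightarrow> complex) \<Rightarrow> ('a \<Rightarrow> complex) \<Rightarrow> complex"
  assumes V_zero: "(\<lambda>_. 0) \<in> V"
    and V_add: "u \<in> V \<Longrightarrow> v \<in> V \<Longrightarrow> (\<lambda>a. u a + v a) \<in> V"
    and V_scale: "u \<in> V \<Longrightarrow> (\<lambda>a. c * u a) \<in> V"
    and B_add: "u \<in> V \<Longrightarrow> v \<in> V \<Longrightarrow> w \<in> V \<Longrightarrow> B (\<lambda>a. u a + v a) w = B u w + B v w"
    and B_scale: "u \<in> V \<Longrightarrow> w \<in> V \<Longrightarrow> B (\<lambda>a. c * u a) w = c * B u w"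
    and B_cnj: "u \<in> V \<Longrightarrow> v \<in> V \<Longrightarrow> B v u = cnj (B u v)"
    and B_nonneg: "u \<in> V \<Longrightarrow> 0 \<le> Re (B u u)"
begin

lemma V_diff: "u \<in> V \<Longrightarrow> v \<in> V \<Longrightarrow> (\<lambda>a. u a - v a) \<in> V"
  using V_add[OF _ V_scale[of v "-1"], of u] by simp

lemma B_diff:
  assumes "u \<in> V" "v \<in> V" "w \<in> V" shows "B (\<lambda>a. u a - v a) w = B u w - B v w"
  using B_add[OF assms(1) V_scale[of v "-1"] assms(3)] B_scale[OF assms(2,3), of "-1"] assms by simp

lemma B_add_right:
  assumes "u \<in> V" "v \<in> V" "w \<in> V" shows "B w (\<lambda>a. u a + v a) = B w u + B w v"
  using assms B_cnj[OF V_add[OF assms(1,2)] assms(3)] B_cnj[of u w] B_cnj[of v w]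
  by (simp add: B_add)

lemma B_diff_right:
  assumes "u \<in> V" "v \<in> V" "w \<in> V" shows "B w (\<lambda>a. u a - v a) = B w u - B w v"
  using assms B_cnj[OF V_diff[OF assms(1,2)] assms(3)] B_cnj[of u w] B_cnj[of v w]
  by (simp add: B_diff)

lemma B_scale_right:
  assumes "u \<in> V" "w \<in> V" shows "B w (\<lambda>a. c * u a) = cnj c * B w u"
  using assms B_cnj[OF V_scale[OF assms(1)] assms(2), of c] B_cnj[of u w]
  by (simp add: B_scale)

definition nrm :: "('a \<Rightarrow> complex) \<Rightarrow> real" where
  "nrm u = sqrt (Re (B u u))"

lemma nrm_nonneg: "u \<in> V \<Longrightarrow> 0 \<le> nrm u"
  by (simp add: nrm_def B_nonneg)

lemma B_self: "u \<in> V \<Longrightarrow> B u u = of_real ((nrm u)\<^sup>2)"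
  using arg_cong[OF B_cnj[of u u], of Im] B_nonneg[of u]
  by (simp add: nrm_def complex_eq_iff)

lemma nrm_scale:
  assumes "u \<in> V" shows "nrm (\<lambda>a. c * u a) = cmod c * nrm u"
proof -
  have "B (\<lambda>a. c * u a) (\<lambda>a. c * u a) = (c * cnj c) * of_real ((nrm u)\<^sup>2)"
    using assms by (simp add: B_scale B_scale_right V_scale B_self)
  also have "\<dots> = of_real ((cmod c * nrm u)\<^sup>2)"
    by (simp only: complex_norm_square[symmetric] power_mult_distrib of_real_mult)
  finally have "B (\<lambda>a. c * u a) (\<lambda>a. c * u a) = of_real ((cmod c * nrm u)\<^sup>2)" .
  then show ?thesis
    using assms nrm_nonneg[of u] by (simp add: nrm_def[of "\<lambda>a. c * u a"])
qed

lemma cauchy_schwarz: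
  assumes u: "u \<in> V" and v: "v \<in> V" shows "cmod (B u v) \<le> nrm u * nrm v"
proof -
  define z where "z = B u v"
  have expand: "0 \<le> (nrm u)\<^sup>2 - 2 * t * (cmod z)\<^sup>2 + t\<^sup>2 * (cmod z)\<^sup>2 * (nrm v)\<^sup>2" for t :: real
  proof -
    \<comment> \<open>The factor \<open>z\<close> aligns the phases, so that a real parameter
      \<open>t\<close> suffices.\<close>
    let ?w = "\<lambda>a. u a - (of_real t * z) * v a"
    have tv: "(\<lambda>a. (of_real t * z) * v a) \<in> V" using v by (rule V_scale)
    have "B ?w ?w = B u u - cnj (of_real t * z) * z - (of_real t * z) * cnj z
        + (of_real t * z) * (cnj (of_real t * z) * B v v)"
      using u v tv V_diff[OF u tv] B_cnj[OF u v]
      by (simp only: B_diff B_diff_right B_scale B_scale_right z_def) (simp add: algebra_simps)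
    also have "\<dots> = B u u - of_real (2 * t) * (z * cnj z) + of_real (t\<^sup>2) * (z * cnj z) * B v v"
      by (simp add: algebra_simps power2_eq_square)
    also have "\<dots> = of_real ((nrm u)\<^sup>2 - 2 * t * (cmod z)\<^sup>2 + t\<^sup>2 * (cmod z)\<^sup>2 * (nrm v)\<^sup>2)"
      using u v by (simp only: B_self complex_norm_square[symmetric] of_real_mult of_real_diff of_real_add)
    finally have eq: "B ?w ?w = \<dots>" .
    show ?thesis
      using B_nonneg[OF V_diff[OF u tv]] unfolding eq Re_complex_of_real .
  qed
  have "cmod z \<le> nrm u * nrm v"
  proof (cases "z = 0 \<or> nrm v = 0")
    case True
    have "z = 0"
    proof (rule ccontr)
      assume z: "z \<noteq> 0"
      with True have "0 \<le> (nrm u)\<^sup>2 - 2 * (((nrm u)\<^sup>2 + 1) / (2 * (cmod z)\<^sup>2)) * (cmod z)\<^sup>2"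
        using expand[of "((nrm u)\<^sup>2 + 1) / (2 * (cmod z)\<^sup>2)"] by simp
      then show False using z by simp
    qed
    then show ?thesis using nrm_nonneg u v by simp
  next
    case False
    then have pos: "nrm v > 0" "cmod z > 0" using nrm_nonneg[OF v] by auto
    \<comment> \<open>This value of \<open>t\<close> minimises the quadratic.\<close>
    have "0 \<le> (nrm u)\<^sup>2 - 2 * (1 / (nrm v)\<^sup>2) * (cmod z)\<^sup>2 + (1 / (nrm v)\<^sup>2)\<^sup>2 * (cmod z)\<^sup>2 * (nrm v)\<^sup>2"
      by (rule expand)
    also have "\<dots> = (nrm u)\<^sup>2 - (cmod z)\<^sup>2 / (nrm v)\<^sup>2"
      using pos by (simp add: field_simps power2_eq_square)
    finally have "(cmod z)\<^sup>2 \<le> (nrm u * nrm v)\<^sup>2"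
      using pos by (simp add: field_simps power_mult_distrib)
    then show ?thesis
      by (rule power2_le_imp_le) (simp add: nrm_nonneg u v)
  qed
  then show ?thesis by (simp add: z_def)
qed

lemma nrm_triangle:
  assumes u: "u \<in> V" and v: "v \<in> V" shows "nrm (\<lambda>a. u a + v a) \<le> nrm u + nrm v"
proof (rule power2_le_imp_le)
  have "of_real ((nrm (\<lambda>a. u a + v a))\<^sup>2) = B (\<lambda>a. u a + v a) (\<lambda>a. u a + v a)"
    using u v by (simp add: B_self V_add)
  also have "\<dots> = B u u + B v v + (B u v + cnj (B u v))"
    using u v V_add[OF u v] B_cnj[OF u v] by (simp add: B_add B_add_right)
  also have "\<dots> = of_real ((nrm u)\<^sup>2 + (nrm v)\<^sup>2 + 2 * Re (B u v))"
    using u v by (simp add: B_self complex_add_cnj)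
  finally have "(nrm (\<lambda>a. u a + v a))\<^sup>2 = (nrm u)\<^sup>2 + (nrm v)\<^sup>2 + 2 * Re (B u v)"
    by (simp only: of_real_eq_iff)
  also have "\<dots> \<le> (nrm u + nrm v)\<^sup>2"
    using cauchy_schwarz[OF u v] complex_Re_le_cmod[of "B u v"] by (simp add: power2_sum)
  finally show "(nrm (\<lambda>a. u a + v a))\<^sup>2 \<le> (nrm u + nrm v)\<^sup>2" .
  show "0 \<le> nrm u + nrm v" using u v nrm_nonneg by simp
qed

lemma nrm_diff_triangle:
  assumes "u \<in> V" "v \<in> V" "w \<in> V"
  shows "nrm (\<lambda>a. u a - w a) \<le> nrm (\<lambda>a. u a - v a) + nrm (\<lambda>a. v a - w a)"
  using nrm_triangle[OF V_diff[OF assms(1,2)] V_diff[OF assms(2,3)]] by simp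

lemma nrm_diff_commute:
  assumes "u \<in> V" "v \<in> V" shows "nrm (\<lambda>a. u a - v a) = nrm (\<lambda>a. v a - u a)"
  using nrm_scale[OF V_diff[OF assms], of "-1"] by simp

section \<open>The completion as a space of functionals\<close>

definition cauchy_seq :: "(nat \<Rightarrow> 'a \<Rightarrow> complex) \<Rightarrow> bool" where
  "cauchy_seq v \<longleftrightarrow> (\<forall>n. v n \<in> V) \<and>
     (\<forall>e>0. \<exists>N. \<forall>m\<ge>N. \<forall>n\<ge>N. nrm (\<lambda>a. v m a - v n a) < e)"

text \<open>An element of the completion is the functional \<open>w \<mapsto> lim B (v n) w\<close> of a Cauchy sequence
  \<open>v\<close>, so that equality in the completion is equality of functions.\<close>

definition represents :: "(('a \<Rightarrow> complex) \<Rightarrow> complex) \<Rightarrow> (nat \<Rightarrow> 'a \<Rightarrow> complex) \<Rightarrow> bool" where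
  "represents l v \<longleftrightarrow> cauchy_seq v \<and> (\<forall>w\<in>V. (\<lambda>n. B (v n) w) \<longlonglongrightarrow> l w) \<and> (\<forall>w. w \<notin> V \<longrightarrow> l w = 0)"

lemma represents_V: "represents l v \<Longrightarrow> v n \<in> V"
  by (simp add: represents_def cauchy_seq_def)

lemma represents_lim: "represents l v \<Longrightarrow> w \<in> V \<Longrightarrow> (\<lambda>n. B (v n) w) \<longlonglongrightarrow> l w"
  by (simp add: represents_def)

lemma cauchy_seqD:
  assumes "cauchy_seq v" "e > 0"
  obtains N where "\<And>m n. m \<ge> N \<Longrightarrow> n \<ge> N \<Longrightarrow> nrm (\<lambda>a. v m a - v n a) < e"
  using assms unfolding cauchy_seq_def by meson

lemma cauchy_seq_bounded:
  assumes v: "cauchy_seq v"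
  obtains C where "C > 0" "\<And>n. nrm (v n) \<le> C"
proof -
  have V: "v n \<in> V" for n using v by (simp add: cauchy_seq_def)
  obtain N where N: "\<And>m n. m \<ge> N \<Longrightarrow> n \<ge> N \<Longrightarrow> nrm (\<lambda>a. v m a - v n a) < 1"
    using cauchy_seqD[OF v, of 1] by auto
  define C where "C = (\<Sum>n\<le>N. nrm (v n)) + 1"
  have le: "nrm (v n) \<le> (\<Sum>n\<le>N. nrm (v n))" if "n \<le> N" for n
    using that V nrm_nonneg by (intro member_le_sum) auto
  have "nrm (v n) \<le> C" for n
  proof (cases "n \<le> N")
    case False
    have "nrm (v n) \<le> nrm (\<lambda>a. v n a - v N a) + nrm (v N)"
      using nrm_triangle[OF V_diff[OF V V] V, of n N N] by simp
    also have "\<dots> \<le> C" using N[of n N] False le[of N] by (simp add: C_def)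
    finally show ?thesis .
  qed (use le in \<open>auto simp: C_def intro: add_increasing2\<close>)
  moreover have "C > 0"
    unfolding C_def using V nrm_nonneg by (intro add_nonneg_pos sum_nonneg) auto
  ultimately show ?thesis using that by blast
qed

lemma represents_bounded:
  assumes "represents l v"
  obtains C where "C > 0" "\<And>w. w \<in> V \<Longrightarrow> cmod (l w) \<le> C * nrm w"
proof -
  obtain C where C: "C > 0" "\<And>n. nrm (v n) \<le> C"
    using assms cauchy_seq_bounded unfolding represents_def by blast
  have "cmod (l w) \<le> C * nrm w" if w: "w \<in> V" for w
  proof (rule LIMSEQ_le_const2)
    show "(\<lambda>n. cmod (B (v n) w)) \<longlonglongrightarrow> cmod (l w)"
      by (intro tendsto_norm represents_lim assms w)
    show "\<exists>N. \<forall>n\<ge>N. cmod (B (v n) w) \<le> C * nrm w"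
      using cauchy_schwarz[OF represents_V[OF assms] w] C(2) nrm_nonneg[OF w]
      by (meson mult_right_mono order_trans)
  qed
  then show ?thesis using C that by blast
qed

lemma represents_diff:
  assumes l: "represents l v" and "u \<in> V" "w \<in> V"
  shows "l (\<lambda>a. u a - w a) = l u - l w"
proof (rule LIMSEQ_unique)
  show "(\<lambda>n. B (v n) (\<lambda>a. u a - w a)) \<longlonglongrightarrow> l (\<lambda>a. u a - w a)"
    by (intro represents_lim l V_diff assms)
  show "(\<lambda>n. B (v n) (\<lambda>a. u a - w a)) \<longlonglongrightarrow> l u - l w"
    using assms by (simp add: B_diff_right represents_V[OF l] tendsto_diff represents_lim)
qed

text \<open>\<open>v\<close> is Cauchy in norm, so by Cauchy-Schwarz \<open>B (v n) w\<close> tends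
  to \<open>l w\<close> uniformly on balls. The uniformity allows \<open>w\<close> to vary with
  \<open>n\<close>.\<close>

lemma represents_approx:
  assumes l: "represents l v" and e: "e > 0"
  obtains N where "\<And>n w. n \<ge> N \<Longrightarrow> w \<in> V \<Longrightarrow> cmod (B (v n) w - l w) \<le> e * nrm w"
proof -
  have V: "v n \<in> V" for n using represents_V[OF l] .
  obtain N where N: "\<And>m n. m \<ge> N \<Longrightarrow> n \<ge> N \<Longrightarrow> nrm (\<lambda>a. v m a - v n a) < e"
    using cauchy_seqD[of v e] l e unfolding represents_def by blast
  have "cmod (B (v n) w - l w) \<le> e * nrm w" if n: "n \<ge> N" and w: "w \<in> V" for n w
  proof (rule LIMSEQ_le_const2)
    show "(\<lambda>m. cmod (B (v n) w - B (v m) w)) \<longlonglongrightarrow> cmod (B (v n) w - l w)"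
      by (intro tendsto_intros represents_lim l w)
    have "cmod (B (v n) w - B (v m) w) \<le> e * nrm w" if "m \<ge> N" for m
    proof -
      have "cmod (B (v n) w - B (v m) w) \<le> nrm (\<lambda>a. v n a - v m a) * nrm w"
        using cauchy_schwarz[OF V_diff[OF V V] w] by (simp add: B_diff V w)
      also have "\<dots> \<le> e * nrm w"
        using N[OF n that] nrm_nonneg[OF w] by (intro mult_right_mono) auto
      finally show ?thesis .
    qed
    then show "\<exists>N. \<forall>m\<ge>N. cmod (B (v n) w - B (v m) w) \<le> e * nrm w" by blast
  qed
  then show ?thesis using that by blast
qed

text \<open>In the diagonal sequence \<open>B (v n) (v' n)\<close> the first argument may be
  replaced by its limit functional, because \<open>v'\<close> stays in a ball.\<close>

lemma represents_asymp:
  assumes l: "represents l v" and v': "cauchy_seq v'"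
  shows "(\<lambda>n. B (v n) (v' n) - l (v' n)) \<longlonglongrightarrow> 0"
proof (rule LIMSEQ_I)
  fix e :: real assume e: "e > 0"
  have V': "v' n \<in> V" for n using v' by (simp add: cauchy_seq_def)
  obtain C where C: "C > 0" "\<And>n. nrm (v' n) \<le> C" using cauchy_seq_bounded[OF v'] by blast
  obtain N where N: "\<And>n w. n \<ge> N \<Longrightarrow> w \<in> V \<Longrightarrow> cmod (B (v n) w - l w) \<le> e / (2 * C) * nrm w"
    using represents_approx[OF l, of "e / (2 * C)"] e C by auto
  have "cmod (B (v n) (v' n) - l (v' n)) < e" if "n \<ge> N" for n
  proof -
    have "cmod (B (v n) (v' n) - l (v' n)) \<le> e / (2 * C) * nrm (v' n)" by (rule N[OF that V'])
    also have "\<dots> \<le> e / (2 * C) * C" using e C by (intro mult_left_mono) auto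
    also have "\<dots> < e" using e C by simp
    finally show ?thesis .
  qed
  then show "\<exists>N. \<forall>n\<ge>N. cmod (B (v n) (v' n) - l (v' n) - 0) < e" by auto
qed

lemma represents_convergent:
  assumes l: "represents l v" and v': "cauchy_seq v'"
  shows "convergent (\<lambda>n. l (v' n))"
proof -
  have V': "v' n \<in> V" for n using v' by (simp add: cauchy_seq_def)
  obtain C where C: "C > 0" "\<And>w. w \<in> V \<Longrightarrow> cmod (l w) \<le> C * nrm w"
    using represents_bounded[OF l] by blast
  have "Cauchy (\<lambda>n. l (v' n))"
  proof (rule CauchyI)
    fix e :: real assume e: "e > 0"
    obtain N where N: "\<And>m n. m \<ge> N \<Longrightarrow> n \<ge> N \<Longrightarrow> nrm (\<lambda>a. v' m a - v' n a) < e / C"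
      using cauchy_seqD[OF v', of "e / C"] e C by auto
    have "cmod (l (v' m) - l (v' n)) < e" if "m \<ge> N" "n \<ge> N" for m n
      using C(2)[OF V_diff[OF V' V'], of m n] N[OF that] C(1)
      by (simp add: represents_diff[OF l] V' field_simps)
    then show "\<exists>M. \<forall>m\<ge>M. \<forall>n\<ge>M. cmod (l (v' m) - l (v' n)) < e" by blast
  qed
  then show ?thesis by (rule Cauchy_convergent)
qed

definition representative :: "(('a \<Rightarrow> complex) \<Rightarrow> complex) \<Rightarrow> nat \<Rightarrow> 'a \<Rightarrow> complex" where
  "representative l = (SOME v. represents l v)"

text \<open>The functionals are conjugate linear, so that \<open>embed\<close> is linear. The inner
  product is read off from arbitrarily chosen representing sequences;
  \<open>represents_inner\<close> shows that all others give the same value.\<close>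

definition completion :: "(('a \<Rightarrow> complex) \<Rightarrow> complex) hilbert_ops" where
  "completion = \<lparr>hcarrier = {l. \<exists>v. represents l v}, hzero = (\<lambda>_. 0), hadd = (\<lambda>l l' w. l w + l' w),
     hscale = (\<lambda>c l w. c * l w),
     hinner = (\<lambda>l l'. lim (\<lambda>n. B (representative l n) (representative l' n)))\<rparr>"

lemma completion_simps [simp]:
  "hcarrier completion = {l. \<exists>v. represents l v}" "hzero completion = (\<lambda>_. 0)"
  "hadd completion l l' = (\<lambda>w. l w + l' w)" "hscale completion c l = (\<lambda>w. c * l w)"
  "hdiff completion l l' = (\<lambda>w. l w - l' w)"
  by (simp_all add: completion_def hdiff_def)

text \<open>The limit of \<open>B (v n) (v' n)\<close> depends on \<open>v\<close> only through
  \<open>l\<close> (fact \<open>left\<close>) and on \<open>v'\<close> only through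
  \<open>l'\<close> (fact \<open>right\<close>). So the two sequences can be exchanged for the
  chosen representatives one after the other.\<close>

lemma represents_inner:
  assumes l: "represents l v" and l': "represents l' v'"
  shows "(\<lambda>n. B (v n) (v' n)) \<longlonglongrightarrow> hinner completion l l'"
proof -
  have c: "\<And>l v. represents l v \<Longrightarrow> cauchy_seq v" by (simp add: represents_def)
  have left: "((\<lambda>n. B (v n) (v' n)) \<longlonglongrightarrow> z) \<longleftrightarrow> ((\<lambda>n. l (v' n)) \<longlonglongrightarrow> z)"
    if r: "represents l v" "represents l' v'" for l v l' v' z
    by (rule Lim_transform_eq[OF represents_asymp[OF r(1) c[OF r(2)]]])
  have right: "((\<lambda>n. B (v n) (v' n)) \<longlonglongrightarrow> z) \<longleftrightarrow> ((\<lambda>n. cnj (l' (v n))) \<longlonglongrightarrow> z)"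
    if r: "represents l v" "represents l' v'" for l v l' v' z
  proof -
    have "(\<lambda>n. B (v' n) (v n)) = (\<lambda>n. cnj (B (v n) (v' n)))"
      by (intro ext B_cnj represents_V[OF r(1)] represents_V[OF r(2)])
    then have "((\<lambda>n. B (v n) (v' n)) \<longlonglongrightarrow> z) \<longleftrightarrow> ((\<lambda>n. B (v' n) (v n)) \<longlonglongrightarrow> cnj z)"
      by (simp only: lim_cnj)
    also have "\<dots> \<longleftrightarrow> ((\<lambda>n. l' (v n)) \<longlonglongrightarrow> cnj z)" by (rule left[OF r(2,1)])
    also have "\<dots> \<longleftrightarrow> ((\<lambda>n. cnj (l' (v n))) \<longlonglongrightarrow> z)" using lim_cnj[of "\<lambda>n. cnj (l' (v n))" z] by simp
    finally show ?thesis .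
  qed
  let ?r = "representative l" and ?r' = "representative l'"
  have r: "represents l ?r" "represents l' ?r'"
    using someI[of "represents l"] someI[of "represents l'"] l l' by (auto simp: representative_def)
  obtain z where "(\<lambda>n. l (?r' n)) \<longlonglongrightarrow> z"
    using represents_convergent[OF l c[OF r(2)]] by (auto simp: convergent_def)
  then have z: "(\<lambda>n. B (?r n) (?r' n)) \<longlonglongrightarrow> z" "(\<lambda>n. B (v n) (?r' n)) \<longlonglongrightarrow> z"
    by (simp_all only: left[OF r] left[OF l r(2)])
  have "hinner completion l l' = z"
    using limI[OF z(1)] by (simp add: completion_def)
  moreover have "(\<lambda>n. B (v n) (v' n)) \<longlonglongrightarrow> z"
    using z(2) by (simp only: right[OF l l'] right[OF l r(2)])
  ultimately show ?thesis by simp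
qed

lemma cauchy_seq_add:
  assumes "cauchy_seq u" "cauchy_seq v"
  shows "cauchy_seq (\<lambda>n a. u n a + v n a)"
  unfolding cauchy_seq_def
proof (intro conjI allI impI)
  have V: "u n \<in> V" "v n \<in> V" for n using assms by (auto simp: cauchy_seq_def)
  then show "(\<lambda>a. u n a + v n a) \<in> V" for n by (simp add: V_add)
  fix e :: real assume "e > 0"
  then obtain M N where M: "\<And>m n. m \<ge> M \<Longrightarrow> n \<ge> M \<Longrightarrow> nrm (\<lambda>a. u m a - u n a) < e/2"
    and N: "\<And>m n. m \<ge> N \<Longrightarrow> n \<ge> N \<Longrightarrow> nrm (\<lambda>a. v m a - v n a) < e/2"
    using cauchy_seqD[OF assms(1)] cauchy_seqD[OF assms(2)] by (metis half_gt_zero)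
  have "nrm (\<lambda>a. (u m a + v m a) - (u n a + v n a)) < e" if "m \<ge> max M N" "n \<ge> max M N" for m n
    using nrm_triangle[OF V_diff[OF V(1) V(1)] V_diff[OF V(2) V(2)], of m n m n] M[of m n] N[of m n] that
    by (simp add: algebra_simps)
  then show "\<exists>N. \<forall>m\<ge>N. \<forall>n\<ge>N. nrm (\<lambda>a. (u m a + v m a) - (u n a + v n a)) < e" by blast
qed

lemma cauchy_seq_bounded_map:
  assumes u: "cauchy_seq u" and T: "\<And>v. v \<in> V \<Longrightarrow> T v \<in> V"
    and diff: "\<And>v w. v \<in> V \<Longrightarrow> w \<in> V \<Longrightarrow> T (\<lambda>a. v a - w a) = (\<lambda>a. T v a - T w a)"
    and C: "\<And>v. v \<in> V \<Longrightarrow> nrm (T v) \<le> C * nrm v"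
  shows "cauchy_seq (\<lambda>n. T (u n))"
  unfolding cauchy_seq_def
proof (intro conjI allI impI)
  have V: "u n \<in> V" for n using u by (auto simp: cauchy_seq_def)
  then show "T (u n) \<in> V" for n by (simp add: T)
  fix e :: real assume e: "e > 0"
  then have "e / (\<bar>C\<bar> + 1) > 0" by simp
  then obtain N where N: "\<And>m n. m \<ge> N \<Longrightarrow> n \<ge> N \<Longrightarrow> nrm (\<lambda>a. u m a - u n a) < e / (\<bar>C\<bar> + 1)"
    using cauchy_seqD[OF u] by metis
  have "nrm (\<lambda>a. T (u m) a - T (u n) a) < e" if "m \<ge> N" "n \<ge> N" for m n
  proof -
    let ?d = "\<lambda>a. u m a - u n a"
    have d: "?d \<in> V" by (intro V_diff V)
    have "nrm (\<lambda>a. T (u m) a - T (u n) a) \<le> C * nrm ?d"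
      using C[OF d] by (simp add: diff V)
    also have "\<dots> \<le> (\<bar>C\<bar> + 1) * nrm ?d"
      using nrm_nonneg[OF d] by (intro mult_right_mono) auto
    also have "\<dots> < e" using N[OF that] by (simp add: pos_less_divide_eq mult.commute)
    finally show ?thesis .
  qed
  then show "\<exists>N. \<forall>m\<ge>N. \<forall>n\<ge>N. nrm (\<lambda>a. T (u m) a - T (u n) a) < e" by blast
qed

lemma represents_add:
  assumes "represents l u" "represents l' v"
  shows "represents (\<lambda>w. l w + l' w) (\<lambda>n a. u n a + v n a)"
  using assms cauchy_seq_add[of u v] represents_V[OF assms(1)] represents_V[OF assms(2)]
  by (auto simp: represents_def B_add intro!: tendsto_add)

lemma represents_scale:
  assumes "represents l u"
  shows "represents (\<lambda>w. c * l w) (\<lambda>n a. c * u n a)"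
  using assms represents_V[OF assms] cauchy_seq_bounded_map[of u "\<lambda>v a. c * v a" "cmod c"]
  by (auto simp: represents_def B_scale V_scale nrm_scale algebra_simps intro!: tendsto_mult_left)

lemma represents_diff_seq:
  assumes "represents l u" "represents l' v"
  shows "represents (\<lambda>w. l w - l' w) (\<lambda>n a. u n a - v n a)"
  using represents_add[OF assms(1) represents_scale[OF assms(2), of "-1"]] by simp

text \<open>The value \<open>0\<close> outside \<open>V\<close> is the normalisation required by
  \<open>represents\<close>. Null vectors of \<open>B\<close> become the zero functional, which
  takes the place of a quotient.\<close>

definition embed :: "('a \<Rightarrow> complex) \<Rightarrow> ('a \<Rightarrow> complex) \<Rightarrow> complex" where
  "embed v w = (if w \<in> V then B v w else 0)"

lemma represents_embed: "v \<in> V \<Longrightarrow> represents (embed v) (\<lambda>_. v)"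
  using B_self[OF V_zero] B_scale[OF V_zero V_zero, of 0]
  by (auto simp: represents_def cauchy_seq_def embed_def nrm_def)

lemma inner_embed: "u \<in> V \<Longrightarrow> v \<in> V \<Longrightarrow> hinner completion (embed u) (embed v) = B u v"
  by (rule LIMSEQ_unique[OF represents_inner[OF represents_embed represents_embed] tendsto_const])

end

text \<open>By the parallelogram law a sequence in \<open>M\<close> that minimises the distance to
  \<open>x\<close> is Cauchy, and at its limit the first variation of the distance vanishes.\<close>

lemma (in hilbert_space) orthogonal_projection:
  assumes M: "M \<subseteq> hcarrier H" "hzero H \<in> M"
      "\<And>x y. x \<in> M \<Longrightarrow> y \<in> M \<Longrightarrow> hadd H x y \<in> M" "\<And>c x. x \<in> M \<Longrightarrow> hscale H c x \<in> M"
    and closed: "\<And>X x. (\<And>n. X n \<in> M) \<Longrightarrow> x \<in> hcarrier H \<Longrightarrow>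
        (\<lambda>n::nat. hnorm H (hdiff H (X n) x)) \<longlonglongrightarrow> 0 \<Longrightarrow> x \<in> M"
    and x: "x \<in> hcarrier H"
  obtains y where "y \<in> M" "\<And>z. z \<in> M \<Longrightarrow> hinner H (hdiff H x y) z = 0"
proof -
  define D where "D = (\<lambda>y. (hdist x y)\<^sup>2) ` M"
  define d where "d = Inf D"
  have MH: "y \<in> hcarrier H" if "y \<in> M" for y using M that by blast
  have D0: "D \<noteq> {}" "bdd_below D"
    using M(2) unfolding D_def by (auto intro!: bdd_belowI[of _ 0])
  have dle: "d \<le> (hdist x y)\<^sup>2" if "y \<in> M" for y
    unfolding d_def using D0 that by (intro cInf_lower) (auto simp: D_def)
  have sq: "(hnorm H u)\<^sup>2 = Re (hinner H u u)" if "u \<in> hcarrier H" for u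
    using inner_nonneg[OF that] by (simp add: hnorm_def)
  have para: "(hdist y z)\<^sup>2 = 2 * (hdist x y)\<^sup>2 + 2 * (hdist x z)\<^sup>2
      - 4 * (hdist x (hscale H (1/2) (hadd H y z)))\<^sup>2" if y: "y \<in> M" and z: "z \<in> M" for y z
    using x MH[OF y] MH[OF z]
    by (simp add: sq hdiff_def inner_simps algebra_simps)
  have cau: "(hdist y z)\<^sup>2 \<le> 4 * e" if y: "y \<in> M" "(hdist x y)\<^sup>2 < d + e"
    and z: "z \<in> M" "(hdist x z)\<^sup>2 < d + e" for y z e
  proof -
    have "d \<le> (hdist x (hscale H (1/2) (hadd H y z)))\<^sup>2" by (intro dle M y z)
    then show ?thesis using para[OF y(1) z(1)] y(2) z(2) by linarith
  qed
  have "\<exists>y\<in>M. (hdist x y)\<^sup>2 < d + 1 / real (Suc n)" for n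
  proof -
    have "Inf D < d + 1 / real (Suc n)" by (simp add: d_def)
    then obtain t where "t \<in> D" "t < d + 1 / real (Suc n)" using D0 by (meson cInf_lessD)
    then show ?thesis by (auto simp: D_def)
  qed
  then obtain Y where Y: "\<And>n. Y n \<in> M" "\<And>n. (hdist x (Y n))\<^sup>2 < d + 1 / real (Suc n)" by metis
  have tail: "hdist (Y m) (Y n) \<le> sqrt (4 / real (Suc N))" if "m \<ge> N" "n \<ge> N" for m n N
  proof (rule real_le_rsqrt)
    have *: "(hdist x (Y k))\<^sup>2 < d + 1 / real (Suc N)" if "k \<ge> N" for k
    proof -
      have "1 / real (Suc k) \<le> 1 / real (Suc N)" using that by (simp add: frac_le)
      then show ?thesis using Y(2)[of k] by linarith
    qed
    show "(hdist (Y m) (Y n))\<^sup>2 \<le> 4 / real (Suc N)"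
      using cau[OF Y(1) *[OF that(1)] Y(1) *[OF that(2)]] by simp
  qed
  have lim0: "(\<lambda>N. sqrt (4 / real (Suc N))) \<longlonglongrightarrow> 0"
    using tendsto_real_sqrt[OF LIMSEQ_Suc[OF lim_const_over_n[of "4::real"]]] by simp
  have "\<exists>y\<in>hcarrier H. (\<lambda>n. hdist (Y n) y) \<longlonglongrightarrow> 0"
  proof (rule complete)
    fix e :: real assume "e > 0"
    then obtain N where "sqrt (4 / real (Suc N)) < e"
      using order_tendstoD(2)[OF lim0, of e] by (auto simp: eventually_sequentially)
    then show "\<exists>N. \<forall>m\<ge>N. \<forall>n\<ge>N. hdist (Y m) (Y n) < e"
      using tail by (meson le_less_trans)
  qed (use Y MH in blast)
  then obtain y where y: "y \<in> hcarrier H" "(\<lambda>n. hdist (Y n) y) \<longlonglongrightarrow> 0" by blast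
  have yM: "y \<in> M" using closed[OF Y(1) y] .
  have dy: "(hdist x y)\<^sup>2 \<le> d"
  proof (rule LIMSEQ_le_const)
    have "(\<lambda>n. (sqrt (d + 1 / real (Suc n)) + hdist (Y n) y)\<^sup>2) \<longlonglongrightarrow> (sqrt (d + 0) + 0)\<^sup>2"
      using y(2) by (intro tendsto_intros LIMSEQ_Suc[OF lim_const_over_n])
    moreover have "d \<ge> 0" unfolding d_def using D0 by (intro cInf_greatest) (auto simp: D_def)
    ultimately show "(\<lambda>n. (sqrt (d + 1 / real (Suc n)) + hdist (Y n) y)\<^sup>2) \<longlonglongrightarrow> d" by simp
    have "(hdist x y)\<^sup>2 \<le> (sqrt (d + 1 / real (Suc n)) + hdist (Y n) y)\<^sup>2" for n
    proof (rule power_mono)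
      have "hdist x (Y n) \<le> sqrt (d + 1 / real (Suc n))"
        using Y(2)[of n] by (intro real_le_rsqrt) simp
      then show "hdist x y \<le> sqrt (d + 1 / real (Suc n)) + hdist (Y n) y"
        using dist_triangle[of x "Y n" y] x y(1) MH[OF Y(1)] by fastforce
    qed (use x y diff_closed norm_nonneg in blast)
    then show "\<exists>N. \<forall>n\<ge>N. (hdist x y)\<^sup>2 \<le> (sqrt (d + 1 / real (Suc n)) + hdist (Y n) y)\<^sup>2" by blast
  qed
  have "hinner H (hdiff H x y) z = 0" if z: "z \<in> M" for z
  proof (rule ccontr)
    define w where "w = hinner H (hdiff H x y) z"
    assume "hinner H (hdiff H x y) z \<noteq> 0"
    then have w: "cmod w > 0" by (simp add: w_def)
    define N where "N = (hnorm H z)\<^sup>2"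
    have N: "N \<ge> 0" by (simp add: N_def)
    \<comment> \<open>\<open>y\<close> is compared with the competitor \<open>y + t w z\<close>; the
      factor \<open>w\<close> makes the term linear in \<open>t\<close> real.\<close>
    have ineq: "2 * t * (cmod w)\<^sup>2 \<le> t\<^sup>2 * (cmod w)\<^sup>2 * N" for t :: real
    proof -
      let ?c = "of_real t * w"
      let ?u = "hdiff H x (hadd H y (hscale H ?c z))"
      have M': "hadd H y (hscale H ?c z) \<in> M" by (intro M yM z)
      have "complex_of_real ((hnorm H ?u)\<^sup>2) = hinner H ?u ?u"
        by (rule inner_self[symmetric, OF diff_closed[OF x MH[OF M']]])
      also have "\<dots> = hinner H (hdiff H x y) (hdiff H x y) - cnj ?c * w - ?c * cnj w + ?c * cnj ?c * hinner H z z"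
        using x y(1) MH[OF z] inner_cnj[OF x MH[OF z]] inner_cnj[OF y(1) MH[OF z]]
        by (simp add: w_def hdiff_def inner_simps algebra_simps)
      also have "\<dots> = hinner H (hdiff H x y) (hdiff H x y)
          - of_real (2 * t) * (w * cnj w) + of_real (t\<^sup>2) * (w * cnj w) * hinner H z z"
        by (simp add: power2_eq_square algebra_simps)
      also have "\<dots> = of_real ((hdist x y)\<^sup>2 - 2 * t * (cmod w)\<^sup>2 + t\<^sup>2 * (cmod w)\<^sup>2 * N)"
        unfolding inner_self[OF diff_closed[OF x y(1)]] inner_self[OF MH[OF z]] N_def
        by (simp only: complex_norm_square[symmetric] of_real_mult of_real_diff of_real_add)
      finally have "(hnorm H ?u)\<^sup>2 = (hdist x y)\<^sup>2 - 2 * t * (cmod w)\<^sup>2 + t\<^sup>2 * (cmod w)\<^sup>2 * N"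
        by (simp only: of_real_eq_iff)
      with dy dle[OF M'] show ?thesis by linarith
    qed
    \<comment> \<open>Any \<open>t > 0\<close> with \<open>t * N < 2\<close> contradicts
      \<open>ineq\<close>; the added \<open>1\<close> avoids division by zero when
      \<open>N = 0\<close>.\<close>
    define s where "s = 1 / (N + 1)"
    have "s > 0" "s * N < 1" using N by (auto simp: s_def field_simps)
    then have pos: "s * (cmod w)\<^sup>2 > 0" using w by simp
    have "2 * (s * (cmod w)\<^sup>2) \<le> (s * N) * (s * (cmod w)\<^sup>2)"
      using ineq[of s] by (simp add: power2_eq_square ac_simps)
    then have "2 \<le> s * N" using pos by (simp only: mult_le_cancel_right)
    with \<open>s * N < 1\<close> show False by simp
  qed
  then show ?thesis using that yM by blast
qed

section \<open>Completeness of the completion\<close>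

context pre_hilbert
begin

text \<open>Cauchy-Schwarz bounds \<open>B (v n) w\<close> by \<open>nrm (v n) * nrm w\<close>,
  which tends to \<open>0\<close>.\<close>

lemma represents_eq_zero:
  assumes "represents l v" "hinner completion l l = 0"
  shows "l = (\<lambda>_. 0)"
proof
  fix w show "l w = 0"
  proof (cases "w \<in> V")
    case True
    have "(\<lambda>n. B (v n) (v n)) \<longlonglongrightarrow> 0"
      using represents_inner[OF assms(1,1)] assms(2) by simp
    then have "(\<lambda>n. sqrt (Re (B (v n) (v n)))) \<longlonglongrightarrow> sqrt (Re 0)"
      by (intro tendsto_intros)
    then have "(\<lambda>n. nrm (v n) * nrm w) \<longlonglongrightarrow> 0"
      using tendsto_mult_right[of _ 0] by (fastforce simp: nrm_def)
    then have "(\<lambda>n. B (v n) w) \<longlonglongrightarrow> 0"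
      by (rule Lim_null_comparison[rotated])
        (simp add: cauchy_schwarz represents_V[OF assms(1)] True)
    then show ?thesis using represents_lim[OF assms(1) True] by (rule LIMSEQ_unique[rotated])
  qed (use assms in \<open>simp add: represents_def\<close>)
qed

text \<open>Applying the locale to the completion provides Cauchy-Schwarz and the triangle
  inequality there before completeness is available.\<close>

lemma pre_hilbert_completion: "pre_hilbert (hcarrier completion) (hinner completion)"
proof
  have "represents (\<lambda>_. 0) (\<lambda>_ _. 0)"
    using represents_embed[OF V_zero] B_scale[OF V_zero, of _ 0]
    by (simp add: embed_def[abs_def] if_distrib cong: if_cong)
  then show "(\<lambda>_. 0) \<in> hcarrier completion" by auto
  fix l l' assume "l \<in> hcarrier completion" "l' \<in> hcarrier completion"
  then obtain u v where r: "represents l u" "represents l' v" by auto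
  note V = represents_V[OF r(1)] represents_V[OF r(2)]
  show "(\<lambda>a. l a + l' a) \<in> hcarrier completion" using represents_add[OF r] by auto
  fix c show "(\<lambda>a. c * l a) \<in> hcarrier completion" using represents_scale[OF r(1)] by auto
  show "hinner completion (\<lambda>a. c * l a) l' = c * hinner completion l l'"
    using represents_inner[OF represents_scale[OF r(1)] r(2), of c]
      tendsto_mult_left[OF represents_inner[OF r], of c]
    by (simp add: B_scale V LIMSEQ_unique)
  have "(\<lambda>n. B (v n) (u n)) = (\<lambda>n. cnj (B (u n) (v n)))" by (intro ext B_cnj V)
  then show "hinner completion l' l = cnj (hinner completion l l')"
    using represents_inner[OF r(2,1)] tendsto_cnj[OF represents_inner[OF r]]
    by (simp only: LIMSEQ_unique)
  have "(\<lambda>n. Re (B (u n) (u n))) \<longlonglongrightarrow> Re (hinner completion l l)"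
    by (intro tendsto_Re represents_inner r)
  then show "0 \<le> Re (hinner completion l l)"
    by (rule LIMSEQ_le_const) (use B_nonneg V in blast)
  fix l'' assume "l'' \<in> hcarrier completion"
  then obtain w where r': "represents l'' w" by auto
  show "hinner completion (\<lambda>a. l a + l' a) l'' = hinner completion l l'' + hinner completion l' l''"
    using represents_inner[OF represents_add[OF r] r']
      tendsto_add[OF represents_inner[OF r(1) r'] represents_inner[OF r(2) r']]
    by (simp add: B_add V represents_V[OF r'] LIMSEQ_unique)
qed

lemma represents_dist:
  assumes "represents l u" "represents l' v"
  shows "(\<lambda>n. nrm (\<lambda>a. u n a - v n a)) \<longlonglongrightarrow> hnorm completion (\<lambda>w. l w - l' w)"
  unfolding nrm_def hnorm_def
  by (intro tendsto_intros represents_inner represents_diff_seq assms)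

lemma embed_dense:
  assumes l: "represents l v" and e: "e > 0"
  shows "\<exists>u\<in>V. hnorm completion (\<lambda>w. l w - embed u w) < e"
proof -
  obtain N where N: "\<And>m n. m \<ge> N \<Longrightarrow> n \<ge> N \<Longrightarrow> nrm (\<lambda>a. v m a - v n a) < e / 2"
    using cauchy_seqD[of v "e/2"] l e unfolding represents_def by auto
  have V: "v N \<in> V" by (rule represents_V[OF l])
  have "hnorm completion (\<lambda>w. l w - embed (v N) w) \<le> e / 2"
    by (rule LIMSEQ_le_const2[OF represents_dist[OF l represents_embed[OF V]]])
      (use N[of _ N] in \<open>auto intro: less_imp_le\<close>)
  then show ?thesis using V e by (intro bexI[of _ "v N"]) auto
qed

lemma hilbert_space_completion: "hilbert_space completion"
proof -
  interpret C: pre_hilbert "hcarrier completion" "hinner completion"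
    by (rule pre_hilbert_completion)
  have nrm: "C.nrm l = hnorm completion l" for l by (simp add: C.nrm_def hnorm_def)
  have embH: "embed u \<in> hcarrier completion" if "u \<in> V" for u
    using represents_embed[OF that] by auto
  show ?thesis
  proof (unfold_locales, goal_cases)
    \<comment> \<open>Goal 17 is completeness. Each \<open>X n\<close> is replaced by an embedded
      vector at distance less than \<open>1 / Suc n\<close>; these vectors form a Cauchy sequence
      \<open>v\<close>, and the functional that it represents is the limit.\<close>
    case (17 X)
    then have XH: "X n \<in> hcarrier completion" for n by auto
    have "\<exists>u\<in>V. hnorm completion (\<lambda>w. X n w - embed u w) < 1 / real (Suc n)" for n
      using embed_dense 17(1)[of n] by auto
    then obtain v where v: "\<And>n. v n \<in> V"
      "\<And>n. hnorm completion (\<lambda>w. X n w - embed (v n) w) < 1 / real (Suc n)" by metis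
    have nd: "nrm (\<lambda>a. v m a - v n a) = hnorm completion (\<lambda>w. embed (v m) w - embed (v n) w)" for m n
      using represents_dist[OF represents_embed[OF v(1)] represents_embed[OF v(1)], of m n] LIMSEQ_unique
        tendsto_const by blast
    have lim0: "(\<lambda>n. 1 / real (Suc n)) \<longlonglongrightarrow> 0"
      by (rule LIMSEQ_Suc[OF lim_const_over_n])
    have cs: "cauchy_seq v"
      unfolding cauchy_seq_def
    proof (intro conjI allI impI v)
      fix e :: real assume e: "e > 0"
      obtain N where N: "\<And>n. n \<ge> N \<Longrightarrow> 1 / real (Suc n) < e / 3"
        using order_tendstoD(2)[OF lim0, of "e/3"] e by (auto simp: eventually_sequentially)
      obtain M where M: "\<And>m n. m \<ge> M \<Longrightarrow> n \<ge> M \<Longrightarrow> hnorm completion (\<lambda>w. X m w - X n w) < e / 3"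
        using 17(2)[of "e/3"] e by auto
      have "nrm (\<lambda>a. v m a - v n a) < e" if "m \<ge> max M N" "n \<ge> max M N" for m n
      proof -
        have "C.nrm (\<lambda>w. embed (v m) w - embed (v n) w) \<le>
          C.nrm (\<lambda>w. embed (v m) w - X m w) + C.nrm (\<lambda>w. X m w - embed (v n) w)"
          by (intro C.nrm_diff_triangle embH v XH)
        moreover have "C.nrm (\<lambda>w. X m w - embed (v n) w) \<le>
          C.nrm (\<lambda>w. X m w - X n w) + C.nrm (\<lambda>w. X n w - embed (v n) w)"
          by (intro C.nrm_diff_triangle embH v XH)
        moreover have "C.nrm (\<lambda>w. embed (v m) w - X m w) = C.nrm (\<lambda>w. X m w - embed (v m) w)"
          by (intro C.nrm_diff_commute embH v XH)
        ultimately show ?thesis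
          using v(2)[of m] v(2)[of n] N[of m] N[of n] M[of m n] that unfolding nd nrm by linarith
      qed
      then show "\<exists>N. \<forall>m\<ge>N. \<forall>n\<ge>N. nrm (\<lambda>a. v m a - v n a) < e" by blast
    qed
    define l where "l w = (if w \<in> V then lim (\<lambda>n. B (v n) w) else 0)" for w
    have l: "represents l v"
      unfolding represents_def
    proof (intro conjI ballI allI impI cs)
      fix w assume w: "w \<in> V"
      \<comment> \<open>\<open>represents_convergent\<close> gives limits in the second argument
        only, so \<open>w\<close> and \<open>v n\<close> exchange their places by
        conjugation.\<close>
      obtain z where "(\<lambda>n. embed w (v n)) \<longlonglongrightarrow> z"
        using represents_convergent[OF represents_embed[OF w] cs] by (auto simp: convergent_def)
      then have "(\<lambda>n. cnj (embed w (v n))) \<longlonglongrightarrow> cnj z" by (rule tendsto_cnj)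
      moreover have "(\<lambda>n. cnj (embed w (v n))) = (\<lambda>n. B (v n) w)"
        by (intro ext) (simp add: embed_def v B_cnj[OF w v(1)])
      ultimately show "(\<lambda>n. B (v n) w) \<longlonglongrightarrow> l w"
        using w by (metis l_def limI)
    qed (simp add: l_def)
    then have lH: "l \<in> hcarrier completion" by auto
    have "(\<lambda>n. hnorm completion (\<lambda>w. X n w - l w)) \<longlonglongrightarrow> 0"
    proof (rule LIMSEQ_I)
      fix e :: real assume e: "e > 0"
      obtain N where N: "\<And>n. n \<ge> N \<Longrightarrow> 1 / real (Suc n) < e / 3"
        using order_tendstoD(2)[OF lim0, of "e/3"] e by (auto simp: eventually_sequentially)
      obtain M where M: "\<And>m n. m \<ge> M \<Longrightarrow> n \<ge> M \<Longrightarrow> nrm (\<lambda>a. v m a - v n a) < e / 3"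
        using cauchy_seqD[OF cs, of "e/3"] e by auto
      have "norm (hnorm completion (\<lambda>w. X n w - l w) - 0) < e" if n: "n \<ge> max M N" for n
      proof -
        have "hnorm completion (\<lambda>w. embed (v n) w - l w) \<le> e / 3"
          by (rule LIMSEQ_le_const2[OF represents_dist[OF represents_embed[OF v(1)] l]])
            (use M[of n] n in \<open>auto intro!: exI[of _ M] less_imp_le\<close>)
        moreover have "C.nrm (\<lambda>w. X n w - l w) \<le>
            C.nrm (\<lambda>w. X n w - embed (v n) w) + C.nrm (\<lambda>w. embed (v n) w - l w)"
          by (intro C.nrm_diff_triangle embH v XH lH)
        moreover have "0 \<le> C.nrm (\<lambda>w. X n w - l w)" by (intro C.nrm_nonneg C.V_diff XH lH)
        ultimately show ?thesis using v(2)[of n] N[of n] n e unfolding nrm by simp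
      qed
      then show "\<exists>N. \<forall>n\<ge>N. norm (hnorm completion (\<lambda>w. X n w - l w) - 0) < e" by blast
    qed
    then show ?case using lH by auto
  next
    case (14 x y)
    then show ?case by (rule C.B_cnj)
  next
    case (16 x)
    then show ?case using represents_eq_zero by auto
  qed (use C.V_zero C.V_add C.V_scale C.B_add C.B_scale C.B_nonneg
        in \<open>simp_all add: algebra_simps del: completion_simps(1)\<close>)
qed

text \<open>The extension to the completion of an operator with adjoint \<open>S\<close>.\<close>

definition lift_adjoint ::
  "(('a \<Rightarrow> complex) \<Rightarrow> ('a \<Rightarrow> complex)) \<Rightarrow> (('a \<Rightarrow> complex) \<Rightarrow> complex) \<Rightarrow> ('a \<Rightarrow> complex) \<Rightarrow> complex" where
  "lift_adjoint S l w = (if w \<in> V then l (S w) else 0)"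

text \<open>Precomposition with \<open>S\<close> makes the extension independent of representing
  sequences; the bound on \<open>T\<close> ensures that \<open>T (v n)\<close> is a Cauchy sequence
  representing the result.\<close>

lemma represents_lift:
  assumes l: "represents l v"
    and T: "\<And>u. u \<in> V \<Longrightarrow> T u \<in> V" and S: "\<And>u. u \<in> V \<Longrightarrow> S u \<in> V"
    and diff: "\<And>v w. v \<in> V \<Longrightarrow> w \<in> V \<Longrightarrow> T (\<lambda>a. v a - w a) = (\<lambda>a. T v a - T w a)"
    and adj: "\<And>u w. u \<in> V \<Longrightarrow> w \<in> V \<Longrightarrow> B (T u) w = B u (S w)"
    and C: "\<And>u. u \<in> V \<Longrightarrow> nrm (T u) \<le> C * nrm u"
  shows "represents (lift_adjoint S l) (\<lambda>n. T (v n))"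
proof -
  have "cauchy_seq (\<lambda>n. T (v n))"
    using l by (intro cauchy_seq_bounded_map[OF _ T diff C]) (auto simp: represents_def)
  then show ?thesis
    using l represents_V[OF l] by (auto simp: represents_def lift_adjoint_def adj S)
qed

lemma lift_embed:
  assumes "u \<in> V" "\<And>w. w \<in> V \<Longrightarrow> S w \<in> V" "\<And>w. w \<in> V \<Longrightarrow> B u' w = B u (S w)"
  shows "lift_adjoint S (embed u) = embed u'"
  using assms by (auto simp: lift_adjoint_def embed_def)

end

section \<open>Convolution on an etale groupoid\<close>

lemma infsum_eq_sum:
  assumes "finite S" "S \<subseteq> A" "\<And>x. x \<in> A - S \<Longrightarrow> f x = 0"
  shows "infsum f A = sum f S"
proof -
  have "infsum f A = infsum f S"
    using assms by (intro infsum_cong_neutral) auto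
  then show ?thesis using assms(1) by simp
qed

text \<open>Only the finitely many \<open>a\<close> in \<open>S\<close> contribute, each with
  finitely many \<open>b\<close>, so both iterated sums reduce to the same finite double
  sum.\<close>

lemma infsum_swap_finite_support:
  assumes S: "finite S" "S \<subseteq> A" and zero: "\<And>a b. a \<in> A - S \<Longrightarrow> b \<in> B \<Longrightarrow> f a b = 0"
    and fin: "\<And>a. a \<in> S \<Longrightarrow> finite {b \<in> B. f a b \<noteq> 0}"
  shows "(\<Sum>\<^sub>\<infinity>a\<in>A. \<Sum>\<^sub>\<infinity>b\<in>B. f a b) = (\<Sum>\<^sub>\<infinity>b\<in>B. \<Sum>\<^sub>\<infinity>a\<in>A. f a b)"
proof -
  define T where "T = (\<Union>a\<in>S. {b \<in> B. f a b \<noteq> 0})"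
  have T: "finite T" "T \<subseteq> B" using S fin by (auto simp: T_def)
  have z: "f a b = 0" if "a \<in> A" "b \<in> B - T" for a b
    using that zero[of a b] by (cases "a \<in> S") (auto simp: T_def)
  have inner: "(\<Sum>\<^sub>\<infinity>b\<in>B. f a b) = (\<Sum>b\<in>T. f a b)" if "a \<in> A" for a
    using T z that by (intro infsum_eq_sum) auto
  have inner': "(\<Sum>\<^sub>\<infinity>a\<in>A. f a b) = (\<Sum>a\<in>S. f a b)" if "b \<in> B" for b
    using S zero that by (intro infsum_eq_sum) auto
  have "(\<Sum>\<^sub>\<infinity>a\<in>A. \<Sum>\<^sub>\<infinity>b\<in>B. f a b) = (\<Sum>\<^sub>\<infinity>a\<in>A. \<Sum>b\<in>T. f a b)"
    by (intro infsum_cong inner)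
  also have "\<dots> = (\<Sum>a\<in>S. \<Sum>b\<in>T. f a b)"
    using S T zero by (intro infsum_eq_sum) (auto intro!: sum.neutral)
  also have "\<dots> = (\<Sum>b\<in>T. \<Sum>a\<in>S. f a b)" by (rule sum.swap)
  also have "\<dots> = (\<Sum>\<^sub>\<infinity>b\<in>B. \<Sum>a\<in>S. f a b)"
    using S T z by (intro infsum_eq_sum[symmetric]) (auto intro!: sum.neutral)
  also have "\<dots> = (\<Sum>\<^sub>\<infinity>b\<in>B. \<Sum>\<^sub>\<infinity>a\<in>A. f a b)"
    by (intro infsum_cong inner'[symmetric])
  finally show ?thesis .
qed

section \<open>Groupoid identities and convolution as a sum over range fibres\<close>

context groupoid
begin

lemma inv_inv [simp]: "ginv G (ginv G g) = g"
proof -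
  have "ginv G (ginv G g) = gmult G (gmult G g (ginv G g)) (ginv G (ginv G g))"
    using rng_mult_left[of "ginv G (ginv G g)"] by (simp add: mult_inv_right rng_inv src_inv)
  also have "\<dots> = gmult G g (gmult G (ginv G g) (ginv G (ginv G g)))"
    by (simp add: mult_assoc rng_inv src_inv)
  also have "\<dots> = g" by (simp add: mult_inv_right rng_inv mult_src_right)
  finally show ?thesis .
qed

lemma inv_mult_cancel: "src G g = rng G h \<Longrightarrow> gmult G (ginv G g) (gmult G g h) = h"
  using mult_assoc[of "ginv G g" g h] by (simp add: src_inv mult_inv_left rng_mult_left)

lemma mult_inv_cancel: "rng G g = rng G h \<Longrightarrow> gmult G g (gmult G (ginv G g) h) = h"
  using inv_mult_cancel[of "ginv G g" h] by (simp add: src_inv)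

lemma rng_inv_mult: "rng G g = rng G h \<Longrightarrow> rng G (gmult G (ginv G g) h) = src G g"
  by (simp add: rng_mult src_inv rng_inv)

lemma src_inv_mult: "rng G g = rng G h \<Longrightarrow> src G (gmult G (ginv G g) h) = src G h"
  by (simp add: src_mult src_inv)

lemma inv_mult:
  assumes "src G g = rng G h"
  shows "ginv G (gmult G g h) = gmult G (ginv G h) (ginv G g)"
proof -
  let ?p = "gmult G g h" and ?q = "gmult G (ginv G h) (ginv G g)"
  have pq: "src G ?p = rng G ?q" using assms by (simp add: src_mult rng_mult rng_inv src_inv)
  have "gmult G ?p ?q = gmult G g (gmult G h ?q)"
    using assms by (simp add: mult_assoc rng_mult src_inv rng_inv)
  also have "\<dots> = rng G g"
    using assms by (simp add: mult_inv_cancel rng_inv mult_inv_right)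
  finally have "?q = gmult G (ginv G ?p) (rng G g)"
    using inv_mult_cancel[OF pq] by simp
  then show ?thesis
    using mult_src_right[of "ginv G ?p"] assms by (simp add: src_inv rng_mult)
qed

lemma inv_mult_inv:
  "rng G g = rng G h \<Longrightarrow> ginv G (gmult G (ginv G g) h) = gmult G (ginv G h) g"
  by (simp add: inv_mult src_inv)

lemma inv_mult_mult:
  "\<lbrakk>src G h = rng G k; rng G h = rng G g\<rbrakk> \<Longrightarrow>
    gmult G (ginv G (gmult G h k)) g = gmult G (ginv G k) (gmult G (ginv G h) g)"
  by (simp add: inv_mult mult_assoc src_inv rng_inv)

lemma bij_betw_mult: "bij_betw (gmult G g) (range_fibre G (src G g)) (range_fibre G (rng G g))"
  by (rule bij_betw_byWitness[where f' = "gmult G (ginv G g)"])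
    (auto simp: range_fibre_def inv_mult_cancel mult_inv_cancel rng_mult rng_inv_mult)

lemma bij_betw_inv: "bij_betw (ginv G) (source_fibre G x) (range_fibre G x)"
  by (rule bij_betw_byWitness[where f' = "ginv G"])
    (auto simp: range_fibre_def source_fibre_def rng_inv src_inv)

lemma infsum_source_fibre: "(\<Sum>\<^sub>\<infinity>g\<in>source_fibre G x. f g) = (\<Sum>\<^sub>\<infinity>g\<in>range_fibre G x. f (ginv G g))"
  using infsum_reindex_bij_betw[OF bij_betw_inv, of "\<lambda>g. f (ginv G g)" x] by simp

lemma units_iff: "x \<in> units G \<longleftrightarrow> rng G x = x"
  using units_alt[OF groupoid_axioms] by simp

lemma unit_simps:
  assumes "x \<in> units G" shows "rng G x = x" "src G x = x" "ginv G x = x"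
proof -
  show r: "rng G x = x" using assms by (simp add: units_iff)
  show s: "src G x = x" using src_rng[of x] r by simp
  have "ginv G x = gmult G x (ginv G x)"
    using rng_mult_left[of "ginv G x"] s by (simp add: rng_inv)
  also have "\<dots> = x" using r by (simp add: mult_inv_right)
  finally show "ginv G x = x" .
qed

lemma rng_units [simp]: "rng G g \<in> units G" and src_units [simp]: "src G g \<in> units G"
  by (simp_all add: units_iff rng_rng rng_src)

lemma inv_unit_iff: "ginv G g \<in> units G \<longleftrightarrow> g \<in> units G"
  by (metis inv_inv unit_simps(3))

lemma inv_mult_unit_iff:
  assumes "rng G h = rng G g" shows "gmult G (ginv G h) g \<in> units G \<longleftrightarrow> h = g"
proof
  assume u: "gmult G (ginv G h) g \<in> units G"
  have "gmult G (ginv G h) g = src G h"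
    using unit_simps(1)[OF u] assms by (simp add: rng_inv_mult)
  then have "g = gmult G h (src G h)" using mult_inv_cancel[OF assms] by simp
  then show "h = g" by (simp add: mult_src_right)
qed (simp add: mult_inv_left)

text \<open>A factorisation \<open>g = h k\<close> is determined by \<open>h\<close>, since
  \<open>k\<close> is the inverse of \<open>h\<close> times \<open>g\<close>. In this form every
  value of a convolution is a sum over one range fibre.\<close>

lemma conv_eq: "conv G f1 f2 g = (\<Sum>\<^sub>\<infinity>h\<in>range_fibre G (rng G g). f1 h * f2 (gmult G (ginv G h) g))"
proof -
  have "bij_betw (\<lambda>h. (h, gmult G (ginv G h) g)) (range_fibre G (rng G g))
     {(h, k). (h, k) \<in> composable G \<and> gmult G h k = g}"
    by (rule bij_betw_byWitness[where f' = fst])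
      (auto simp: range_fibre_def composable_def rng_mult inv_mult_cancel mult_inv_cancel rng_inv_mult)
  then show ?thesis
    unfolding conv_def by (subst infsum_reindex_bij_betw[symmetric]) auto
qed

lemma conv_cong:
  assumes "\<And>h. rng G h = rng G g \<Longrightarrow> f1 h * f2 (gmult G (ginv G h) g) = f1' h * f2' (gmult G (ginv G h) g)"
  shows "conv G f1 f2 g = conv G f1' f2' g"
  unfolding conv_eq using assms by (intro infsum_cong) (simp add: range_fibre_def)

lemma star_star [simp]: "star G (star G f) = f"
  by (simp add: star_def fun_eq_iff)

lemma star_conv: "star G (conv G f1 f2) = conv G (star G f2) (star G f1)"
proof
  fix g
  have "star G (conv G f1 f2) g = (\<Sum>\<^sub>\<infinity>k\<in>range_fibre G (src G g). cnj (f1 k) * cnj (f2 (gmult G (ginv G k) (ginv G g))))"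
    by (simp add: star_def conv_eq rng_inv flip: infsum_cnj)
  also have "\<dots> = (\<Sum>\<^sub>\<infinity>k\<in>range_fibre G (src G g).
      star G f2 (gmult G g k) * star G f1 (gmult G (ginv G (gmult G g k)) g))"
  proof (intro infsum_cong)
    fix k assume "k \<in> range_fibre G (src G g)"
    then have k: "rng G k = src G g" by (simp add: range_fibre_def)
    have "ginv G (gmult G (ginv G (gmult G g k)) g) = k"
      using k by (simp add: inv_mult_inv rng_mult inv_mult_cancel)
    then show "cnj (f1 k) * cnj (f2 (gmult G (ginv G k) (ginv G g))) =
        star G f2 (gmult G g k) * star G f1 (gmult G (ginv G (gmult G g k)) g)"
      using k by (simp add: star_def inv_mult)
  qed
  also have "\<dots> = conv G (star G f2) (star G f1) g"
    unfolding conv_eq by (rule infsum_reindex_bij_betw[OF bij_betw_mult])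
  finally show "star G (conv G f1 f2) g = conv G (star G f2) (star G f1) g" .
qed

text \<open>The algebraic substitute for membership in \<open>Cc\<close>: it makes sums over fibres
  finite and can be used without topology.\<close>

definition fibre_finite :: "('g \<Rightarrow> complex) \<Rightarrow> bool" where
  "fibre_finite f \<longleftrightarrow> (\<forall>x. finite {g \<in> range_fibre G x. f g \<noteq> 0})"

lemma fibre_finite_summable: "fibre_finite f \<Longrightarrow> (\<lambda>h. f h * q h) summable_on range_fibre G x"
  unfolding fibre_finite_def
  by (intro finite_nonzero_values_imp_summable_on) (auto elim!: finite_subset[rotated])

text \<open>Left translation by \<open>h\<close> identifies the fibre over \<open>src G h\<close>
  with the fibre over \<open>x\<close>; after the substitution \<open>m = h k\<close> the two sums
  are exchanged. The free function \<open>q\<close> serves associativity of convolution, the formula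
  for the state, and, when constant, the fibre sums of a convolution.\<close>

lemma infsum_fibre_translate:
  assumes f2: "fibre_finite f2" and f1: "finite {h \<in> range_fibre G x. f1 h \<noteq> 0}"
  shows "(\<Sum>\<^sub>\<infinity>h\<in>range_fibre G x. f1 h * (\<Sum>\<^sub>\<infinity>k\<in>range_fibre G (src G h). f2 k * q (gmult G h k))) =
    (\<Sum>\<^sub>\<infinity>m\<in>range_fibre G x. (\<Sum>\<^sub>\<infinity>h\<in>range_fibre G x. f1 h * f2 (gmult G (ginv G h) m)) * q m)"
proof -
  let ?R = "range_fibre G x"
  have "(\<Sum>\<^sub>\<infinity>h\<in>?R. f1 h * (\<Sum>\<^sub>\<infinity>k\<in>range_fibre G (src G h). f2 k * q (gmult G h k))) =
        (\<Sum>\<^sub>\<infinity>h\<in>?R. \<Sum>\<^sub>\<infinity>m\<in>?R. f1 h * (f2 (gmult G (ginv G h) m) * q m))"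
  proof (intro infsum_cong)
    fix h assume "h \<in> ?R"
    then have h: "rng G h = x" by (simp add: range_fibre_def)
    have "(\<Sum>\<^sub>\<infinity>k\<in>range_fibre G (src G h). f2 k * q (gmult G h k)) =
      (\<Sum>\<^sub>\<infinity>k\<in>range_fibre G (src G h). f2 (gmult G (ginv G h) (gmult G h k)) * q (gmult G h k))"
      by (intro infsum_cong) (simp add: range_fibre_def inv_mult_cancel)
    also have "\<dots> = (\<Sum>\<^sub>\<infinity>m\<in>?R. f2 (gmult G (ginv G h) m) * q m)"
      unfolding h[symmetric] by (rule infsum_reindex_bij_betw[OF bij_betw_mult])
    finally show "f1 h * (\<Sum>\<^sub>\<infinity>k\<in>range_fibre G (src G h). f2 k * q (gmult G h k)) =
        (\<Sum>\<^sub>\<infinity>m\<in>?R. f1 h * (f2 (gmult G (ginv G h) m) * q m))"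
      by (simp add: infsum_cmult_right')
  qed
  also have "\<dots> = (\<Sum>\<^sub>\<infinity>m\<in>?R. \<Sum>\<^sub>\<infinity>h\<in>?R. f1 h * (f2 (gmult G (ginv G h) m) * q m))"
  proof (rule infsum_swap_finite_support[OF f1])
    fix h assume "h \<in> {h \<in> ?R. f1 h \<noteq> 0}"
    then have h: "rng G h = x" by (simp add: range_fibre_def)
    have "{m \<in> ?R. f1 h * (f2 (gmult G (ginv G h) m) * q m) \<noteq> 0} \<subseteq>
        gmult G h ` {k \<in> range_fibre G (src G h). f2 k \<noteq> 0}"
    proof
      fix m assume m: "m \<in> {m \<in> ?R. f1 h * (f2 (gmult G (ginv G h) m) * q m) \<noteq> 0}"
      then have "m = gmult G h (gmult G (ginv G h) m)"
        using h by (simp add: range_fibre_def mult_inv_cancel)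
      then show "m \<in> gmult G h ` {k \<in> range_fibre G (src G h). f2 k \<noteq> 0}"
        using m h by (intro image_eqI) (auto simp: range_fibre_def rng_inv_mult)
    qed
    then show "finite {m \<in> ?R. f1 h * (f2 (gmult G (ginv G h) m) * q m) \<noteq> 0}"
      by (rule finite_subset) (use f2 in \<open>simp add: fibre_finite_def\<close>)
  qed auto
  also have "\<dots> = (\<Sum>\<^sub>\<infinity>m\<in>?R. (\<Sum>\<^sub>\<infinity>h\<in>?R. f1 h * f2 (gmult G (ginv G h) m)) * q m)"
    by (simp add: infsum_cmult_left' flip: mult.assoc)
  finally show ?thesis .
qed

lemma conv_assoc:
  assumes "fibre_finite f1" "fibre_finite f2"
  shows "conv G (conv G f1 f2) f3 = conv G f1 (conv G f2 f3)"
proof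
  fix g
  let ?R = "range_fibre G (rng G g)"
  have "conv G f1 (conv G f2 f3) g = (\<Sum>\<^sub>\<infinity>h\<in>?R. f1 h * (\<Sum>\<^sub>\<infinity>k\<in>range_fibre G (src G h).
      f2 k * f3 (gmult G (ginv G (gmult G h k)) g)))"
  proof (unfold conv_eq, rule infsum_cong)
    fix h assume "h \<in> ?R"
    then have h: "rng G h = rng G g" by (simp add: range_fibre_def)
    show "f1 h * (\<Sum>\<^sub>\<infinity>k\<in>range_fibre G (rng G (gmult G (ginv G h) g)).
          f2 k * f3 (gmult G (ginv G k) (gmult G (ginv G h) g))) =
        f1 h * (\<Sum>\<^sub>\<infinity>k\<in>range_fibre G (src G h). f2 k * f3 (gmult G (ginv G (gmult G h k)) g))"
      unfolding rng_inv_mult[OF h]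
      by (intro arg_cong[where f="(*) _"] infsum_cong) (simp add: range_fibre_def inv_mult_mult h)
  qed
  also have "\<dots> = (\<Sum>\<^sub>\<infinity>m\<in>?R. (\<Sum>\<^sub>\<infinity>h\<in>?R. f1 h * f2 (gmult G (ginv G h) m)) *
      f3 (gmult G (ginv G m) g))"
    using assms by (intro infsum_fibre_translate) (auto simp: fibre_finite_def)
  also have "\<dots> = conv G (conv G f1 f2) f3 g"
    unfolding conv_eq by (intro infsum_cong) (simp add: range_fibre_def)
  finally show "conv G (conv G f1 f2) f3 g = conv G f1 (conv G f2 f3) g" by simp
qed

lemma unit_fun_conv: "conv G (unit_fun G) f = f"
proof
  fix g
  have "conv G (unit_fun G) f g = (\<Sum>h\<in>{rng G g}. unit_fun G h * f (gmult G (ginv G h) g))"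
    unfolding conv_eq
    by (rule infsum_eq_sum) (auto simp: range_fibre_def rng_rng unit_fun_def indicator_def units_iff)
  then show "conv G (unit_fun G) f g = f g"
    by (simp add: unit_fun_def unit_simps rng_mult_left)
qed

lemma conv_unit_fun: "conv G f (unit_fun G) = f"
proof
  fix g
  have "conv G f (unit_fun G) g = (\<Sum>h\<in>{g}. f h * unit_fun G (gmult G (ginv G h) g))"
    unfolding conv_eq
    by (rule infsum_eq_sum) (auto simp: range_fibre_def unit_fun_def indicator_def inv_mult_unit_iff)
  then show "conv G f (unit_fun G) g = f g"
    by (simp add: unit_fun_def mult_inv_left)
qed

lemma star_unit_fun: "star G (unit_fun G) = unit_fun G"
  by (auto simp: star_def unit_fun_def indicator_def inv_unit_iff)

lemma infsum_supported_on_units: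
  assumes "\<And>g. g \<notin> units G \<Longrightarrow> f g = 0" and "x \<in> units G"
  shows "(\<Sum>\<^sub>\<infinity>g\<in>range_fibre G x. f g) = f x"
proof -
  have "(\<Sum>\<^sub>\<infinity>g\<in>range_fibre G x. f g) = (\<Sum>g\<in>{x}. f g)"
    using assms by (intro infsum_eq_sum) (auto simp: range_fibre_def units_iff)
  then show ?thesis by simp
qed

end

section \<open>Continuous functions with compact support as a convolution algebra\<close>

lemma CcI:
  fixes f :: "'g::t2_space \<Rightarrow> complex"
  assumes "continuous_on UNIV f" "compact C" "\<And>g. g \<notin> C \<Longrightarrow> f g = 0"
  shows "f \<in> Cc"
proof -
  have "support f \<subseteq> C"
    unfolding support_def using assms by (intro closure_minimal compact_imp_closed) auto
  then have "compact (support f)"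
    using compact_Int_closed[OF assms(2), of "support f"] by (simp add: Int_absorb1 support_def)
  then show ?thesis using assms by (simp add: Cc_def)
qed

lemma CcD:
  assumes "f \<in> Cc"
  shows "continuous_on UNIV f" "compact (support f)" "g \<notin> support f \<Longrightarrow> f g = 0"
  using assms closure_subset[of "{g. f g \<noteq> 0}"] by (auto simp: Cc_def support_def)

lemma Cc_add:
  fixes f1 f2 :: "'g::t2_space \<Rightarrow> complex"
  assumes "f1 \<in> Cc" "f2 \<in> Cc" shows "(\<lambda>g. f1 g + f2 g) \<in> Cc"
  using assms CcD(3)[OF assms(1)] CcD(3)[OF assms(2)]
  by (intro CcI[of _ "support f1 \<union> support f2"]) (auto intro!: continuous_intros dest: CcD(1,2))

lemma Cc_mult:
  fixes f :: "'g::t2_space \<Rightarrow> complex"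
  assumes "f \<in> Cc" "continuous_on UNIV q" shows "(\<lambda>g. f g * q g) \<in> Cc"
  using assms by (intro CcI[of _ "support f"]) (auto intro!: continuous_intros dest: CcD)

lemma Cc_scale:
  fixes f :: "'g::t2_space \<Rightarrow> complex"
  assumes "f \<in> Cc" shows "(\<lambda>g. c * f g) \<in> Cc"
  using Cc_mult[OF assms, of "\<lambda>_. c"] by (simp add: mult.commute)

lemma Cc_diff:
  fixes f1 f2 :: "'g::t2_space \<Rightarrow> complex"
  assumes "f1 \<in> Cc" "f2 \<in> Cc" shows "(\<lambda>g. f1 g - f2 g) \<in> Cc"
  using Cc_add[OF assms(1) Cc_scale[OF assms(2), of "-1"]] by simp

lemma Cc_cnj:
  fixes f :: "'g::t2_space \<Rightarrow> complex"
  assumes "f \<in> Cc" shows "(\<lambda>g. cnj (f g)) \<in> Cc"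
  using assms by (intro CcI[of _ "support f"]) (auto intro!: continuous_intros dest: CcD)

lemma Cc_bounded:
  fixes f :: "'g::t2_space \<Rightarrow> complex"
  assumes "f \<in> Cc"
  obtains C where "\<And>g. cmod (f g) \<le> C" "C > 0"
proof -
  have "compact (f ` support f)"
    using CcD[OF assms] continuous_on_subset by (blast intro: compact_continuous_image)
  then obtain C where "C > 0" "\<forall>z\<in>f ` support f. cmod z \<le> C"
    using compact_imp_bounded bounded_pos by blast
  then have "cmod (f g) \<le> C" for g
    using CcD(3)[OF assms, of g] by (cases "g \<in> support f") auto
  then show ?thesis using \<open>C > 0\<close> that by blast
qed

locale etale_t2 = etale_groupoid G for G :: "'g::t2_space groupoid_ops" +
  assumes compact_units: "compact (units G)"
begin

lemma bisection_section:
  obtains B t where "\<And>g. open (B g)" "\<And>g. g \<in> B g" "\<And>g. inj_on (rng G) (B g)"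
    "\<And>g. open (rng G ` B g)" "\<And>g. homeomorphism (B g) (rng G ` B g) (rng G) (t g)"
proof -
  have "\<forall>g. \<exists>B t. open_bisection G B \<and> g \<in> B \<and> homeomorphism B (rng G ` B) (rng G) t"
  proof
    fix g
    obtain B where "open_bisection G B" "g \<in> B"
      using topological_basisE[OF basis_of_bisections open_UNIV, of g] by auto
    then show "\<exists>B t. open_bisection G B \<and> g \<in> B \<and> homeomorphism B (rng G ` B) (rng G) t"
      unfolding open_bisection_def by blast
  qed
  then obtain B t where B: "\<And>g. open_bisection G (B g)" "\<And>g. g \<in> B g"
    and t: "\<And>g. homeomorphism (B g) (rng G ` B g) (rng G) (t g)"
    by metis
  have "open (B g)" "open (rng G ` B g)" for g
    using B(1)[of g] open_units[OF etale_groupoid_axioms] by (auto simp: open_bisection_def openin_open_eq)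
  moreover have "inj_on (rng G) (B g)" for g
    using t[of g] unfolding homeomorphism_def by (metis inj_onI)
  ultimately show ?thesis using that B t by blast
qed

text \<open>Each chosen bisection meets a range fibre at most once, so the size of a finite cover of
  \<open>C\<close> by bisections bounds all fibres simultaneously.\<close>

lemma compact_fibre_card:
  assumes "compact C"
  obtains N :: nat where "N > 0" "\<And>x. finite (range_fibre G x \<inter> C)" "\<And>x. card (range_fibre G x \<inter> C) \<le> N"
proof -
  obtain B t where B: "\<And>g. open (B g)" "\<And>g. g \<in> B g" "\<And>g. inj_on (rng G) (B g)"
    "\<And>g. open (rng G ` B g)" "\<And>g. homeomorphism (B g) (rng G ` B g) (rng G) (t g)"
    by (rule bisection_section) blast
  obtain D where D: "D \<subseteq> C" "finite D" "C \<subseteq> (\<Union>g\<in>D. B g)"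
    using compactE_image[OF assms, of C B] B(1,2) by (metis UN_I subsetI)
  have one: "finite (range_fibre G x \<inter> B g) \<and> card (range_fibre G x \<inter> B g) \<le> 1" for x g
  proof (cases "range_fibre G x \<inter> B g = {}")
    case False
    then obtain h where "h \<in> range_fibre G x \<inter> B g" by blast
    then have "range_fibre G x \<inter> B g = {h}"
      using inj_onD[OF B(3)[of g]] by (auto simp: range_fibre_def)
    then show ?thesis by simp
  qed simp
  have "finite (range_fibre G x \<inter> C) \<and> card (range_fibre G x \<inter> C) \<le> card D" for x
  proof -
    have sub: "range_fibre G x \<inter> C \<subseteq> (\<Union>g\<in>D. range_fibre G x \<inter> B g)" using D by blast
    have fin: "finite (\<Union>g\<in>D. range_fibre G x \<inter> B g)" using D one by blast
    have "card (range_fibre G x \<inter> C) \<le> card (\<Union>g\<in>D. range_fibre G x \<inter> B g)"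
      using fin sub by (rule card_mono)
    also have "\<dots> \<le> (\<Sum>g\<in>D. card (range_fibre G x \<inter> B g))" using D(2) by (rule card_UN_le)
    also have "\<dots> \<le> (\<Sum>g\<in>D. 1)" using one by (intro sum_mono) blast
    finally show ?thesis using finite_subset[OF sub fin] by simp
  qed
  \<comment> \<open>The \<open>+ 1\<close> makes the bound positive even for empty \<open>D\<close>;
    it later serves as a denominator.\<close>
  then show ?thesis using that[of "card D + 1"] by (simp add: le_SucI)
qed

lemma Cc_fibre_finite: "f \<in> Cc \<Longrightarrow> fibre_finite f"
  unfolding fibre_finite_def
proof
  fix x assume f: "f \<in> Cc"
  obtain N :: nat where "\<And>x. finite (range_fibre G x \<inter> support f)"
    using compact_fibre_card[OF CcD(2)[OF f]] by metis
  moreover have "{g \<in> range_fibre G x. f g \<noteq> 0} \<subseteq> range_fibre G x \<inter> support f"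
    using CcD(3)[OF f] by auto
  ultimately show "finite {g \<in> range_fibre G x. f g \<noteq> 0}" using finite_subset by blast
qed

text \<open>Near a point the compact set meets the fibres of \<open>rng\<close> only in the values of
  finitely many local sections with distinct values, so the sum is locally a finite sum of
  continuous functions.\<close>

lemma continuous_fibre_sum:
  fixes q :: "'g \<Rightarrow> 'g \<Rightarrow> complex"
  assumes C: "compact C" and q0: "\<And>h g. rng G h = rng G g \<Longrightarrow> h \<notin> C \<Longrightarrow> q h g = 0"
    and cont: "continuous_on {(h, g). rng G h = rng G g} (\<lambda>(h, g). q h g)"
  shows "continuous_on UNIV (\<lambda>g. \<Sum>\<^sub>\<infinity>h\<in>range_fibre G (rng G g). q h g)"
proof -
  let ?f = "\<lambda>g. \<Sum>\<^sub>\<infinity>h\<in>range_fibre G (rng G g). q h g"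
  obtain B t where B: "\<And>g. open (B g)" "\<And>g. g \<in> B g" "\<And>g. inj_on (rng G) (B g)"
    "\<And>g. open (rng G ` B g)" and t: "\<And>g. homeomorphism (B g) (rng G ` B g) (rng G) (t g)"
    by (rule bisection_section) blast
  have tr: "t g (rng G h) = h" if "h \<in> B g" for g h
    using t[of g] that by (simp add: homeomorphism_def)
  have rt: "rng G (t g y) = y" "t g y \<in> B g" if "y \<in> rng G ` B g" for g y
    using t[of g] that by (auto simp: homeomorphism_def)
  have "(?f \<longlongrightarrow> ?f g0) (nhds g0)" for g0
  proof -
    define x where "x = rng G g0"
    define S where "S = range_fibre G x \<inter> C"
    have "finite S" using compact_fibre_card[OF C] S_def by metis
    have Sx: "rng G h = x" if "h \<in> S" for h using that by (simp add: S_def range_fibre_def)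
    have xB: "x \<in> rng G ` B h" if "h \<in> S" for h using Sx[OF that] B(2)[of h] by force
    have rlim: "(rng G \<longlongrightarrow> x) (nhds g0)"
      unfolding x_def using continuous_rng
      by (metis UNIV_I continuous_on_eq_continuous_at isCont_def open_UNIV tendsto_at_iff_tendsto_nhds)
    have lim: "((\<lambda>g. t h (rng G g)) \<longlongrightarrow> h) (nhds g0)" if h: "h \<in> S" for h
    proof -
      have "isCont (t h) x"
        using t[of h] B(4) xB[OF h] unfolding homeomorphism_def
        by (metis continuous_on_eq_continuous_at)
      moreover have "t h x = h" using tr[OF B(2)] Sx[OF h] by metis
      ultimately show ?thesis using isCont_tendsto_compose[OF _ rlim, of "t h"] by simp
    qed
    have ev_dom: "\<forall>\<^sub>F g in nhds g0. \<forall>h\<in>S. rng G g \<in> rng G ` B h"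
      using \<open>finite S\<close> topological_tendstoD[OF rlim B(4)] xB by (simp add: eventually_ball_finite_distrib)
    have ev1: "\<forall>\<^sub>F g in nhds g0. t h (rng G g) \<noteq> t k (rng G g)" if hk: "h \<in> S" "k \<in> S" "h \<noteq> k" for h k
    proof -
      obtain U V where UV: "open U" "open V" "h \<in> U" "k \<in> V" "U \<inter> V = {}"
        using hausdorff[OF hk(3)] by blast
      show ?thesis
        using topological_tendstoD[OF lim[OF hk(1)] UV(1,3)] topological_tendstoD[OF lim[OF hk(2)] UV(2,4)]
        by eventually_elim (use UV in auto)
    qed
    have ev_inj: "\<forall>\<^sub>F g in nhds g0. \<forall>h\<in>S. \<forall>k\<in>S. h \<noteq> k \<longrightarrow> t h (rng G g) \<noteq> t k (rng G g)"
      using \<open>finite S\<close> ev1 by (simp add: eventually_ball_finite_distrib eventually_mono)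
    \<comment> \<open>\<open>L\<close> is the part of \<open>C\<close> missed by the bisections at
      \<open>S\<close>. Its image under \<open>rng G\<close> is closed and does not contain
      \<open>x\<close>, so over nearby base points the sections account for all of
      \<open>C\<close>.\<close>
    define L where "L = C - (\<Union>h\<in>S. B h)"
    have "compact L" unfolding L_def using C B(1) by (intro compact_diff) auto
    then have "closed (rng G ` L)"
      by (intro compact_imp_closed compact_continuous_image continuous_on_subset[OF continuous_rng]) auto
    moreover have "x \<notin> rng G ` L"
      using B(2) by (auto simp: L_def S_def range_fibre_def)
    ultimately have ev_L: "\<forall>\<^sub>F g in nhds g0. rng G g \<in> - rng G ` L"
      by (intro topological_tendstoD[OF rlim]) auto
    have ev: "\<forall>\<^sub>F g in nhds g0. (\<Sum>h\<in>S. q (t h (rng G g)) g) = ?f g"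
      using ev_inj ev_dom ev_L
    proof eventually_elim
      case (elim g)
      have "?f g = sum (\<lambda>h. q h g) ((\<lambda>h. t h (rng G g)) ` S)"
      proof (rule infsum_eq_sum)
        fix k assume k: "k \<in> range_fibre G (rng G g) - (\<lambda>h. t h (rng G g)) ` S"
        then have kr: "rng G k = rng G g" by (simp add: range_fibre_def)
        show "q k g = 0"
        proof (rule ccontr)
          assume "q k g \<noteq> 0"
          then have "k \<in> C" using q0[OF kr] by blast
          then obtain h where "h \<in> S" "k \<in> B h" using elim(3) kr unfolding L_def by (metis ComplD DiffI UN_E imageI)
          then show False using tr[of k h] kr k by auto
        qed
      qed (use elim rt \<open>finite S\<close> in \<open>auto simp: range_fibre_def\<close>)
      also have "\<dots> = (\<Sum>h\<in>S. q (t h (rng G g)) g)"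
        using elim(1) by (subst sum.reindex) (auto simp: inj_on_def)
      finally show ?case by simp
    qed
    have "((\<lambda>g. \<Sum>h\<in>S. q (t h (rng G g)) g) \<longlongrightarrow> (\<Sum>h\<in>S. q h g0)) (nhds g0)"
    proof (intro tendsto_sum)
      fix h assume h: "h \<in> S"
      have "((\<lambda>g. (t h (rng G g), g)) \<longlongrightarrow> (h, g0)) (nhds g0)"
        by (intro tendsto_Pair lim[OF h] filterlim_ident)
      then have "((\<lambda>g. (\<lambda>(h, g). q h g) (t h (rng G g), g)) \<longlongrightarrow> (\<lambda>(h, g). q h g) (h, g0)) (nhds g0)"
      proof (rule continuous_on_tendsto_compose[OF cont])
        show "(h, g0) \<in> {(h, g). rng G h = rng G g}" using Sx[OF h] by (simp add: x_def)
        show "\<forall>\<^sub>F g in nhds g0. (t h (rng G g), g) \<in> {(h, g). rng G h = rng G g}"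
          using ev_dom by eventually_elim (use h rt in auto)
      qed
      then show "((\<lambda>g. q (t h (rng G g)) g) \<longlongrightarrow> q h g0) (nhds g0)" by simp
    qed
    moreover have "(\<Sum>h\<in>S. q h g0) = ?f g0"
      by (rule infsum_eq_sum[symmetric])
        (use \<open>finite S\<close> q0 in \<open>auto simp: S_def x_def range_fibre_def\<close>)
    ultimately show ?thesis using ev by (simp add: tendsto_cong)
  qed
  then have "(?f \<longlongrightarrow> ?f g0) (at g0)" for g0
    by (rule tendsto_at_iff_tendsto_nhds[of ?f g0, THEN iffD2])
  then show ?thesis by (simp add: continuous_on_def)
qed

lemma continuous_inv_mult:
  "continuous_on {(h, g). rng G h = rng G g} (\<lambda>(h, g). gmult G (ginv G h) g)"
proof -
  have "continuous_on {(h, g). rng G h = rng G g} (\<lambda>p. (\<lambda>(h, g). gmult G h g) (ginv G (fst p), snd p))"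
    by (rule continuous_on_compose2[OF continuous_mult])
      (auto intro!: continuous_intros continuous_on_compose2[OF continuous_inv] simp: composable_def src_inv)
  then show ?thesis by (simp add: case_prod_beta)
qed

lemma compact_inv_mult:
  assumes "compact C" "compact D"
  shows "compact ((\<lambda>(h, g). gmult G (ginv G h) g) ` (C \<times> D \<inter> {(h, g). rng G h = rng G g}))"
proof -
  have "closed {p. rng G (fst p) = rng G (snd p)}"
    by (intro closed_Collect_eq continuous_on_compose2[OF continuous_rng] continuous_intros) auto
  moreover have "{(h, g). rng G h = rng G g} = {p. rng G (fst p) = rng G (snd p)}" by auto
  ultimately have "compact (C \<times> D \<inter> {(h, g). rng G h = rng G g})"
    using compact_Int_closed[OF compact_Times[OF assms]] by simp
  then show ?thesis
    by (rule compact_continuous_image[OF continuous_on_subset[OF continuous_inv_mult], rotated]) auto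
qed

text \<open>The second factor is merely continuous because it will be a function of positive type,
  whose support is usually not compact.\<close>

lemma continuous_conv:
  assumes f1: "f1 \<in> Cc" and f2: "continuous_on UNIV f2"
  shows "continuous_on UNIV (conv G f1 f2)"
  unfolding conv_eq[abs_def]
proof (rule continuous_fibre_sum[OF CcD(2)[OF f1]])
  have "continuous_on {(h, g). rng G h = rng G g}
      (\<lambda>p. f1 (fst p) * f2 ((\<lambda>(h, g). gmult G (ginv G h) g) p))"
    by (intro continuous_on_mult continuous_on_compose2[OF f2 continuous_inv_mult]
        continuous_on_compose2[OF CcD(1)[OF f1]] continuous_intros) auto
  then show "continuous_on {(h, g). rng G h = rng G g} (\<lambda>(h, g). f1 h * f2 (gmult G (ginv G h) g))"
    by (simp add: case_prod_beta)
qed (use CcD(3)[OF f1] in auto)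

lemma Cc_conv:
  assumes f1: "f1 \<in> Cc" and f2: "f2 \<in> Cc"
  shows "conv G f1 f2 \<in> Cc"
proof (rule CcI)
  show "continuous_on UNIV (conv G f1 f2)" by (rule continuous_conv[OF f1 CcD(1)[OF f2]])
  \<comment> \<open>The product of the supports is written with the inverse taken twice, so that it
    has the shape treated in \<open>compact_inv_mult\<close>.\<close>
  let ?C = "ginv G ` support f1"
  show "compact ((\<lambda>(h, g). gmult G (ginv G h) g) ` (?C \<times> support f2 \<inter> {(h, g). rng G h = rng G g}))"
    using CcD(2)[OF f1] CcD(2)[OF f2]
    by (intro compact_inv_mult compact_continuous_image continuous_on_subset[OF continuous_inv]) auto
  fix g assume g: "g \<notin> (\<lambda>(h, g). gmult G (ginv G h) g) ` (?C \<times> support f2 \<inter> {(h, g). rng G h = rng G g})"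
  have z: "f1 h * f2 (gmult G (ginv G h) g) = 0" if h: "h \<in> range_fibre G (rng G g)" for h
  proof (rule ccontr)
    assume "f1 h * f2 (gmult G (ginv G h) g) \<noteq> 0"
    then have s: "h \<in> support f1" "gmult G (ginv G h) g \<in> support f2"
      using CcD(3)[OF f1] CcD(3)[OF f2] by auto
    have "g = gmult G (ginv G (ginv G h)) (gmult G (ginv G h) g)"
      using h by (simp add: range_fibre_def mult_inv_cancel)
    moreover have "rng G (ginv G h) = rng G (gmult G (ginv G h) g)"
      using h by (simp add: range_fibre_def rng_inv_mult rng_inv)
    ultimately have "g \<in> (\<lambda>(h, g). gmult G (ginv G h) g) ` (?C \<times> support f2 \<inter> {(h, g). rng G h = rng G g})"
      using s by (intro image_eqI[where x = "(ginv G h, gmult G (ginv G h) g)"]) auto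
    with g show False by blast
  qed
  show "conv G f1 f2 g = 0" unfolding conv_eq by (rule infsum_0) (rule z)
qed

lemma Cc_unit_fun: "unit_fun G \<in> Cc"
proof (rule CcI[OF _ compact_units])
  \<comment> \<open>The unit space is open because the groupoid is etale, and closed because it is
    compact.\<close>
  have "continuous_on (units G \<union> - units G) (unit_fun G)"
    using open_units[OF etale_groupoid_axioms] compact_imp_closed[OF compact_units]
    by (intro continuous_on_open_Un continuous_on_cong[THEN iffD2, OF refl _ continuous_on_const[of _ 1]]
        continuous_on_cong[THEN iffD2, OF refl _ continuous_on_const[of _ 0]])
      (auto simp: unit_fun_def)
  then show "continuous_on UNIV (unit_fun G)" by (simp add: Un_Diff_cancel)
qed (simp add: unit_fun_def)

lemma Cc_inv: "f \<in> Cc \<Longrightarrow> (\<lambda>g. f (ginv G g)) \<in> Cc"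
  using Cc_cnj[OF star_Cc] by (simp add: star_def[abs_def])

lemmas Cc_Psi = Psi_Cc[OF _ etale_groupoid_axioms compact_units]

end

section \<open>Invariant measures and the GNS representation\<close>

lemma (in pre_hilbert) represents_norm:
  assumes "represents l v" shows "(\<lambda>n. nrm (v n)) \<longlonglongrightarrow> hnorm completion l"
  unfolding nrm_def hnorm_def by (intro tendsto_intros represents_inner assms)

lemma (in pre_hilbert) represents_add_arg:
  assumes l: "represents l v" and u: "u \<in> V" and w: "w \<in> V"
  shows "l (\<lambda>a. u a + w a) = l u + l w"
  using represents_diff[OF l V_add[OF u w] w] by simp

lemma (in pre_hilbert) represents_scale_arg:
  assumes l: "represents l v" and u: "u \<in> V"
  shows "l (\<lambda>a. c * u a) = cnj c * l u"
proof (rule LIMSEQ_unique)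
  show "(\<lambda>n. B (v n) (\<lambda>a. c * u a)) \<longlonglongrightarrow> l (\<lambda>a. c * u a)"
    by (intro represents_lim l V_scale u)
  show "(\<lambda>n. B (v n) (\<lambda>a. c * u a)) \<longlonglongrightarrow> cnj c * l u"
    using u by (simp add: B_scale_right represents_V[OF l] tendsto_mult_left represents_lim[OF l])
qed

text \<open>By the Cauchy--Schwarz inequality \<open>\<parallel>T^k u\<parallel>\<^sup>2 \<le> \<parallel>u\<parallel> \<parallel>T^(2k) u\<parallel>\<close>,
  so \<open>\<parallel>T u\<parallel> > C \<parallel>u\<parallel>\<close> would propagate to the powers \<open>2\<^sup>n\<close>.\<close>

lemma (in pre_hilbert) selfadjoint_bounded:
  assumes T: "\<And>u. u \<in> V \<Longrightarrow> T u \<in> V" and sa: "\<And>u w. u \<in> V \<Longrightarrow> w \<in> V \<Longrightarrow> B (T u) w = B u (T w)"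
    and u: "u \<in> V" and growth: "\<And>n. nrm ((T ^^ n) u) \<le> D * C ^ n" and C: "C > 0"
  shows "nrm (T u) \<le> C * nrm u"
proof (rule ccontr)
  assume less: "\<not> nrm (T u) \<le> C * nrm u"
  have TV: "(T ^^ n) u \<in> V" for n by (induction n) (auto simp: u T)
  have sa_pow: "B ((T ^^ n) u) ((T ^^ m) u) = B u ((T ^^ (n + m)) u)" for n m
  proof (induction n arbitrary: m)
    case (Suc n)
    have "B ((T ^^ Suc n) u) ((T ^^ m) u) = B ((T ^^ n) u) ((T ^^ Suc m) u)"
      using sa[OF TV TV, of n m] by simp
    then show ?case using Suc[of "Suc m"] by simp
  qed simp
  have step: "(nrm ((T ^^ n) u))\<^sup>2 \<le> nrm u * nrm ((T ^^ (2 * n)) u)" for n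
  proof -
    have "(nrm ((T ^^ n) u))\<^sup>2 = cmod (B ((T ^^ n) u) ((T ^^ n) u))"
      using B_self[OF TV] by (simp add: norm_power)
    also have "\<dots> \<le> nrm u * nrm ((T ^^ (2 * n)) u)"
      unfolding sa_pow mult_2 by (rule cauchy_schwarz[OF u TV])
    finally show ?thesis .
  qed
  have "nrm u \<noteq> 0"
  proof
    assume "nrm u = 0"
    then have "nrm (T u) = 0" using step[of 1] by simp
    with less \<open>nrm u = 0\<close> show False by simp
  qed
  then have nu: "nrm u > 0" using nrm_nonneg[OF u] by simp
  define r where "r = nrm (T u) / nrm u"
  have r: "r > C" using less nu by (simp add: r_def field_simps)
  have lower: "nrm u * r ^ (2 ^ n) \<le> nrm ((T ^^ (2 ^ n)) u)" for n
  proof (induction n)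
    case 0
    then show ?case using nu by (simp add: r_def)
  next
    case (Suc n)
    have "(nrm u * r ^ (2 ^ n))\<^sup>2 \<le> (nrm ((T ^^ (2 ^ n)) u))\<^sup>2"
      using Suc nu r C by (intro power_mono) auto
    also have "\<dots> \<le> nrm u * nrm ((T ^^ (2 ^ Suc n)) u)" using step[of "2 ^ n"] by simp
    finally have "nrm u * (nrm u * r ^ (2 ^ Suc n)) \<le> nrm u * nrm ((T ^^ (2 ^ Suc n)) u)"
      by (simp add: power2_eq_square power_mult_distrib power_add[symmetric] mult_2 ac_simps)
    then show ?case using nu by (simp only: mult_le_cancel_left_pos)
  qed
  have "1 < r / C" using r C by simp
  then obtain k where k: "D / nrm u < (r / C) ^ k" using real_arch_pow by blast
  also have "\<dots> \<le> (r / C) ^ (2 ^ k)"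
    using \<open>1 < r / C\<close> less_exp[of k] by (intro power_increasing) (auto intro: less_imp_le)
  finally have "D * C ^ (2 ^ k) < nrm u * r ^ (2 ^ k)"
    using nu C by (simp add: field_simps power_divide)
  then show False using lower[of k] growth[of "2 ^ k"] by linarith
qed

context groupoid
begin

lemma conv_add_left:
  assumes "fibre_finite f1" "fibre_finite f2"
  shows "conv G (\<lambda>g. f1 g + f2 g) f = (\<lambda>g. conv G f1 f g + conv G f2 f g)"
  unfolding conv_eq using fibre_finite_summable assms
  by (simp add: distrib_right infsum_add)

lemma conv_add_right:
  assumes "fibre_finite f"
  shows "conv G f (\<lambda>g. f1 g + f2 g) = (\<lambda>g. conv G f f1 g + conv G f f2 g)"
  unfolding conv_eq using fibre_finite_summable assms
  by (simp add: distrib_left infsum_add)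

lemma conv_scale_left: "conv G (\<lambda>g. c * f1 g) f = (\<lambda>g. c * conv G f1 f g)"
  unfolding conv_eq by (simp add: mult.assoc infsum_cmult_right')

lemma conv_scale_right: "conv G f (\<lambda>g. c * f1 g) = (\<lambda>g. c * conv G f f1 g)"
  unfolding conv_eq by (simp add: mult.left_commute[of _ c] infsum_cmult_right')

lemma conv_diff_right:
  assumes "fibre_finite f"
  shows "conv G f (\<lambda>g. f1 g - f2 g) = (\<lambda>g. conv G f f1 g - conv G f f2 g)"
  using conv_add_right[OF assms, of f1 "\<lambda>g. - 1 * f2 g"] unfolding conv_scale_right by simp

text \<open>One half of a bound on \<open>I_norm\<close>; the bound on source sums is the same
  statement for \<open>star G f\<close>.\<close>

definition fibre_l1_le :: "('g \<Rightarrow> complex) \<Rightarrow> real \<Rightarrow> bool" where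
  "fibre_l1_le f C \<longleftrightarrow> (\<forall>x. (\<Sum>\<^sub>\<infinity>g\<in>range_fibre G x. cmod (f g)) \<le> C)"

lemma fibre_sum_finite:
  assumes "fibre_finite f" "\<And>g. f g = 0 \<Longrightarrow> q g = 0"
  shows "(\<Sum>\<^sub>\<infinity>g\<in>range_fibre G x. q g) = (\<Sum>g\<in>{g \<in> range_fibre G x. f g \<noteq> 0}. q g)"
  using assms by (intro infsum_eq_sum) (auto simp: fibre_finite_def)

lemma fibre_l1_leD:
  assumes "fibre_finite f" "fibre_l1_le f C"
  shows "(\<Sum>g\<in>{g \<in> range_fibre G x. f g \<noteq> 0}. cmod (f g)) \<le> C"
proof -
  have "(\<Sum>\<^sub>\<infinity>g\<in>range_fibre G x. cmod (f g)) \<le> C" using assms(2) by (simp add: fibre_l1_le_def)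
  then show ?thesis by (subst (asm) fibre_sum_finite[OF assms(1)]) auto
qed

lemma fibre_l1_le_nonneg:
  assumes "fibre_l1_le f C" shows "0 \<le> C"
proof -
  have "0 \<le> (\<Sum>\<^sub>\<infinity>g\<in>range_fibre G undefined. cmod (f g))" by (intro infsum_nonneg) auto
  also have "\<dots> \<le> C" using assms by (simp add: fibre_l1_le_def)
  finally show ?thesis .
qed

lemma fibre_finite_conv:
  assumes "fibre_finite f1" "fibre_finite f2" shows "fibre_finite (conv G f1 f2)"
  unfolding fibre_finite_def
proof
  fix x
  have "{g \<in> range_fibre G x. conv G f1 f2 g \<noteq> 0} \<subseteq>
    (\<Union>h\<in>{h \<in> range_fibre G x. f1 h \<noteq> 0}. gmult G h ` {k \<in> range_fibre G (src G h). f2 k \<noteq> 0})"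
  proof
    fix g assume g: "g \<in> {g \<in> range_fibre G x. conv G f1 f2 g \<noteq> 0}"
    then obtain h where h: "h \<in> range_fibre G x" "f1 h \<noteq> 0" "f2 (gmult G (ginv G h) g) \<noteq> 0"
      using infsum_0[of "range_fibre G x" "\<lambda>h. f1 h * f2 (gmult G (ginv G h) g)"]
      by (auto simp: conv_eq range_fibre_def)
    then have "gmult G (ginv G h) g \<in> {k \<in> range_fibre G (src G h). f2 k \<noteq> 0}"
      "g = gmult G h (gmult G (ginv G h) g)"
      using g by (auto simp: range_fibre_def rng_inv_mult mult_inv_cancel)
    then show "g \<in> (\<Union>h\<in>{h \<in> range_fibre G x. f1 h \<noteq> 0}.
        gmult G h ` {k \<in> range_fibre G (src G h). f2 k \<noteq> 0})"
      using h by blast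
  qed
  then show "finite {g \<in> range_fibre G x. conv G f1 f2 g \<noteq> 0}"
    by (rule finite_subset) (use assms in \<open>simp add: fibre_finite_def\<close>)
qed

text \<open>The sum over \<open>g\<close> is taken first: translation by \<open>h\<close> turns it
  into part of a fibre sum of \<open>f2\<close>, bounded by \<open>D\<close> uniformly in
  \<open>h\<close>.\<close>

lemma fibre_l1_le_conv:
  assumes f: "fibre_finite f1" "fibre_finite f2" and le: "fibre_l1_le f1 C" "fibre_l1_le f2 D"
  shows "fibre_l1_le (conv G f1 f2) (C * D)"
  unfolding fibre_l1_le_def
proof
  fix x
  let ?R = "range_fibre G x"
  let ?S = "{h \<in> ?R. f1 h \<noteq> 0}"
  let ?T = "{g \<in> ?R. conv G f1 f2 g \<noteq> 0}"
  have fin: "finite ?S" "finite ?T" using f fibre_finite_conv[OF f] by (auto simp: fibre_finite_def)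
  have inner: "(\<Sum>g\<in>?T. cmod (f2 (gmult G (ginv G h) g))) \<le> D" if h: "h \<in> ?S" for h
  proof -
    let ?U = "{k \<in> range_fibre G (src G h). f2 k \<noteq> 0}"
    have hx: "rng G h = x" using h by (simp add: range_fibre_def)
    have "(\<Sum>g\<in>?T. cmod (f2 (gmult G (ginv G h) g))) =
        (\<Sum>k\<in>(\<lambda>g. gmult G (ginv G h) g) ` ?T. cmod (f2 k))"
    proof (subst sum.reindex)
      show "inj_on (\<lambda>g. gmult G (ginv G h) g) ?T"
        by (rule inj_on_inverseI[where g = "gmult G h"]) (simp add: range_fibre_def mult_inv_cancel hx)
    qed simp
    also have "\<dots> = (\<Sum>k\<in>(\<lambda>g. gmult G (ginv G h) g) ` ?T \<inter> ?U. cmod (f2 k))"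
      using fin(2) hx by (intro sum.mono_neutral_right) (auto simp: range_fibre_def rng_inv_mult)
    also have "\<dots> \<le> (\<Sum>k\<in>?U. cmod (f2 k))"
      using f by (intro sum_mono2) (auto simp: fibre_finite_def)
    also have "\<dots> \<le> D" by (rule fibre_l1_leD[OF f(2) le(2)])
    finally show ?thesis .
  qed
  have "(\<Sum>\<^sub>\<infinity>g\<in>?R. cmod (conv G f1 f2 g)) = (\<Sum>g\<in>?T. cmod (conv G f1 f2 g))"
    by (intro fibre_sum_finite fibre_finite_conv f) simp
  also have "\<dots> \<le> (\<Sum>g\<in>?T. \<Sum>h\<in>?S. cmod (f1 h) * cmod (f2 (gmult G (ginv G h) g)))"
  proof (rule sum_mono)
    fix g assume "g \<in> ?T"
    then have "conv G f1 f2 g = (\<Sum>\<^sub>\<infinity>h\<in>?R. f1 h * f2 (gmult G (ginv G h) g))"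
      by (auto simp: conv_eq range_fibre_def)
    also have "\<dots> = (\<Sum>h\<in>?S. f1 h * f2 (gmult G (ginv G h) g))"
      by (intro fibre_sum_finite f) simp
    finally show "cmod (conv G f1 f2 g) \<le> (\<Sum>h\<in>?S. cmod (f1 h) * cmod (f2 (gmult G (ginv G h) g)))"
      by (simp add: sum_norm_le norm_mult)
  qed
  also have "\<dots> = (\<Sum>h\<in>?S. cmod (f1 h) * (\<Sum>g\<in>?T. cmod (f2 (gmult G (ginv G h) g))))"
    by (subst sum.swap) (simp add: sum_distrib_left)
  also have "\<dots> \<le> (\<Sum>h\<in>?S. cmod (f1 h) * D)"
    using inner by (intro sum_mono mult_left_mono) auto
  also have "\<dots> \<le> C * D"
    unfolding sum_distrib_right[symmetric]
    by (intro mult_right_mono fibre_l1_leD f le fibre_l1_le_nonneg[OF le(2)])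
  finally show "(\<Sum>\<^sub>\<infinity>g\<in>?R. cmod (conv G f1 f2 g)) \<le> C * D" .
qed

end

lemma (in etale_t2) Cc_fibre_l1:
  assumes "f \<in> Cc" obtains C where "C > 0" "fibre_l1_le f C"
proof -
  obtain N :: nat where N: "\<And>x. finite (range_fibre G x \<inter> support f)"
    "\<And>x. card (range_fibre G x \<inter> support f) \<le> N"
    using compact_fibre_card[OF CcD(2)[OF assms]] by metis
  obtain C where C: "\<And>g. cmod (f g) \<le> C" "C > 0" using Cc_bounded[OF assms] by blast
  have "(\<Sum>\<^sub>\<infinity>g\<in>range_fibre G x. cmod (f g)) \<le> real N * C" for x
  proof -
    have "(\<Sum>\<^sub>\<infinity>g\<in>range_fibre G x. cmod (f g)) = (\<Sum>g\<in>range_fibre G x \<inter> support f. cmod (f g))"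
      using N CcD(3)[OF assms] by (intro infsum_eq_sum) auto
    also have "\<dots> \<le> real (card (range_fibre G x \<inter> support f)) * C"
      using C by (intro sum_bounded_above)
    also have "\<dots> \<le> real N * C" using N(2) C(2) by (intro mult_right_mono) auto
    finally show ?thesis .
  qed
  then have "fibre_l1_le f (real N * C + 1)"
    unfolding fibre_l1_le_def by (meson add_increasing2 order_trans zero_le_one order_refl)
  moreover have "real N * C + 1 > 0" using C(2) by (simp add: add_nonneg_pos)
  ultimately show ?thesis using that by blast
qed

section \<open>The functional given by an invariant measure\<close>

locale measured_etale = etale_t2 G for G :: "'g::t2_space groupoid_ops" +
  fixes M :: "'g measure"
  assumes invariant: "invariant_probability G M"
begin

sublocale prob_space M
  using invariant by (simp add: invariant_probability_def radon_probability_on_def)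

lemma sets_M: "sets M = sets (restrict_space borel (units G))"
  using invariant by (simp add: invariant_probability_def radon_probability_on_def)

lemma space_M: "space M = units G"
  using sets_eq_imp_space_eq[OF sets_M] by (simp add: space_restrict_space)

text \<open>Integration against the measure on \<open>G\<close> induced by \<open>M\<close> and the
  counting measures of the range fibres. Invariance of \<open>M\<close> means that inversion
  preserves it, see \<open>Lam_inv\<close>.\<close>

definition Lam :: "('g \<Rightarrow> complex) \<Rightarrow> complex" where
  "Lam f = (LINT x|M. Psi G f x)"

lemma integrable_Psi:
  assumes "f \<in> Cc" shows "integrable M (Psi G f)"
proof -
  have P: "Psi G f \<in> Cc" by (rule Cc_Psi[OF assms])
  have "Psi G f \<in> borel_measurable borel"
    using CcD(1)[OF P] by (rule borel_measurable_continuous_onI)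
  then have "Psi G f \<in> borel_measurable (restrict_space borel (units G))"
    by (rule measurable_restrict_space1)
  then have meas: "Psi G f \<in> borel_measurable M"
    by (simp add: measurable_cong_sets[OF sets_M refl])
  obtain C where "\<And>g. cmod (Psi G f g) \<le> C" using Cc_bounded[OF P] by blast
  then show ?thesis by (intro integrable_const_bound[of _ C] meas) auto
qed

lemma Psi_unit: "x \<in> units G \<Longrightarrow> Psi G f x = (\<Sum>\<^sub>\<infinity>g\<in>range_fibre G x. f g)"
  by (simp add: Psi_def)

lemma Lam_cong:
  assumes "\<And>x. x \<in> units G \<Longrightarrow> Psi G f1 x = Psi G f2 x" shows "Lam f1 = Lam f2"
  unfolding Lam_def using assms by (intro Bochner_Integration.integral_cong) (auto simp: space_M)

lemma Psi_add:
  assumes "f1 \<in> Cc" "f2 \<in> Cc"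
  shows "Psi G (\<lambda>g. f1 g + f2 g) x = Psi G f1 x + Psi G f2 x"
  using fibre_finite_summable[OF Cc_fibre_finite[OF assms(1)], of "\<lambda>_. 1"]
    fibre_finite_summable[OF Cc_fibre_finite[OF assms(2)], of "\<lambda>_. 1"]
  by (simp add: Psi_def infsum_add)

lemma Psi_scale: "Psi G (\<lambda>g. c * f g) x = c * Psi G f x"
  by (simp add: Psi_def infsum_cmult_right')

lemma Psi_diff:
  assumes "f1 \<in> Cc" "f2 \<in> Cc"
  shows "Psi G (\<lambda>g. f1 g - f2 g) x = Psi G f1 x - Psi G f2 x"
  using Psi_add[OF assms(1) Cc_scale[OF assms(2), of "-1"], of x] unfolding Psi_scale by simp

lemma Psi_cnj: "Psi G (\<lambda>g. cnj (f g)) x = cnj (Psi G f x)"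
  by (simp add: Psi_def infsum_cnj)

lemma Lam_add: "f1 \<in> Cc \<Longrightarrow> f2 \<in> Cc \<Longrightarrow> Lam (\<lambda>g. f1 g + f2 g) = Lam f1 + Lam f2"
  by (simp add: Lam_def Psi_add integrable_Psi)

lemma Lam_scale: "Lam (\<lambda>g. c * f g) = c * Lam f"
  by (simp add: Lam_def Psi_scale)

lemma Lam_diff: "f1 \<in> Cc \<Longrightarrow> f2 \<in> Cc \<Longrightarrow> Lam (\<lambda>g. f1 g - f2 g) = Lam f1 - Lam f2"
  by (simp add: Lam_def Psi_diff integrable_Psi)

lemma Lam_cnj: "Lam (\<lambda>g. cnj (f g)) = cnj (Lam f)"
  by (simp add: Lam_def Psi_cnj)

lemma Lam_inv:
  assumes "f \<in> Cc" shows "Lam (\<lambda>g. f (ginv G g)) = Lam f"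
proof -
  have "Lam (\<lambda>g. f (ginv G g)) = (LINT x|M. (\<Sum>\<^sub>\<infinity>g\<in>source_fibre G x. f g))"
    unfolding Lam_def
    by (intro Bochner_Integration.integral_cong) (auto simp: space_M Psi_unit infsum_source_fibre)
  also have "\<dots> = (LINT x|M. (\<Sum>\<^sub>\<infinity>g\<in>range_fibre G x. f g))"
    using invariant assms by (simp add: invariant_probability_def)
  also have "\<dots> = Lam f"
    unfolding Lam_def by (intro Bochner_Integration.integral_cong) (auto simp: space_M Psi_unit)
  finally show ?thesis .
qed

lemma Lam_norm_le:
  assumes "\<And>x. x \<in> units G \<Longrightarrow> cmod (Psi G f x) \<le> C" and "f \<in> Cc"
  shows "cmod (Lam f) \<le> C"
proof -
  have "cmod (Lam f) \<le> (LINT x|M. cmod (Psi G f x))"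
    unfolding Lam_def by (rule integral_norm_bound)
  also have "\<dots> \<le> (LINT x|M. C)"
    using assms integrable_Psi by (intro integral_mono integrable_norm) (auto simp: space_M)
  finally show ?thesis by (simp add: prob_space)
qed

lemma Lam_Re_ge:
  assumes "\<And>x. x \<in> units G \<Longrightarrow> C \<le> Re (Psi G f x)" and f: "f \<in> Cc"
  shows "C \<le> Re (Lam f)"
proof -
  have "(LINT x|M. C) \<le> (LINT x|M. Re (Psi G f x))"
    using assms integrable_Psi by (intro integral_mono integrable_Re) (auto simp: space_M)
  also have "\<dots> = Re (Lam f)" unfolding Lam_def by (rule integral_Re[OF integrable_Psi[OF f]])
  finally show ?thesis by (simp add: prob_space)
qed

end

section \<open>Constant and almost constant vectors of a representation\<close>

lemma (in hilbert_space) scale_zero: "x \<in> hcarrier H \<Longrightarrow> hscale H 0 x = hzero H"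
  using add_scale[of x 1 "-1"] add_neg[of x] by (simp add: scale_one)

context representation
begin

lemma rep_closed: "f \<in> Cc \<Longrightarrow> x \<in> hcarrier H \<Longrightarrow> \<pi> f x \<in> hcarrier H"
  using bounded by (auto simp: bounded_operator_def)

lemma rep_linear:
  assumes "f \<in> Cc" "x \<in> hcarrier H" "y \<in> hcarrier H"
  shows "\<pi> f (hadd H x y) = hadd H (\<pi> f x) (\<pi> f y)" "\<pi> f (hscale H c x) = hscale H c (\<pi> f x)"
  using bounded[OF assms(1)] assms(2,3) by (auto simp: bounded_operator_def)

text \<open>The constant vectors are cut out by equations between bounded operators, hence form a
  closed subspace to which the projection theorem applies.\<close>

lemma constant_projection:
  assumes Psi: "\<And>f. f \<in> Cc \<Longrightarrow> Psi G f \<in> Cc" and xi: "\<xi> \<in> hcarrier H"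
  obtains \<eta> where "\<eta> \<in> constant_vectors H G \<pi>" "hdiff H \<xi> \<eta> \<in> nonconstant_part H G \<pi>"
proof -
  let ?M = "constant_vectors H G \<pi>"
  have sub: "?M \<subseteq> hcarrier H" by (auto simp: constant_vectors_def)
  have zero: "\<pi> f (hzero H) = hzero H" if "f \<in> Cc" for f
    using rep_linear(2)[OF that zero_closed zero_closed, of 0] rep_closed[OF that zero_closed]
    by (simp add: scale_zero zero_closed)
  have closed: "x \<in> ?M"
    if X: "\<And>n. X n \<in> ?M" and x: "x \<in> hcarrier H" and lim: "(\<lambda>n::nat. hdist (X n) x) \<longlonglongrightarrow> 0" for X x
    unfolding constant_vectors_def
  proof (intro CollectI conjI ballI x)
    fix f :: "'g \<Rightarrow> complex" assume f: "f \<in> Cc"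
    have XH: "X n \<in> hcarrier H" for n using X sub by blast
    obtain C1 where C1: "\<And>x y. x \<in> hcarrier H \<Longrightarrow> y \<in> hcarrier H \<Longrightarrow> hdist (\<pi> f x) (\<pi> f y) \<le> C1 * hdist x y"
      by (rule dist_bounded[OF bounded[OF f]]) blast
    obtain C2 where C2: "\<And>x y. x \<in> hcarrier H \<Longrightarrow> y \<in> hcarrier H \<Longrightarrow>
        hdist (\<pi> (Psi G f) x) (\<pi> (Psi G f) y) \<le> C2 * hdist x y"
      by (rule dist_bounded[OF bounded[OF Psi[OF f]]]) blast
    have le: "hdist (\<pi> f x) (\<pi> (Psi G f) x) \<le> C1 * hdist (X n) x + C2 * hdist (X n) x" for n
    proof -
      have "\<pi> f (X n) = \<pi> (Psi G f) (X n)" using X[of n] f by (simp add: constant_vectors_def)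
      then have "hdist (\<pi> f x) (\<pi> (Psi G f) x) \<le>
          hdist (\<pi> f x) (\<pi> f (X n)) + hdist (\<pi> (Psi G f) (X n)) (\<pi> (Psi G f) x)"
        using dist_triangle[of "\<pi> f x" "\<pi> f (X n)" "\<pi> (Psi G f) x"] rep_closed f Psi x XH by simp
      moreover have "hdist x (X n) = hdist (X n) x" by (rule dist_commute[OF x XH])
      ultimately show ?thesis using C1[OF x XH, of n] C2[OF XH x, of n] by simp
    qed
    have "(\<lambda>n. C1 * hdist (X n) x + C2 * hdist (X n) x) \<longlonglongrightarrow> C1 * 0 + C2 * 0"
      by (intro tendsto_intros lim)
    then have "hdist (\<pi> f x) (\<pi> (Psi G f) x) \<le> 0"
      using le by (intro LIMSEQ_le_const[where X = "\<lambda>n. C1 * hdist (X n) x + C2 * hdist (X n) x"]) auto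
    then show "\<pi> f x = \<pi> (Psi G f) x"
      using norm_nonneg[OF diff_closed] rep_closed f Psi x
      by (intro dist_zeroD) (auto intro: antisym)
  qed
  have "\<exists>\<eta>\<in>?M. \<forall>z\<in>?M. hinner H (hdiff H \<xi> \<eta>) z = 0"
  proof (rule orthogonal_projection[OF sub _ _ _ closed xi])
    show "hzero H \<in> ?M" using zero Psi zero_closed by (auto simp: constant_vectors_def)
    show "hadd H x y \<in> ?M" if "x \<in> ?M" "y \<in> ?M" for x y
      using that Psi by (auto simp: constant_vectors_def rep_linear add_closed)
    show "hscale H c x \<in> ?M" if "x \<in> ?M" for c x
      using that Psi by (auto simp: constant_vectors_def rep_linear scale_closed)
  qed auto
  then obtain \<eta> where "\<eta> \<in> ?M" "\<forall>z\<in>?M. hinner H (hdiff H \<xi> \<eta>) z = 0" by blast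
  then show ?thesis using that sub xi by (auto simp: nonconstant_part_def diff_closed)
qed

text \<open>With \<open>\<eta>\<close> the projection of \<open>\<xi>\<close> to the constant
  vectors, \<open>\<zeta> = \<xi> - \<eta>\<close> has the same displacement as \<open>\<xi>\<close>
  under every \<open>f\<close>. The one function supplied by the Kazhdan pair bounds
  \<open>\<zeta>\<close>; the last conclusion holds for all \<open>f\<close> in \<open>Cc\<close>,
  which carries the estimate beyond \<open>K\<close>.\<close>

lemma kazhdan_approx:
  assumes Psi: "\<And>f. f \<in> Cc \<Longrightarrow> Psi G f \<in> Cc" and xi: "\<xi> \<in> hcarrier H"
    and kp: "kazhdan_pair TYPE('h) G K c"
    and small: "\<And>f. \<lbrakk>f \<in> Cc; support f \<subseteq> K; I_norm G f \<le> 1\<rbrakk> \<Longrightarrow>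
      hnorm H (hdiff H (\<pi> f \<xi>) (\<pi> (Psi G f) \<xi>)) \<le> \<delta>"
  obtains \<zeta> where "\<zeta> \<in> hcarrier H" "c * hnorm H \<zeta> \<le> \<delta>"
    "\<And>f. f \<in> Cc \<Longrightarrow> hdiff H (\<pi> f \<zeta>) (\<pi> (Psi G f) \<zeta>) = hdiff H (\<pi> f \<xi>) (\<pi> (Psi G f) \<xi>)"
proof -
  obtain \<eta> where eta: "\<eta> \<in> constant_vectors H G \<pi>" and zeta: "hdiff H \<xi> \<eta> \<in> nonconstant_part H G \<pi>"
    using constant_projection[OF Psi xi] by blast
  have etaH: "\<eta> \<in> hcarrier H" using eta by (simp add: constant_vectors_def)
  have eq: "hdiff H (\<pi> f (hdiff H \<xi> \<eta>)) (\<pi> (Psi G f) (hdiff H \<xi> \<eta>)) = hdiff H (\<pi> f \<xi>) (\<pi> (Psi G f) \<xi>)"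
    if f: "f \<in> Cc" for f
  proof (rule dist_zeroD)
    have lin: "\<pi> h (hdiff H \<xi> \<eta>) = hdiff H (\<pi> h \<xi>) (\<pi> h \<eta>)" if "h \<in> Cc" for h
      using rep_linear[OF that] xi etaH by (simp add: hdiff_def scale_closed)
    have c: "\<pi> f \<eta> = \<pi> (Psi G f) \<eta>" using eta f by (simp add: constant_vectors_def)
    show "hdist (hdiff H (\<pi> f (hdiff H \<xi> \<eta>)) (\<pi> (Psi G f) (hdiff H \<xi> \<eta>)))
        (hdiff H (\<pi> f \<xi>) (\<pi> (Psi G f) \<xi>)) = 0"
      using xi etaH f Psi[OF f] rep_closed unfolding lin[OF f] lin[OF Psi[OF f]] c
      by (simp add: hnorm_def hdiff_def inner_simps algebra_simps)
  qed (auto intro!: diff_closed rep_closed Psi xi etaH f)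
  obtain f where "f \<in> Cc" "support f \<subseteq> K" "I_norm G f \<le> 1"
    "c * hnorm H (hdiff H \<xi> \<eta>) \<le> hnorm H (hdiff H (\<pi> f (hdiff H \<xi> \<eta>)) (\<pi> (Psi G f) (hdiff H \<xi> \<eta>)))"
    using kp zeta representation_axioms unfolding kazhdan_pair_def by blast
  then have "c * hnorm H (hdiff H \<xi> \<eta>) \<le> \<delta>" using small[of f] eq[of f] by simp
  then show ?thesis using that[of "hdiff H \<xi> \<eta>"] eq xi etaH diff_closed by blast
qed

end

section \<open>The GNS representation of a function of positive type\<close>

locale positive_type_function = measured_etale G M for G :: "'g::t2_space groupoid_ops" and M +
  fixes \<phi> :: "'g \<Rightarrow> real"
  assumes phi_continuous: "continuous_on UNIV \<phi>"
    and phi_unit: "x \<in> units G \<Longrightarrow> \<phi> x = 1"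
    and phi_inv: "\<phi> (ginv G g) = \<phi> g"
    and phi_bounds: "0 \<le> \<phi> g" "\<phi> g \<le> 1"
    and phi_psd: "finite A \<Longrightarrow> A \<subseteq> range_fibre G x \<Longrightarrow> psd_kernel A (\<lambda>g h. \<phi> (gmult G (ginv G g) h))"
begin

abbreviation "\<phi>c \<equiv> \<lambda>g. complex_of_real (\<phi> g)"

lemma phi_cont: "continuous_on UNIV \<phi>c"
  by (intro continuous_intros phi_continuous)

definition state :: "('g \<Rightarrow> complex) \<Rightarrow> complex" where
  "state f = Lam (\<lambda>g. f g * \<phi>c g)"

lemma state_add: "f1 \<in> Cc \<Longrightarrow> f2 \<in> Cc \<Longrightarrow> state (\<lambda>g. f1 g + f2 g) = state f1 + state f2"
  unfolding state_def distrib_right by (intro Lam_add Cc_mult phi_cont)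

lemma state_scale: "state (\<lambda>g. c * f g) = c * state f"
  unfolding state_def mult.assoc by (rule Lam_scale)

lemma state_star:
  assumes "f \<in> Cc" shows "state (star G f) = cnj (state f)"
proof -
  have "state (star G f) = Lam (\<lambda>g. (\<lambda>g. cnj (f g * \<phi>c g)) (ginv G g))"
    by (simp add: state_def star_def phi_inv)
  also have "\<dots> = Lam (\<lambda>g. cnj (f g * \<phi>c g))"
    by (intro Lam_inv Cc_cnj Cc_mult assms phi_cont)
  finally show ?thesis by (simp only: state_def Lam_cnj)
qed

text \<open>The integrand of the inner product of \<open>v\<close> with \<open>u\<close>. Summed
  over a range fibre it becomes the form whose kernel is the one in \<open>phi_psd\<close>, see
  \<open>Psi_gns_density\<close>.\<close>

definition gns_density :: "('g \<Rightarrow> complex) \<Rightarrow> ('g \<Rightarrow> complex) \<Rightarrow> 'g \<Rightarrow> complex" where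
  "gns_density u v b = cnj (u b) * conv G v \<phi>c b"

lemma gns_density_Cc: "u \<in> Cc \<Longrightarrow> v \<in> Cc \<Longrightarrow> gns_density u v \<in> Cc"
  unfolding gns_density_def[abs_def] by (intro Cc_mult Cc_cnj continuous_conv phi_cont)

text \<open>Expanding the convolution evaluates \<open>u\<close> at the inverses of the elements of
  a range fibre, that is, along a source fibre. Invariance of the measure moves the sum back to
  range fibres, where \<open>phi_psd\<close> applies.\<close>

lemma state_conv_star:
  assumes u: "u \<in> Cc" and v: "v \<in> Cc"
  shows "state (conv G (star G u) v) = Lam (gns_density u v)"
proof -
  have "state (conv G (star G u) v) = Lam (\<lambda>g. gns_density u v (ginv G g))"
    unfolding state_def
  proof (rule Lam_cong)
    fix x assume x: "x \<in> units G"
    let ?R = "range_fibre G x"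
    have "Psi G (\<lambda>g. conv G (star G u) v g * \<phi>c g) x =
        (\<Sum>\<^sub>\<infinity>m\<in>?R. (\<Sum>\<^sub>\<infinity>h\<in>?R. star G u h * v (gmult G (ginv G h) m)) * \<phi>c m)"
      unfolding Psi_unit[OF x] by (intro infsum_cong) (simp add: conv_eq range_fibre_def)
    also have "\<dots> = (\<Sum>\<^sub>\<infinity>h\<in>?R. star G u h * (\<Sum>\<^sub>\<infinity>k\<in>range_fibre G (src G h). v k * \<phi>c (gmult G h k)))"
      using Cc_fibre_finite[OF v] Cc_fibre_finite[OF star_Cc[OF u]]
      by (intro infsum_fibre_translate[symmetric]) (auto simp: fibre_finite_def)
    also have "\<dots> = (\<Sum>\<^sub>\<infinity>h\<in>?R. gns_density u v (ginv G h))"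
    proof (intro infsum_cong)
      fix h
      have "conv G v \<phi>c (ginv G h) = (\<Sum>\<^sub>\<infinity>k\<in>range_fibre G (src G h). v k * \<phi>c (gmult G h k))"
        unfolding conv_eq rng_inv
      proof (intro infsum_cong)
        fix k assume "k \<in> range_fibre G (src G h)"
        then have "gmult G (ginv G k) (ginv G h) = ginv G (gmult G h k)"
          by (simp add: range_fibre_def inv_mult)
        then show "v k * \<phi>c (gmult G (ginv G k) (ginv G h)) = v k * \<phi>c (gmult G h k)"
          by (simp add: phi_inv)
      qed
      then show "star G u h * (\<Sum>\<^sub>\<infinity>k\<in>range_fibre G (src G h). v k * \<phi>c (gmult G h k)) =
          gns_density u v (ginv G h)"
        by (simp add: gns_density_def star_def)
    qed
    finally show "Psi G (\<lambda>g. conv G (star G u) v g * \<phi>c g) x = Psi G (\<lambda>g. gns_density u v (ginv G g)) x"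
      by (simp add: Psi_unit[OF x])
  qed
  then show ?thesis by (simp only: Lam_inv[OF gns_density_Cc[OF u v]])
qed

lemma Psi_gns_density:
  assumes "u \<in> Cc" "v \<in> Cc" "x \<in> units G"
  shows "Psi G (gns_density u v) x = (\<Sum>b\<in>{g \<in> range_fibre G x. u g \<noteq> 0}. \<Sum>k\<in>{g \<in> range_fibre G x. v g \<noteq> 0}.
    cnj (u b) * v k * \<phi>c (gmult G (ginv G b) k))"
proof -
  have "Psi G (gns_density u v) x = (\<Sum>b\<in>{g \<in> range_fibre G x. u g \<noteq> 0}. gns_density u v b)"
    unfolding Psi_unit[OF assms(3)]
    by (intro fibre_sum_finite Cc_fibre_finite assms) (simp add: gns_density_def)
  also have "\<dots> = (\<Sum>b\<in>{g \<in> range_fibre G x. u g \<noteq> 0}. \<Sum>k\<in>{g \<in> range_fibre G x. v g \<noteq> 0}.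
    cnj (u b) * v k * \<phi>c (gmult G (ginv G b) k))"
  proof (intro sum.cong refl)
    fix b assume "b \<in> {g \<in> range_fibre G x. u g \<noteq> 0}"
    then have b: "rng G b = x" by (simp add: range_fibre_def)
    have "conv G v \<phi>c b = (\<Sum>k\<in>{g \<in> range_fibre G x. v g \<noteq> 0}. v k * \<phi>c (gmult G (ginv G k) b))"
      unfolding conv_eq b by (intro fibre_sum_finite Cc_fibre_finite assms) simp
    also have "\<dots> = (\<Sum>k\<in>{g \<in> range_fibre G x. v g \<noteq> 0}. v k * \<phi>c (gmult G (ginv G b) k))"
    proof (intro sum.cong refl)
      fix k assume "k \<in> {g \<in> range_fibre G x. v g \<noteq> 0}"
      then show "v k * \<phi>c (gmult G (ginv G k) b) = v k * \<phi>c (gmult G (ginv G b) k)"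
        using phi_inv[of "gmult G (ginv G b) k"] b by (simp add: range_fibre_def inv_mult_inv)
    qed
    finally show "gns_density u v b = (\<Sum>k\<in>{g \<in> range_fibre G x. v g \<noteq> 0}.
        cnj (u b) * v k * \<phi>c (gmult G (ginv G b) k))"
      by (simp add: gns_density_def sum_distrib_left mult.assoc)
  qed
  finally show ?thesis .
qed

lemma state_nonneg:
  assumes u: "u \<in> Cc" shows "0 \<le> Re (state (conv G (star G u) u))"
  unfolding state_conv_star[OF u u]
proof (rule Lam_Re_ge)
  fix x assume x: "x \<in> units G"
  have "finite {g \<in> range_fibre G x. u g \<noteq> 0}"
    using Cc_fibre_finite[OF u] by (simp add: fibre_finite_def)
  then show "0 \<le> Re (Psi G (gns_density u u) x)"
    unfolding Psi_gns_density[OF u u x] by (intro psd_kernel_complex phi_psd) auto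
qed (intro gns_density_Cc u)

text \<open>Replacing \<open>\<phi>\<close> by \<open>\<phi> - s\<close> leaves the double sum
  unchanged when \<open>s = 0\<close> or when the fibre sums of \<open>u\<close> vanish. With
  \<open>s = 0\<close> this bounds the GNS norm by fibre sums; with \<open>s = 1\<close> it shows
  that vectors with zero fibre sums are short when \<open>\<phi>\<close> is close to
  \<open>1\<close> on the quotients of their support.\<close>

lemma state_norm_le:
  assumes u: "u \<in> Cc" and C: "fibre_l1_le u C" and e: "0 \<le> e"
    and small: "\<And>x b k. \<lbrakk>rng G b = x; rng G k = x; u b \<noteq> 0; u k \<noteq> 0\<rbrakk> \<Longrightarrow>
      \<bar>\<phi> (gmult G (ginv G b) k) - s\<bar> \<le> e"
    and s: "s = 0 \<or> (\<forall>x\<in>units G. Psi G u x = 0)"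
  shows "cmod (state (conv G (star G u) u)) \<le> e * C\<^sup>2"
  unfolding state_conv_star[OF u u]
proof (rule Lam_norm_le)
  fix x assume x: "x \<in> units G"
  let ?S = "{g \<in> range_fibre G x. u g \<noteq> 0}"
  let ?p = "\<lambda>b k. \<phi>c (gmult G (ginv G b) k)"
  note fu = Cc_fibre_finite[OF u]
  have "of_real s * (\<Sum>k\<in>?S. u k) = 0"
    using s x fibre_sum_finite[OF fu, of u x] by (auto simp: Psi_unit)
  moreover have "(\<Sum>b\<in>?S. \<Sum>k\<in>?S. cnj (u b) * u k * of_real s) =
      (\<Sum>b\<in>?S. cnj (u b) * (of_real s * (\<Sum>k\<in>?S. u k)))"
    by (simp add: sum_distrib_left ac_simps)
  ultimately have z: "(\<Sum>b\<in>?S. \<Sum>k\<in>?S. cnj (u b) * u k * of_real s) = 0"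
    by (simp only: mult_zero_right sum.neutral_const)
  have "Psi G (gns_density u u) x = (\<Sum>b\<in>?S. \<Sum>k\<in>?S. cnj (u b) * u k * (?p b k - of_real s))"
    unfolding Psi_gns_density[OF u u x] right_diff_distrib sum_subtractf z by simp
  also have "cmod \<dots> \<le> (\<Sum>b\<in>?S. \<Sum>k\<in>?S. cmod (u b) * cmod (u k) * e)"
  proof (intro sum_norm_le)
    fix b k assume bk: "b \<in> ?S" "k \<in> ?S"
    have "cmod (?p b k - of_real s) \<le> e"
      using small[of b x k] bk by (simp add: range_fibre_def flip: of_real_diff)
    then show "cmod (cnj (u b) * u k * (?p b k - of_real s)) \<le> cmod (u b) * cmod (u k) * e"
      by (simp add: norm_mult mult_left_mono)
  qed
  also have "\<dots> = e * (\<Sum>b\<in>?S. cmod (u b))\<^sup>2"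
    by (simp add: power2_eq_square sum_product sum_distrib_left ac_simps)
  also have "\<dots> \<le> e * C\<^sup>2"
    using fibre_l1_leD[OF fu C, of x] e by (intro mult_left_mono power_mono) (auto intro: sum_nonneg)
  finally show "cmod (Psi G (gns_density u u) x) \<le> e * C\<^sup>2" .
qed (intro gns_density_Cc u)

definition ip :: "('g \<Rightarrow> complex) \<Rightarrow> ('g \<Rightarrow> complex) \<Rightarrow> complex" where
  "ip u v = state (conv G (star G v) u)"

sublocale pre_hilbert Cc ip
proof
  show "(\<lambda>_. 0) \<in> (Cc :: ('g \<Rightarrow> complex) set)" by (rule CcI[of _ "{}"]) auto
  fix u v w :: "'g \<Rightarrow> complex" and c
  assume u: "u \<in> Cc"
  show "(\<lambda>a. c * u a) \<in> Cc" by (rule Cc_scale[OF u])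
  show "0 \<le> Re (ip u u)" unfolding ip_def by (rule state_nonneg[OF u])
  {
    assume v: "v \<in> Cc"
    show "(\<lambda>a. u a + v a) \<in> Cc" by (rule Cc_add[OF u v])
    show "ip v u = cnj (ip u v)"
      unfolding ip_def state_star[OF Cc_conv[OF star_Cc[OF v] u], symmetric] star_conv star_star ..
    assume w: "w \<in> Cc"
    show "ip (\<lambda>a. u a + v a) w = ip u w + ip v w"
      unfolding ip_def conv_add_right[OF Cc_fibre_finite[OF star_Cc[OF w]]]
      by (intro state_add Cc_conv star_Cc u v w)
  }
  show "ip (\<lambda>a. c * u a) w = c * ip u w"
    unfolding ip_def conv_scale_right by (rule state_scale)
qed

lemma nrm_le:
  assumes u: "u \<in> Cc" and C: "fibre_l1_le u C" shows "nrm u \<le> C"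
proof -
  have "cmod (ip u u) \<le> 1 * C\<^sup>2"
    unfolding ip_def using phi_bounds by (intro state_norm_le[where s = 0] u C) (auto simp: abs_le_iff intro: order_trans)
  then have "(nrm u)\<^sup>2 \<le> C\<^sup>2" using B_self[OF u] by (simp add: norm_power)
  then show ?thesis by (rule power2_le_imp_le) (rule fibre_l1_le_nonneg[OF C])
qed

lemma ip_adjoint:
  assumes "f \<in> Cc" "u \<in> Cc" "w \<in> Cc"
  shows "ip (conv G f u) w = ip u (conv G (star G f) w)"
  unfolding ip_def star_conv star_star
  using assms by (simp add: conv_assoc Cc_fibre_finite star_Cc)

text \<open>\<open>T\<close> is symmetric, and on a fixed \<open>u\<close> the fibre sums of its
  iterates, which dominate \<open>nrm\<close>, grow at most like \<open>(C2 * C1) ^ n\<close> times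
  a constant depending on \<open>u\<close>. \<open>selfadjoint_bounded\<close> removes that
  constant.\<close>

lemma conv_bounded:
  assumes f: "f \<in> Cc"
  obtains C where "C > 0" "\<And>u. u \<in> Cc \<Longrightarrow> nrm (conv G f u) \<le> C * nrm u"
proof -
  obtain C1 C2 where C: "C1 > 0" "fibre_l1_le f C1" "C2 > 0" "fibre_l1_le (star G f) C2"
    using Cc_fibre_l1[OF f] Cc_fibre_l1[OF star_Cc[OF f]] by metis
  define T where "T u = conv G (star G f) (conv G f u)" for u
  have TC: "T u \<in> Cc" if "u \<in> Cc" for u unfolding T_def by (intro Cc_conv star_Cc f that)
  have adj: "ip (T u) w = ip u (T w)" "ip (conv G f u) (conv G f w) = ip u (T w)"
    if "u \<in> Cc" "w \<in> Cc" for u w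
    using that f ip_adjoint[of "star G f" "conv G f u" w] ip_adjoint[of f u "conv G f w"]
    by (simp_all add: T_def star_Cc Cc_conv)
  have bound: "nrm (T u) \<le> C2 * C1 * nrm u" if u: "u \<in> Cc" for u
  proof -
    obtain D where D: "D > 0" "fibre_l1_le u D" using Cc_fibre_l1[OF u] by metis
    have pow: "(T ^^ n) u \<in> Cc \<and> fibre_l1_le ((T ^^ n) u) (D * (C2 * C1) ^ n)" for n
    proof (induction n)
      case 0
      then show ?case using u D by simp
    next
      case (Suc n)
      then have "fibre_l1_le (T ((T ^^ n) u)) (C2 * (C1 * (D * (C2 * C1) ^ n)))"
        unfolding T_def using C f
        by (intro fibre_l1_le_conv fibre_finite_conv Cc_fibre_finite star_Cc) auto
      then show ?case using Suc TC by (simp add: ac_simps)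
    qed
    show ?thesis
      using C pow nrm_le by (intro selfadjoint_bounded[of T u D] TC adj u) auto
  qed
  have "nrm (conv G f u) \<le> sqrt (C2 * C1) * nrm u" if u: "u \<in> Cc" for u
  proof -
    have "(nrm (conv G f u))\<^sup>2 = cmod (ip u (T u))"
      using B_self[OF Cc_conv[OF f u]] adj(2)[OF u u] by (simp add: norm_power)
    also have "\<dots> \<le> nrm u * nrm (T u)" by (rule cauchy_schwarz[OF u TC[OF u]])
    also have "\<dots> \<le> nrm u * (C2 * C1 * nrm u)"
      using bound[OF u] nrm_nonneg[OF u] by (rule mult_left_mono)
    also have "\<dots> = (sqrt (C2 * C1) * nrm u)\<^sup>2"
      using C by (simp add: power_mult_distrib power2_eq_square)
    finally show ?thesis
      by (rule power2_le_imp_le) (use C nrm_nonneg[OF u] in simp)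
  qed
  then show ?thesis using that[of "sqrt (C2 * C1)"] C by auto
qed

definition gns_rep :: "('g \<Rightarrow> complex) \<Rightarrow> (('g \<Rightarrow> complex) \<Rightarrow> complex) \<Rightarrow> ('g \<Rightarrow> complex) \<Rightarrow> complex" where
  "gns_rep f = lift_adjoint (conv G (star G f))"

lemma represents_gns_rep:
  assumes f: "f \<in> Cc" and l: "represents l v"
  shows "represents (gns_rep f l) (\<lambda>n. conv G f (v n))"
proof -
  obtain C where "\<And>u. u \<in> Cc \<Longrightarrow> nrm (conv G f u) \<le> C * nrm u" using conv_bounded[OF f] by blast
  then show ?thesis
    unfolding gns_rep_def
    by (intro represents_lift[OF l] Cc_conv star_Cc f conv_diff_right Cc_fibre_finite ip_adjoint)
qed

lemma star_add: "star G (\<lambda>g. f1 g + f2 g) = (\<lambda>g. star G f1 g + star G f2 g)"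
  by (simp add: star_def[abs_def])

lemma star_scale: "star G (\<lambda>g. c * f g) = (\<lambda>g. cnj c * star G f g)"
  by (simp add: star_def[abs_def])

lemma representation_gns: "representation completion G gns_rep"
proof -
  interpret hilbert_space completion by (rule hilbert_space_completion)
  show ?thesis
  proof
    fix f :: "'g \<Rightarrow> complex" assume f: "f \<in> Cc"
    obtain C where C: "C > 0" "\<And>u. u \<in> Cc \<Longrightarrow> nrm (conv G f u) \<le> C * nrm u"
      using conv_bounded[OF f] by blast
    have "hnorm completion (gns_rep f l) \<le> C * hnorm completion l" if l: "represents l v" for l v
    proof (rule LIMSEQ_le)
      show "(\<lambda>n. nrm (conv G f (v n))) \<longlonglongrightarrow> hnorm completion (gns_rep f l)"
        by (rule represents_norm[OF represents_gns_rep[OF f l]])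
      show "(\<lambda>n. C * nrm (v n)) \<longlonglongrightarrow> C * hnorm completion l"
        by (intro tendsto_mult_left represents_norm l)
    qed (use C represents_V[OF l] in blast)
    then show "bounded_operator completion (gns_rep f)"
      unfolding bounded_operator_def
    proof (intro conjI ballI allI exI[of _ C])
      fix x assume "x \<in> hcarrier completion"
      then show "gns_rep f x \<in> hcarrier completion" using represents_gns_rep[OF f] by auto
    qed (auto simp: gns_rep_def lift_adjoint_def fun_eq_iff)
    fix x c assume "x \<in> hcarrier completion"
    then obtain u where x: "represents x u" by auto
    \<comment> \<open>The scalar is conjugated by \<open>star\<close> and once more by the
      functional \<open>x\<close>.\<close>
    show "gns_rep (\<lambda>g. c * f g) x = hscale completion c (gns_rep f x)"
      by (auto simp: gns_rep_def lift_adjoint_def fun_eq_iff star_scale conv_scale_left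
          represents_scale_arg[OF x] Cc_conv star_Cc f)
    fix y assume "y \<in> hcarrier completion"
    then obtain v where y: "represents y v" by auto
    show "hinner completion (gns_rep (star G f) x) y = hinner completion x (gns_rep f y)"
    proof (rule LIMSEQ_unique)
      show "(\<lambda>n. ip (conv G (star G f) (u n)) (v n)) \<longlonglongrightarrow> hinner completion (gns_rep (star G f) x) y"
        by (intro represents_inner represents_gns_rep star_Cc f x y)
      have "ip (conv G (star G f) (u n)) (v n) = ip (u n) (conv G f (v n))" for n
        using ip_adjoint[OF star_Cc[OF f] represents_V[OF x] represents_V[OF y]] by simp
      then show "(\<lambda>n. ip (conv G (star G f) (u n)) (v n)) \<longlonglongrightarrow> hinner completion x (gns_rep f y)"
        using represents_inner[OF x represents_gns_rep[OF f y]] by simp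
    qed
  next
    fix f1 f2 :: "'g \<Rightarrow> complex" and x assume f: "f1 \<in> Cc" "f2 \<in> Cc" and "x \<in> hcarrier completion"
    then obtain u where x: "represents x u" by auto
    show "gns_rep (\<lambda>g. f1 g + f2 g) x = hadd completion (gns_rep f1 x) (gns_rep f2 x)"
      by (auto simp: gns_rep_def lift_adjoint_def fun_eq_iff star_add conv_add_left Cc_fibre_finite
          represents_add_arg[OF x] Cc_conv star_Cc f)
    \<comment> \<open>\<open>star\<close> reverses products, and precomposition reverses them
      again.\<close>
    show "gns_rep (conv G f1 f2) x = gns_rep f1 (gns_rep f2 x)"
      by (auto simp: gns_rep_def lift_adjoint_def fun_eq_iff star_conv conv_assoc Cc_fibre_finite
          Cc_conv star_Cc f)
  next
    fix x assume "x \<in> hcarrier completion"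
    then show "gns_rep (unit_fun G) x = x"
      by (auto simp: gns_rep_def lift_adjoint_def fun_eq_iff star_unit_fun unit_fun_conv represents_def)
  qed
qed

lemma gns_rep_cyclic: "f \<in> Cc \<Longrightarrow> gns_rep f (embed (unit_fun G)) = embed f"
  unfolding gns_rep_def
  using ip_adjoint[OF _ Cc_unit_fun, of f]
  by (intro lift_embed Cc_unit_fun Cc_conv star_Cc) (simp_all add: conv_unit_fun)

end

section \<open>Spread out functions and the theorem\<close>

lemma infsum_complex_of_real:
  assumes "r summable_on A"
  shows "(\<Sum>\<^sub>\<infinity>x\<in>A. complex_of_real (r x)) = of_real (\<Sum>\<^sub>\<infinity>x\<in>A. r x)"
  by (intro infsumI has_sum_of_real_iff[THEN iffD2] has_sum_infsum assms)

context groupoid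
begin

lemma fibre_finite_real_summable:
  assumes "fibre_finite f" "\<And>g. f g = 0 \<Longrightarrow> r g = 0" shows "r summable_on range_fibre G x"
  using assms
  by (intro finite_nonzero_values_imp_summable_on) (auto simp: fibre_finite_def elim!: finite_subset[rotated])

lemma range_fibre_empty: "x \<notin> units G \<Longrightarrow> range_fibre G x = {}"
  by (auto simp: range_fibre_def)

lemma fibre_l1_leI:
  assumes "\<And>x. x \<in> units G \<Longrightarrow> (\<Sum>\<^sub>\<infinity>g\<in>range_fibre G x. cmod (f g)) \<le> C" and "0 \<le> C"
  shows "fibre_l1_le f C"
  unfolding fibre_l1_le_def using assms range_fibre_empty by (metis infsum_empty)

lemma fibre_l1_le_diff:
  assumes f: "fibre_finite f1" "fibre_finite f2" and le: "fibre_l1_le f1 C" "fibre_l1_le f2 D"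
  shows "fibre_l1_le (\<lambda>g. f1 g - f2 g) (C + D)"
proof (rule fibre_l1_leI)
  fix x
  have s: "(\<lambda>g. cmod (f1 g)) summable_on range_fibre G x" "(\<lambda>g. cmod (f2 g)) summable_on range_fibre G x"
    using fibre_finite_real_summable f by (metis norm_zero)+
  have "(\<Sum>\<^sub>\<infinity>g\<in>range_fibre G x. cmod (f1 g - f2 g)) \<le>
      (\<Sum>\<^sub>\<infinity>g\<in>range_fibre G x. cmod (f1 g) + cmod (f2 g))"
  proof (rule infsum_mono)
    show "(\<lambda>g. cmod (f1 g - f2 g)) summable_on range_fibre G x"
      by (rule summable_on_comparison_test[OF summable_on_add[OF s]]) (auto simp: norm_triangle_ineq4)
  qed (auto simp: norm_triangle_ineq4 summable_on_add s)
  also have "\<dots> = (\<Sum>\<^sub>\<infinity>g\<in>range_fibre G x. cmod (f1 g)) + (\<Sum>\<^sub>\<infinity>g\<in>range_fibre G x. cmod (f2 g))"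
    by (rule infsum_add[OF s])
  also have "\<dots> \<le> C + D" using le by (auto simp: fibre_l1_le_def intro: add_mono)
  finally show "(\<Sum>\<^sub>\<infinity>g\<in>range_fibre G x. cmod (f1 g - f2 g)) \<le> C + D" .
qed (use fibre_l1_le_nonneg le in \<open>auto intro: add_nonneg_nonneg\<close>)

end

context measured_etale
begin

lemma Psi_norm_le: "f \<in> Cc \<Longrightarrow> fibre_l1_le f C \<Longrightarrow> x \<in> units G \<Longrightarrow> cmod (Psi G f x) \<le> C"
  unfolding Psi_unit fibre_l1_le_def
  by (rule order_trans[OF norm_infsum_bound])
    (auto intro: fibre_finite_real_summable[OF Cc_fibre_finite])

text \<open>A function on the units contributes one term to each fibre sum, and inversion fixes the
  units, so range and source sums agree.\<close>

lemma fibre_l1_le_Psi: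
  assumes "f \<in> Cc" "fibre_l1_le f C"
  shows "fibre_l1_le (Psi G f) C" "fibre_l1_le (star G (Psi G f)) C"
proof -
  have z: "Psi G f g = 0" if "g \<notin> units G" for g using that by (simp add: Psi_def)
  show "fibre_l1_le (Psi G f) C"
    using Psi_norm_le[OF assms] fibre_l1_le_nonneg[OF assms(2)] z
    by (intro fibre_l1_leI) (simp_all add: infsum_supported_on_units)
  show "fibre_l1_le (star G (Psi G f)) C"
    using Psi_norm_le[OF assms] fibre_l1_le_nonneg[OF assms(2)] z
    by (intro fibre_l1_leI) (simp_all add: infsum_supported_on_units star_def inv_unit_iff unit_simps)
qed

lemma Psi_supported_on_units:
  assumes "\<And>g. g \<notin> units G \<Longrightarrow> f g = 0" shows "Psi G f = f"
proof
  fix x show "Psi G f x = f x"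
    using assms infsum_supported_on_units[of f x] by (cases "x \<in> units G") (auto simp: Psi_def)
qed

lemma I_norm_fibre_l1:
  assumes f: "f \<in> Cc" and I: "I_norm G f \<le> 1" shows "fibre_l1_le f 1"
proof (rule fibre_l1_leI)
  fix x assume x: "x \<in> units G"
  \<comment> \<open>The supremum in \<open>I_norm\<close> bounds its members only if they are
    bounded above, which is secured first.\<close>
  obtain C where "fibre_l1_le f C" using Cc_fibre_l1[OF f] by metis
  then have "bdd_above ((\<lambda>x. \<Sum>\<^sub>\<infinity>g\<in>range_fibre G x. cmod (f g)) ` units G)"
    by (auto simp: fibre_l1_le_def intro!: bdd_aboveI)
  then have "(\<Sum>\<^sub>\<infinity>g\<in>range_fibre G x. cmod (f g)) \<le> (SUP x\<in>units G. \<Sum>\<^sub>\<infinity>g\<in>range_fibre G x. cmod (f g))"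
    using x by (intro cSUP_upper)
  also have "\<dots> \<le> 1" using I by (simp add: I_norm_def)
  finally show "(\<Sum>\<^sub>\<infinity>g\<in>range_fibre G x. cmod (f g)) \<le> 1" .
qed simp

end

section \<open>Property (T) applied to the GNS vector\<close>

context positive_type_function
begin

lemma embed_diff: "u \<in> Cc \<Longrightarrow> v \<in> Cc \<Longrightarrow> embed (\<lambda>g. u g - v g) = (\<lambda>w. embed u w - embed v w)"
  by (auto simp: embed_def B_diff)

lemma hnorm_embed: "u \<in> Cc \<Longrightarrow> hnorm completion (embed u) = nrm u"
  by (simp add: hnorm_def nrm_def inner_embed)

text \<open>For \<open>h = f - Psi f\<close> the state is
  \<open><h \<xi>, \<xi>> = <h \<zeta>, \<xi>> = <\<zeta>, h* \<xi>>\<close>, with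
  \<open>\<zeta>\<close> the short vector from \<open>kazhdan_approx\<close>. Closeness of
  \<open>\<phi>\<close> to \<open>1\<close> is assumed only on quotients of elements of
  \<open>K\<close> and units, but \<open>f\<close> may have any compact support. \<open>D\<close>
  bounds the norm of \<open>h* \<xi>\<close>; here the source sums of \<open>f\<close>
  enter.\<close>

lemma kazhdan_state_bound:
  assumes kp: "kazhdan_pair TYPE(('g \<Rightarrow> complex) \<Rightarrow> complex) G K c" and e: "0 \<le> e"
    and close: "\<And>b k. \<lbrakk>b \<in> K \<union> units G; k \<in> K \<union> units G; rng G b = rng G k\<rbrakk> \<Longrightarrow>
      1 - \<phi> (gmult G (ginv G b) k) \<le> e"
    and f: "f \<in> Cc" and D: "fibre_l1_le (star G (\<lambda>g. f g - Psi G f g)) D"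
  shows "cmod (state (\<lambda>g. f g - Psi G f g)) \<le> 2 * sqrt e / c * D"
proof -
  interpret R: representation completion G gns_rep by (rule representation_gns)
  interpret C: pre_hilbert "hcarrier completion" "hinner completion" by (rule pre_hilbert_completion)
  let ?xi = "embed (unit_fun G)"
  have c: "c > 0" using kp by (simp add: kazhdan_pair_def)
  have embH: "embed u \<in> hcarrier completion" if "u \<in> Cc" for u
    using represents_embed[OF that] by auto
  have diff: "hdiff completion (gns_rep f ?xi) (gns_rep (Psi G f) ?xi) = embed (\<lambda>g. f g - Psi G f g)"
    if "f \<in> Cc" for f
    by (simp add: gns_rep_cyclic Cc_Psi that embed_diff)
  have small: "hnorm completion (hdiff completion (gns_rep f ?xi) (gns_rep (Psi G f) ?xi)) \<le> 2 * sqrt e"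
    if f: "f \<in> Cc" and supp: "support f \<subseteq> K" and I: "I_norm G f \<le> 1" for f
  proof -
    let ?h = "\<lambda>g. f g - Psi G f g"
    have P: "Psi G f \<in> Cc" by (rule Cc_Psi[OF f])
    have h: "?h \<in> Cc" by (rule Cc_diff[OF f P])
    have l1: "fibre_l1_le f 1" by (rule I_norm_fibre_l1[OF f I])
    have h1: "fibre_l1_le ?h 2"
      using fibre_l1_le_diff[OF Cc_fibre_finite[OF f] Cc_fibre_finite[OF P] l1 fibre_l1_le_Psi(1)[OF f l1]]
      by simp
    have hK: "g \<in> K \<union> units G" if "?h g \<noteq> 0" for g
    proof (rule ccontr)
      assume "g \<notin> K \<union> units G"
      then have "f g = 0" "Psi G f g = 0" using supp CcD(3)[OF f, of g] by (auto simp: Psi_def)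
      with that show False by simp
    qed
    have "cmod (ip ?h ?h) \<le> e * 2\<^sup>2"
      unfolding ip_def
    \<comment> \<open>The fibre sums of \<open>?h\<close> vanish, because \<open>Psi\<close> fixes
      functions living on the units; so \<open>\<phi>\<close> may be compared with
      \<open>1\<close>.\<close>
    proof (rule state_norm_le[OF h h1 e, where s = 1])
      fix x b k assume bk: "rng G b = x" "rng G k = x" "?h b \<noteq> 0" "?h k \<noteq> 0"
      show "\<bar>\<phi> (gmult G (ginv G b) k) - 1\<bar> \<le> e"
        using close[OF hK[OF bk(3)] hK[OF bk(4)]] bk(1,2) phi_bounds(2)[of "gmult G (ginv G b) k"] by simp
    next
      have "Psi G (Psi G f) = Psi G f" by (rule Psi_supported_on_units) (simp add: Psi_def)
      then show "1 = (0::real) \<or> (\<forall>x\<in>units G. Psi G ?h x = 0)" by (simp add: Psi_diff f P)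
    qed
    then have "(nrm ?h)\<^sup>2 \<le> (2 * sqrt e)\<^sup>2"
      using B_self[OF h] e by (simp add: norm_power power_mult_distrib mult.commute)
    then have "nrm ?h \<le> 2 * sqrt e" by (rule power2_le_imp_le) (use e in simp)
    then show ?thesis by (simp only: diff[OF f] hnorm_embed[OF h])
  qed
  obtain \<zeta> where z: "\<zeta> \<in> hcarrier completion" "c * hnorm completion \<zeta> \<le> 2 * sqrt e"
    "\<And>f. f \<in> Cc \<Longrightarrow> hdiff completion (gns_rep f \<zeta>) (gns_rep (Psi G f) \<zeta>) =
      hdiff completion (gns_rep f ?xi) (gns_rep (Psi G f) ?xi)"
    by (rule R.kazhdan_approx[OF Cc_Psi embH[OF Cc_unit_fun] kp small]) blast+
  let ?h = "\<lambda>g. f g - Psi G f g"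
  have P: "Psi G f \<in> Cc" by (rule Cc_Psi[OF f])
  have h: "?h \<in> Cc" by (rule Cc_diff[OF f P])
  \<comment> \<open>By the displacement identity \<open>?h\<close> sends \<open>\<zeta>\<close> and
    the GNS vector to the same element.\<close>
  have rep_h: "gns_rep ?h \<zeta> = embed ?h"
  proof -
    have "gns_rep ?h \<zeta> = gns_rep (\<lambda>g. f g + -1 * Psi G f g) \<zeta>" by simp
    also have "\<dots> = hdiff completion (gns_rep f \<zeta>) (gns_rep (Psi G f) \<zeta>)"
      by (simp only: R.rep_add[OF f Cc_scale[OF P] z(1)] R.rep_scale[OF P z(1)] hdiff_def)
    also have "\<dots> = embed ?h" by (simp only: z(3)[OF f] diff[OF f])
    finally show ?thesis .
  qed
  have "state ?h = ip ?h (unit_fun G)"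
    by (simp add: ip_def star_unit_fun unit_fun_conv)
  also have "\<dots> = hinner completion (gns_rep ?h \<zeta>) ?xi"
    by (simp only: rep_h inner_embed[OF h Cc_unit_fun])
  also have "\<dots> = hinner completion \<zeta> (gns_rep (star G ?h) ?xi)"
    using R.rep_star[OF star_Cc[OF h] z(1) embH[OF Cc_unit_fun]] by (simp only: star_star)
  also have "\<dots> = hinner completion \<zeta> (embed (star G ?h))"
    by (simp only: gns_rep_cyclic[OF star_Cc[OF h]])
  also have "cmod \<dots> \<le> hnorm completion \<zeta> * nrm (star G ?h)"
    using C.cauchy_schwarz[OF z(1) embH[OF star_Cc[OF h]]] hnorm_embed[OF star_Cc[OF h]]
    by (simp only: C.nrm_def hnorm_def)
  also have "\<dots> \<le> 2 * sqrt e / c * D"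
  proof (rule mult_mono)
    show "hnorm completion \<zeta> \<le> 2 * sqrt e / c" using z(2) c by (simp add: field_simps)
    show "nrm (star G ?h) \<le> D" by (rule nrm_le[OF star_Cc[OF h] D])
  qed (use c e nrm_nonneg[OF star_Cc[OF h]] in auto)
  finally show ?thesis .
qed

end

text \<open>A locally compact Hausdorff space is completely regular; \<open>g0\<close> is separated
  from the complement of an open set contained in a compact one.\<close>

lemma locally_compact_bump:
  fixes g0 :: "'g::t2_space"
  assumes "locally_compact_space (euclidean :: 'g topology)"
  obtains \<theta> C where "continuous_on UNIV \<theta>" "compact C" "\<And>g. g \<notin> C \<Longrightarrow> \<theta> g = 0"
    "\<And>g. 0 \<le> \<theta> g" "\<And>g. \<theta> g \<le> (1::real)" "\<theta> g0 = 1"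
proof -
  have "Hausdorff_space (euclidean :: 'g topology)"
    unfolding Hausdorff_space_def using hausdorff by (auto simp: disjnt_def)
  then have "completely_regular_space (euclidean :: 'g topology)"
    using assms by (intro locally_compact_regular_imp_completely_regular_space) auto
  moreover obtain U C where U: "open U" "compact C" "g0 \<in> U" "U \<subseteq> C"
    using assms unfolding locally_compact_space_def by (simp add: Bex_def) metis
  ultimately obtain f :: "'g \<Rightarrow> real" where f: "continuous_map euclidean (top_of_set {0..1}) f"
    "f g0 = 0" "f ` (- U) \<subseteq> {1}"
    unfolding completely_regular_space_def by (metis Compl_iff DiffI UNIV_I closed_Compl closed_closedin topspace_euclidean)
  have fc: "continuous_on UNIV f" and f01: "f g \<in> {0..1}" for g
    using f(1) by (auto simp: continuous_map_in_subtopology Pi_iff)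
  show ?thesis
  proof (rule that[of "\<lambda>g. 1 - f g" C])
    show "1 - f g = 0" if "g \<notin> C" for g using that U f(3) by auto
  qed (use U f(2) f01 fc in \<open>auto intro!: continuous_intros\<close>)
qed

section \<open>Functions spread thinly over infinite fibres\<close>

context measured_etale
begin

text \<open>Truncating at height \<open>1\<close> a sum of bumps at many points of each fibre gives a function
  with large fibre sums, which is then normalised.\<close>

lemma spread_out_function:
  assumes lc: "locally_compact_space (euclidean :: 'g topology)"
    and inf: "\<And>x. x \<in> units G \<Longrightarrow> infinite (range_fibre G x)" and e: "e > 0"
  obtains k :: "'g \<Rightarrow> real" where "(\<lambda>g. complex_of_real (k g)) \<in> Cc" "\<And>g. 0 \<le> k g" "\<And>g. k g \<le> e"
    "\<And>x. x \<in> units G \<Longrightarrow> Psi G (\<lambda>g. complex_of_real (k g)) x = 1"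
proof -
  obtain n :: nat where n: "1 / e < real n" using reals_Archimedean2 by blast
  then have n0: "real n > 0" using e by (meson divide_pos_pos less_trans zero_less_one)
  have "\<forall>g0::'g. \<exists>\<theta> C. continuous_on UNIV \<theta> \<and> compact C \<and> (\<forall>g. g \<notin> C \<longrightarrow> \<theta> g = 0) \<and>
      (\<forall>g. 0 \<le> \<theta> g) \<and> (\<forall>g. \<theta> g \<le> (1::real)) \<and> \<theta> g0 = 1"
    using locally_compact_bump[OF lc] by metis
  then obtain \<theta> :: "'g \<Rightarrow> 'g \<Rightarrow> real" and C where chi: "\<And>d. continuous_on UNIV (\<theta> d)" "\<And>d. compact (C d)"
    "\<And>d g. g \<notin> C d \<Longrightarrow> \<theta> d g = 0" "\<And>d g. 0 \<le> \<theta> d g" "\<And>d. \<theta> d d = 1"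
    by metis
  \<comment> \<open>Truncation keeps the values at most \<open>1\<close>, while every
    \<open>d \<in> D\<close> still has value \<open>1\<close>, however the bumps overlap.\<close>
  define b where "b D g = min 1 (\<Sum>d\<in>D. \<theta> d g)" for D g
  have b01: "0 \<le> b D g" "b D g \<le> 1" for D g using chi(4) by (auto simp: b_def intro: sum_nonneg)
  have bCc: "(\<lambda>g. complex_of_real (b D g)) \<in> Cc" if "finite D" for D
    using that chi(2) by (intro CcI[of _ "\<Union>d\<in>D. C d"]) (auto simp: b_def chi(3) intro!: continuous_intros chi(1))
  have summ: "b D summable_on range_fibre G x" if "finite D" for D x
    by (rule fibre_finite_real_summable[OF Cc_fibre_finite[OF bCc[OF that]]]) simp
  have Psi_b: "Psi G (\<lambda>g. complex_of_real (b D g)) x = of_real (\<Sum>\<^sub>\<infinity>g\<in>range_fibre G x. b D g)"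
    if "finite D" "x \<in> units G" for D x
    unfolding Psi_unit[OF that(2)] by (rule infsum_complex_of_real[OF summ[OF that(1)]])
  \<comment> \<open>One point more than \<open>n\<close> gives the strict inequality in
    \<open>big\<close>, an open condition that persists near \<open>x\<close>.\<close>
  have "\<exists>D. finite D \<and> card D = Suc n \<and> D \<subseteq> range_fibre G x" if "x \<in> units G" for x
    using infinite_arbitrarily_large[OF inf[OF that]] by blast
  then obtain D where D: "\<And>x. x \<in> units G \<Longrightarrow> finite (D x)" "\<And>x. x \<in> units G \<Longrightarrow> card (D x) = Suc n"
    "\<And>x. x \<in> units G \<Longrightarrow> D x \<subseteq> range_fibre G x" by metis
  have big: "real n < (\<Sum>\<^sub>\<infinity>g\<in>range_fibre G x. b (D x) g)" if x: "x \<in> units G" for x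
  proof -
    have "b (D x) d = 1" if "d \<in> D x" for d
      using member_le_sum[OF that, of "\<lambda>d'. \<theta> d' d"] chi(4,5) D(1)[OF x] by (simp add: b_def)
    then have "real n < (\<Sum>d\<in>D x. b (D x) d)" by (simp add: D(2)[OF x])
    also have "\<dots> \<le> (\<Sum>\<^sub>\<infinity>g\<in>range_fibre G x. b (D x) g)"
      by (intro finite_sum_le_infsum summ D x b01)
    finally show ?thesis .
  qed
  define U where "U x = {y. real n < Re (Psi G (\<lambda>g. complex_of_real (b (D x) g)) y)}" for x
  have oU: "open (U x)" if "x \<in> units G" for x
    unfolding U_def using CcD(1)[OF Cc_Psi[OF bCc[OF D(1)[OF that]]]]
    by (intro open_Collect_less continuous_intros)
  have xU: "x \<in> U x" if "x \<in> units G" for x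
    using big[OF that] by (simp add: U_def Psi_b[OF D(1)] that)
  obtain X where X: "X \<subseteq> units G" "finite X" "units G \<subseteq> (\<Union>x\<in>X. U x)"
    using compactE_image[OF compact_units, of "units G" U] oU xU by (metis UN_I subsetI)
  \<comment> \<open>More bumps only increase the fibre sums, so those for all of the finite set
    \<open>X\<close> together work over the whole unit space.\<close>
  define E where "E = (\<Union>x\<in>X. D x)"
  have E: "finite E" using X D(1) by (auto simp: E_def)
  define \<beta> where "\<beta> = (\<lambda>g. complex_of_real (b E g))"
  define P where "P y = Re (Psi G \<beta> y)" for y
  have Psi_beta: "Psi G \<beta> y = of_real (P y)" "P y = (\<Sum>\<^sub>\<infinity>g\<in>range_fibre G y. b E g)" if "y \<in> units G" for y
    using Psi_b[OF E that] by (simp_all add: P_def \<beta>_def)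
  have P: "real n < P y" if y: "y \<in> units G" for y
  proof -
    obtain x where x: "x \<in> X" "y \<in> U x" using X y by blast
    then have xu: "x \<in> units G" using X by blast
    have "real n < (\<Sum>\<^sub>\<infinity>g\<in>range_fibre G y. b (D x) g)"
      using x(2) by (simp add: U_def Psi_b[OF D(1)[OF xu] y])
    also have "\<dots> \<le> (\<Sum>\<^sub>\<infinity>g\<in>range_fibre G y. b E g)"
    proof (intro infsum_mono summ E D xu)
      fix g
      have "(\<Sum>d\<in>D x. \<theta> d g) \<le> (\<Sum>d\<in>E. \<theta> d g)"
        using E x chi(4) by (intro sum_mono2) (auto simp: E_def)
      then show "b (D x) g \<le> b E g" by (simp add: b_def)
    qed
    finally show ?thesis by (simp add: Psi_beta(2)[OF y])
  qed
  have Pc: "continuous_on UNIV (\<lambda>g. P (rng G g))"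
    unfolding P_def using CcD(1)[OF Cc_Psi[OF bCc[OF E]]]
    by (intro continuous_intros continuous_on_compose2[OF _ continuous_rng]) (auto simp: \<beta>_def)
  have Pn: "real n < P (rng G g)" for g by (rule P) simp
  have Pnz: "P (rng G g) \<noteq> 0" for g using Pn[of g] n0 by linarith
  define k where "k g = b E g / P (rng G g)" for g
  show ?thesis
  proof (rule that)
    have "continuous_on UNIV (\<lambda>g. complex_of_real (1 / P (rng G g)))"
      using Pnz by (intro continuous_intros Pc) auto
    then have "(\<lambda>g. \<beta> g * complex_of_real (1 / P (rng G g))) \<in> Cc"
      unfolding \<beta>_def by (intro Cc_mult bCc E)
    then show "(\<lambda>g. complex_of_real (k g)) \<in> Cc" by (simp add: k_def \<beta>_def)
    show "0 \<le> k g" for g using b01(1)[of E g] Pn[of g] n0 by (simp add: k_def)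
    show "k g \<le> e" for g
    proof -
      have "1 < real n * e" using n e by (simp add: field_simps)
      also have "\<dots> \<le> P (rng G g) * e" using Pn[of g] e by (intro mult_right_mono) auto
      finally have "b E g \<le> e * P (rng G g)" using b01(2)[of E g] by (simp add: mult.commute)
      then show ?thesis using Pn[of g] n0 by (simp add: k_def divide_le_eq)
    qed
    fix x assume x: "x \<in> units G"
    have "Psi G (\<lambda>g. complex_of_real (k g)) x = (\<Sum>\<^sub>\<infinity>g\<in>range_fibre G x. complex_of_real (1 / P x) * \<beta> g)"
      unfolding Psi_unit[OF x] by (intro infsum_cong) (simp add: k_def \<beta>_def range_fibre_def)
    also have "\<dots> = complex_of_real (1 / P x) * Psi G \<beta> x"
      unfolding Psi_unit[OF x] by (rule infsum_cmult_right')
    also have "\<dots> = 1" using P[OF x] n0 by (simp add: Psi_beta(1)[OF x])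
    finally show "Psi G (\<lambda>g. complex_of_real (k g)) x = 1" .
  qed
qed

end

context measured_etale
begin

text \<open>With \<open>S\<close> the source sums of a spread out function \<open>k\<close>, the function
  \<open>k (1 + S)\<^sup>-\<^sup>1 k\<^sup>*\<close> is symmetric, so its source sums equal its range sums. By invariance its total
  mass is \<open>\<integral> S\<^sup>2 / (S + 1)\<close>, where \<open>S\<^sup>2 / (S + 1) \<ge> (3 S - 1) / 4\<close> and \<open>\<integral> S = 1\<close>.\<close>

lemma spread_out_symmetric_function:
  assumes lc: "locally_compact_space (euclidean :: 'g topology)"
    and inf: "\<And>x. x \<in> units G \<Longrightarrow> infinite (range_fibre G x)" and e: "e > 0"
  obtains r :: "'g \<Rightarrow> real" where "(\<lambda>g. complex_of_real (r g)) \<in> Cc" "\<And>g. 0 \<le> r g" "\<And>g. r g \<le> e"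
    "\<And>g. r (ginv G g) = r g" "fibre_l1_le (\<lambda>g. complex_of_real (r g)) 1"
    "1 / 2 \<le> Re (Lam (\<lambda>g. complex_of_real (r g)))"
proof -
  obtain k :: "'g \<Rightarrow> real" where kCc: "(\<lambda>g. complex_of_real (k g)) \<in> Cc" and k0: "\<And>g. 0 \<le> k g"
    and ke: "\<And>g. k g \<le> e" and Psi_k: "\<And>x. x \<in> units G \<Longrightarrow> Psi G (\<lambda>g. complex_of_real (k g)) x = 1"
    using spread_out_function[OF lc inf e] by blast
  define \<kappa> where "\<kappa> = (\<lambda>g. complex_of_real (k g))"
  define \<kappa>' where "\<kappa>' = (\<lambda>g. complex_of_real (k (ginv G g)))"
  have C: "\<kappa> \<in> Cc" "\<kappa>' \<in> Cc" using kCc Cc_inv[OF kCc] by (simp_all add: \<kappa>_def \<kappa>'_def)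
  have ff: "fibre_finite \<kappa>" "fibre_finite \<kappa>'" using C by (auto intro: Cc_fibre_finite)
  have summ: "k summable_on range_fibre G x" "(\<lambda>g. k (ginv G g)) summable_on range_fibre G x" for x
    using ff by (auto intro: fibre_finite_real_summable simp: \<kappa>_def \<kappa>'_def)
  have sum_k: "(\<Sum>\<^sub>\<infinity>g\<in>range_fibre G x. k g) = 1" if "x \<in> units G" for x
    using Psi_k[OF that] infsum_complex_of_real[OF summ(1)[of x]] by (simp add: Psi_unit that)
  define S where "S x = Re (Psi G \<kappa>' x)" for x
  have S: "Psi G \<kappa>' x = of_real (S x)" "S x = (\<Sum>\<^sub>\<infinity>g\<in>range_fibre G x. k (ginv G g))" if "x \<in> units G" for x
    using infsum_complex_of_real[OF summ(2)[of x]] that by (simp_all add: S_def Psi_unit \<kappa>'_def)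
  have S0: "0 \<le> S x" if "x \<in> units G" for x
    unfolding S(2)[OF that] using k0 by (intro infsum_nonneg) auto
  have S0': "0 \<le> S (src G g)" "0 \<le> S (rng G g)" for g by (auto intro: S0)
  have S_cont: "continuous_on UNIV S"
    unfolding S_def using CcD(1)[OF Cc_Psi[OF C(2)]] by (intro continuous_intros)
  \<comment> \<open>The weight \<open>1 / S\<close> would give range sums exactly \<open>1\<close>,
    but \<open>S\<close> may vanish. Adding \<open>1\<close> keeps \<open>w\<close> continuous, and
    since \<open>S / (S + 1) \<le> 1\<close> the range sums stay at most \<open>1\<close>.\<close>
  define w where "w g = 1 / (S (src G g) + 1)" for g
  have w: "0 \<le> w g" "w g \<le> 1" for g using S0'(1)[of g] by (simp_all add: w_def)
  have w_cont: "continuous_on UNIV (\<lambda>g. complex_of_real (w g))"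
    unfolding w_def using S0'(1)
    by (intro continuous_intros continuous_on_compose2[OF S_cont continuous_src])
      (auto simp: add_nonneg_eq_0_iff)
  define \<delta> where "\<delta> g = \<kappa> g * complex_of_real (w g)" for g
  have dC: "\<delta> \<in> Cc" unfolding \<delta>_def[abs_def] by (rule Cc_mult[OF C(1) w_cont])
  define f where "f = conv G \<delta> \<kappa>'"
  have fC: "f \<in> Cc" unfolding f_def by (rule Cc_conv[OF dC C(2)])
  define r where "r g = (\<Sum>\<^sub>\<infinity>h\<in>range_fibre G (rng G g). k h * w h * k (gmult G (ginv G g) h))" for g
  have inv_prod: "ginv G (gmult G (ginv G h) g) = gmult G (ginv G g) h" if "rng G h = rng G g" for g h
    using that by (rule inv_mult_inv)
  have summ_r: "(\<lambda>h. k h * w h * q h) summable_on range_fibre G x" for q x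
    by (rule fibre_finite_real_summable[OF ff(1)]) (simp add: \<kappa>_def)
  have fr: "f g = complex_of_real (r g)" for g
  proof -
    have "f g = (\<Sum>\<^sub>\<infinity>h\<in>range_fibre G (rng G g). complex_of_real (k h * w h * k (gmult G (ginv G g) h)))"
      unfolding f_def conv_eq
      by (intro infsum_cong) (simp add: \<delta>_def \<kappa>_def \<kappa>'_def range_fibre_def inv_prod)
    also have "\<dots> = complex_of_real (r g)"
      unfolding r_def by (rule infsum_complex_of_real[OF summ_r])
    finally show ?thesis .
  qed
  have f_eq: "(\<lambda>g. complex_of_real (r g)) = f" by (simp add: fr fun_eq_iff)
  have r0: "0 \<le> r g" for g
    unfolding r_def using k0 w by (intro infsum_nonneg) auto
  \<comment> \<open>Only the last factor has to be small: the product of the other two has total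
    weight at most \<open>1\<close> on the fibre.\<close>
  have re: "r g \<le> e" for g
  proof -
    have "r g \<le> (\<Sum>\<^sub>\<infinity>h\<in>range_fibre G (rng G g). k h * e)"
      unfolding r_def
    proof (rule infsum_mono[OF summ_r])
      show "(\<lambda>h. k h * e) summable_on range_fibre G (rng G g)" by (intro summable_on_cmult_left summ)
      fix h
      have "k h * w h * k (gmult G (ginv G g) h) \<le> k h * 1 * e"
        using k0 ke w by (intro mult_mono mult_nonneg_nonneg) auto
      then show "k h * w h * k (gmult G (ginv G g) h) \<le> k h * e" by simp
    qed
    also have "\<dots> = e" by (simp add: infsum_cmult_left' sum_k)
    finally show ?thesis .
  qed
  have star_f: "star G f = f"
  proof
    fix g
    have "star G f g = conv G (star G \<kappa>') (star G \<delta>) g" by (simp add: f_def star_conv)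
    also have "\<dots> = conv G \<delta> \<kappa>' g"
    proof (rule conv_cong)
      fix h assume h: "rng G h = rng G g"
      have "src G (gmult G (ginv G g) h) = src G h" using h by (simp add: src_inv_mult)
      then show "star G \<kappa>' h * star G \<delta> (gmult G (ginv G h) g) = \<delta> h * \<kappa>' (gmult G (ginv G h) g)"
        using h by (simp add: star_def \<kappa>'_def \<delta>_def \<kappa>_def inv_prod w_def)
    qed
    finally show "star G f g = f g" by (simp add: f_def)
  qed
  have sym: "r (ginv G g) = r g" for g
    using fun_cong[OF star_f, of g] unfolding star_def fr by simp
  have Psi_f: "Psi G f x = (\<Sum>\<^sub>\<infinity>h\<in>range_fibre G x. complex_of_real (k h * w h * S (src G h)))"
    if x: "x \<in> units G" for x
  proof -
    have "Psi G f x = (\<Sum>\<^sub>\<infinity>m\<in>range_fibre G x.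
        (\<Sum>\<^sub>\<infinity>h\<in>range_fibre G x. \<delta> h * \<kappa>' (gmult G (ginv G h) m)) * 1)"
      unfolding Psi_unit[OF x] f_def by (intro infsum_cong) (simp add: conv_eq range_fibre_def)
    also have "\<dots> = (\<Sum>\<^sub>\<infinity>h\<in>range_fibre G x. \<delta> h * (\<Sum>\<^sub>\<infinity>k\<in>range_fibre G (src G h). \<kappa>' k * 1))"
      using ff(2) Cc_fibre_finite[OF dC]
      by (intro infsum_fibre_translate[symmetric]) (auto simp: fibre_finite_def)
    also have "\<dots> = (\<Sum>\<^sub>\<infinity>h\<in>range_fibre G x. complex_of_real (k h * w h * S (src G h)))"
      using S(1) by (intro infsum_cong) (simp add: \<delta>_def \<kappa>_def Psi_unit)
    finally show ?thesis .
  qed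
  have l1: "fibre_l1_le f 1"
  proof (rule fibre_l1_leI)
    fix x assume x: "x \<in> units G"
    have rs: "r summable_on range_fibre G x"
      using fibre_finite_real_summable[OF Cc_fibre_finite[OF fC]] by (simp add: fr)
    have "complex_of_real (\<Sum>\<^sub>\<infinity>g\<in>range_fibre G x. r g) = Psi G f x"
      unfolding Psi_unit[OF x] fr by (rule infsum_complex_of_real[OF rs, symmetric])
    also have "\<dots> = complex_of_real (\<Sum>\<^sub>\<infinity>h\<in>range_fibre G x. k h * w h * S (src G h))"
      unfolding Psi_f[OF x] by (rule infsum_complex_of_real[OF summ_r])
    finally have "(\<Sum>\<^sub>\<infinity>g\<in>range_fibre G x. r g) = (\<Sum>\<^sub>\<infinity>h\<in>range_fibre G x. k h * w h * S (src G h))"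
      by (simp only: of_real_eq_iff)
    also have "\<dots> \<le> (\<Sum>\<^sub>\<infinity>h\<in>range_fibre G x. k h)"
    proof (rule infsum_mono[OF summ_r summ(1)])
      fix h
      have "w h * S (src G h) \<le> 1" using S0'(1)[of h] by (simp add: w_def)
      then show "k h * w h * S (src G h) \<le> k h"
        using k0[of h] mult_left_mono[of "w h * S (src G h)" 1 "k h"] by (simp add: mult.assoc)
    qed
    also have "\<dots> = 1" by (rule sum_k[OF x])
    finally show "(\<Sum>\<^sub>\<infinity>g\<in>range_fibre G x. cmod (f g)) \<le> 1" by (simp add: fr r0)
  qed simp
  have "1 / 2 \<le> Re (Lam f)"
  proof -
    define \<nu> where "\<nu> g = \<kappa> g * complex_of_real (w g * S (src G g))" for g
    have nC: "\<nu> \<in> Cc"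
      unfolding \<nu>_def[abs_def] of_real_mult
      by (intro Cc_mult C continuous_on_mult w_cont continuous_on_of_real continuous_on_compose2[OF S_cont continuous_src]) auto
    define \<nu>' where "\<nu>' g = \<nu> (ginv G g)" for g
    have nC': "\<nu>' \<in> Cc" unfolding \<nu>'_def[abs_def] by (rule Cc_inv[OF nC])
    have "Lam f = Lam \<nu>"
    proof (rule Lam_cong)
      fix x assume x: "x \<in> units G"
      show "Psi G f x = Psi G \<nu> x"
        unfolding Psi_f[OF x] by (simp add: Psi_unit[OF x] \<nu>_def \<kappa>_def mult.assoc)
    qed
    also have "\<dots> = Lam \<nu>'" unfolding \<nu>'_def by (rule Lam_inv[OF nC, symmetric])
    finally have 1: "Lam f = Lam \<nu>'" .
    have Psi_u: "Psi G (unit_fun G) = unit_fun G"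
      by (rule Psi_supported_on_units) (simp add: unit_fun_def)
    \<comment> \<open>By invariance the mean of the source sums \<open>S\<close> equals the mean of
      the range sums, all of which are \<open>1\<close>.\<close>
    have "Lam \<kappa>' = Lam \<kappa>" using Lam_inv[OF C(1)] by (simp add: \<kappa>_def \<kappa>'_def)
    also have "\<dots> = Lam (unit_fun G)"
      using Psi_k by (intro Lam_cong) (simp only: Psi_u \<kappa>_def, simp add: unit_fun_def)
    also have "\<dots> = (LINT x|M. 1)"
      unfolding Lam_def Psi_u
      by (intro Bochner_Integration.integral_cong) (simp_all add: space_M unit_fun_def)
    also have "\<dots> = 1" by (simp add: prob_space)
    finally have 2: "Lam \<kappa>' = 1" .
    have kC': "(\<lambda>g. complex_of_real (3 / 4) * \<kappa>' g) \<in> Cc" by (rule Cc_scale[OF C(2)])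
    have "- 1 / 4 \<le> Re (Lam (\<lambda>g. \<nu>' g - complex_of_real (3 / 4) * \<kappa>' g))"
    proof (rule Lam_Re_ge)
      fix x assume x: "x \<in> units G"
      \<comment> \<open>After inversion the weight depends on the base point only; it leaves the
        sum, which contributes a second factor \<open>S x\<close>.\<close>
      have "Psi G \<nu>' x = (\<Sum>\<^sub>\<infinity>g\<in>range_fibre G x. complex_of_real (S x / (S x + 1)) * \<kappa>' g)"
        unfolding Psi_unit[OF x]
        by (intro infsum_cong) (simp add: \<nu>'_def \<nu>_def w_def \<kappa>_def \<kappa>'_def range_fibre_def src_inv)
      also have "\<dots> = complex_of_real (S x / (S x + 1)) * Psi G \<kappa>' x"
        unfolding Psi_unit[OF x] by (rule infsum_cmult_right')
      also have "\<dots> = complex_of_real (S x / (S x + 1) * S x)" by (simp add: S(1)[OF x])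
      finally have "Psi G (\<lambda>g. \<nu>' g - complex_of_real (3 / 4) * \<kappa>' g) x =
          complex_of_real (S x / (S x + 1) * S x - 3 / 4 * S x)"
        by (simp only: Psi_diff[OF nC' kC'] Psi_scale S(1)[OF x] of_real_diff of_real_mult)
      \<comment> \<open>\<open>3 / 4 * s - 1 / 4\<close> is the tangent of the convex function
        \<open>s^2 / (s + 1)\<close> at \<open>s = 1\<close>, the mean of \<open>S\<close>: the
        estimate is Jensen's inequality.\<close>
      moreover have "- 1 / 4 \<le> S x / (S x + 1) * S x - 3 / 4 * S x"
      proof -
        have "S x / (S x + 1) * S x - 3 / 4 * S x + 1 / 4 = (S x - 1)\<^sup>2 / (4 * (S x + 1))"
          using S0[OF x] by (simp add: field_simps power2_eq_square)
        also have "\<dots> \<ge> 0" using S0[OF x] by simp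
        finally show ?thesis by simp
      qed
      ultimately show "- 1 / 4 \<le> Re (Psi G (\<lambda>g. \<nu>' g - complex_of_real (3 / 4) * \<kappa>' g) x)"
        by (simp only: Re_complex_of_real)
    qed (rule Cc_diff[OF nC' kC'])
    also have "\<dots> = Re (Lam f) - 3 / 4"
      unfolding Lam_diff[OF nC' kC'] Lam_scale 1 2 by simp
    finally show ?thesis by simp
  qed
  then show ?thesis
    using that[of r] f_eq fC r0 re sym l1 by simp
qed

end

section \<open>The contradiction for infinite fibres\<close>

context positive_type_function
begin

text \<open>Two estimates for the integral of the fibre sums of \<open>r (1 - \<phi>)\<close>
  collide. Property (T) bounds it above by \<open>2 * (c / 64) / c * 2 = 1 / 16\<close>, where the
  last \<open>2\<close> bounds the source sums of \<open>f - Psi f\<close>. Spreading bounds it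
  below by \<open>1 / 4 - 1 / 8\<close>: half of the mass of \<open>r\<close>, less a correction for
  \<open>L\<close>. The constant \<open>64\<close> makes the first bound smaller than the
  second.\<close>

lemma kazhdan_infinite_fibres:
  assumes lc: "locally_compact_space (euclidean :: 'g topology)"
    and kp: "kazhdan_pair TYPE(('g \<Rightarrow> complex) \<Rightarrow> complex) G K c"
    and close: "\<And>b k. \<lbrakk>b \<in> K \<union> units G; k \<in> K \<union> units G; rng G b = rng G k\<rbrakk> \<Longrightarrow>
      1 - \<phi> (gmult G (ginv G b) k) \<le> (c / 64)\<^sup>2"
    and L: "compact L" "\<And>g. g \<notin> L \<Longrightarrow> \<phi> g \<le> 1 / 2"
  shows "\<exists>x\<in>units G. finite (range_fibre G x)"
proof (rule ccontr)
  assume "\<not> (\<exists>x\<in>units G. finite (range_fibre G x))"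
  then have inf: "\<And>x. x \<in> units G \<Longrightarrow> infinite (range_fibre G x)" by blast
  have c: "c > 0" using kp by (simp add: kazhdan_pair_def)
  obtain N :: nat where N: "N > 0" "\<And>x. finite (range_fibre G x \<inter> L)" "\<And>x. card (range_fibre G x \<inter> L) \<le> N"
    using compact_fibre_card[OF L(1)] by blast
  \<comment> \<open>Inside \<open>L\<close> the lower estimate loses at most \<open>e / 2\<close> at
    each of at most \<open>N\<close> points of a fibre, in total
    \<open>N * e / 2 = 1 / 8\<close>.\<close>
  define e where "e = 1 / (4 * real N)"
  have e: "e > 0" using N(1) by (simp add: e_def)
  obtain r :: "'g \<Rightarrow> real" where rC: "(\<lambda>g. complex_of_real (r g)) \<in> Cc" and r0: "\<And>g. 0 \<le> r g"
    and re: "\<And>g. r g \<le> e" and sym: "\<And>g. r (ginv G g) = r g"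
    and l1: "fibre_l1_le (\<lambda>g. complex_of_real (r g)) 1"
    and Lr: "1 / 2 \<le> Re (Lam (\<lambda>g. complex_of_real (r g)))"
    using spread_out_symmetric_function[OF lc inf e] by blast
  define f where "f = (\<lambda>g. complex_of_real (r g))"
  have fC: "f \<in> Cc" and fl1: "fibre_l1_le f 1" and Lf: "1 / 2 \<le> Re (Lam f)"
    using rC l1 Lr by (simp_all add: f_def)
  have PC: "Psi G f \<in> Cc" by (rule Cc_Psi[OF fC])
  have sf: "star G f = f" by (simp add: star_def f_def sym fun_eq_iff)
  have "star G (\<lambda>g. f g - Psi G f g) = (\<lambda>g. star G f g - star G (Psi G f) g)"
    by (simp add: star_def fun_eq_iff)
  then have "fibre_l1_le (star G (\<lambda>g. f g - Psi G f g)) (1 + 1)"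
    unfolding sf
    using fibre_l1_le_diff[OF Cc_fibre_finite[OF fC] Cc_fibre_finite[OF star_Cc[OF PC]] fl1 fibre_l1_le_Psi(2)[OF fC fl1]]
    by simp
  then have "cmod (state (\<lambda>g. f g - Psi G f g)) \<le> 2 * sqrt ((c / 64)\<^sup>2) / c * (1 + 1)"
    by (intro kazhdan_state_bound[OF kp _ close fC]) auto
  also have "sqrt ((c / 64)\<^sup>2) = c / 64" by (rule real_sqrt_unique) (use c in auto)
  also have "2 * (c / 64) / c * (1 + 1) = 1 / 16" using c by simp
  finally have upper: "cmod (state (\<lambda>g. f g - Psi G f g)) \<le> 1 / 16" .
  have fp: "(\<lambda>g. f g * \<phi>c g) \<in> Cc" and Pp: "(\<lambda>g. Psi G f g * \<phi>c g) \<in> Cc"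
    by (intro Cc_mult fC PC phi_cont)+
  \<comment> \<open>\<open>Psi G f\<close> lives on the units, where
    \<open>\<phi> = 1\<close>.\<close>
  have "Lam (\<lambda>g. Psi G f g * \<phi>c g) = Lam f"
  proof (rule Lam_cong)
    fix x assume x: "x \<in> units G"
    have "Psi G (\<lambda>g. Psi G f g * \<phi>c g) = (\<lambda>g. Psi G f g * \<phi>c g)"
      by (rule Psi_supported_on_units) (simp add: Psi_def)
    then show "Psi G (\<lambda>g. Psi G f g * \<phi>c g) x = Psi G f x" by (simp add: phi_unit x)
  qed
  then have st: "state (\<lambda>g. f g - Psi G f g) = Lam (\<lambda>g. f g * \<phi>c g) - Lam f"
    unfolding state_def left_diff_distrib by (simp add: Lam_diff[OF fp Pp])
  define q where "q = (\<lambda>g. f g - f g * \<phi>c g)"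
  have qC: "q \<in> Cc" unfolding q_def by (rule Cc_diff[OF fC fp])
  define h where "h = (\<lambda>g. complex_of_real (1 / 2) * f g)"
  have hC: "h \<in> Cc" unfolding h_def by (rule Cc_scale[OF fC])
  have "- 1 / 8 \<le> Re (Lam (\<lambda>g. q g - h g))"
  proof (rule Lam_Re_ge)
    fix x assume x: "x \<in> units G"
    let ?R = "range_fibre G x"
    \<comment> \<open>\<open>p\<close> compares \<open>r (1 - \<phi>)\<close> with
      \<open>r / 2\<close>: it is nonnegative outside \<open>L\<close>, where
      \<open>\<phi> \<le> 1 / 2\<close>, and at least \<open>- e / 2\<close> everywhere.\<close>
    define p where "p g = r g * (1 - \<phi> g) - r g / 2" for g
    have ps: "p summable_on ?R"
      by (rule fibre_finite_real_summable[OF Cc_fibre_finite[OF fC]]) (simp add: f_def p_def)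
    have "Psi G (\<lambda>g. q g - h g) x = (\<Sum>\<^sub>\<infinity>g\<in>?R. complex_of_real (p g))"
      unfolding Psi_unit[OF x] by (intro infsum_cong) (simp add: q_def h_def f_def p_def algebra_simps)
    also have "\<dots> = complex_of_real (\<Sum>\<^sub>\<infinity>g\<in>?R. p g)" by (rule infsum_complex_of_real[OF ps])
    finally have Pq: "Re (Psi G (\<lambda>g. q g - h g) x) = (\<Sum>\<^sub>\<infinity>g\<in>?R. p g)" by simp
    have "- 1 / 8 \<le> (\<Sum>g\<in>?R \<inter> L. - e / 2)"
    proof -
      have "real (card (?R \<inter> L)) * (e / 2) \<le> real N * (e / 2)"
        using N(3)[of x] e by (intro mult_right_mono) auto
      also have "\<dots> = 1 / 8" using N(1) by (simp add: e_def)
      finally show ?thesis by simp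
    qed
    also have "\<dots> \<le> (\<Sum>g\<in>?R \<inter> L. p g)"
    proof (rule sum_mono)
      fix g
      have "0 \<le> r g * (1 - \<phi> g)" using r0 phi_bounds(2)[of g] by simp
      then show "- e / 2 \<le> p g" using re[of g] by (simp add: p_def)
    qed
    also have "\<dots> \<le> (\<Sum>\<^sub>\<infinity>g\<in>?R. p g)"
    proof (rule finite_sum_le_infsum[OF ps N(2)])
      fix g assume "g \<in> ?R - ?R \<inter> L"
      then have "1 / 2 \<le> 1 - \<phi> g" using L(2)[of g] by simp
      then show "0 \<le> p g" using mult_left_mono[of "1 / 2" "1 - \<phi> g" "r g"] r0[of g] by (simp add: p_def)
    qed simp
    finally show "- 1 / 8 \<le> Re (Psi G (\<lambda>g. q g - h g) x)" by (simp only: Pq)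
  qed (rule Cc_diff[OF qC hC])
  also have "\<dots> = Re (Lam q) - 1 / 2 * Re (Lam f)"
    unfolding Lam_diff[OF qC hC] unfolding h_def Lam_scale by simp
  finally have "1 / 8 \<le> Re (Lam q)" using Lf by simp
  also have "Lam q = - state (\<lambda>g. f g - Psi G f g)"
    unfolding st q_def by (simp add: Lam_diff[OF fC fp])
  also have "Re (- state (\<lambda>g. f g - Psi G f g)) \<le> 1 / 16"
    using upper abs_Re_le_cmod[of "state (\<lambda>g. f g - Psi G f g)"] by simp
  finally show False by simp
qed

end

text \<open>Negative type concerns coefficients with sum zero. Adding the unit \<open>x\<close> with
  coefficient \<open>- sum c A\<close> produces such coefficients, and by the symmetry of
  \<open>F\<close> the new terms contain the values of \<open>F\<close> on \<open>A\<close>; so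
  \<open>F\<close> itself plays the role of \<open>d\<close> in
  \<open>psd_kernel_exp_neg\<close>.\<close>

lemma (in groupoid) negative_type_psd:
  assumes F: "negative_type G F" and A: "finite A" "A \<subseteq> range_fibre G x" and t: "0 \<le> t"
  shows "psd_kernel A (\<lambda>g h. exp (- t * F (gmult G (ginv G g) h)))"
\<comment> \<open>A nonempty \<open>A\<close> guarantees that \<open>x\<close> is a unit and can
  serve as base point.\<close>
proof (cases "A = {}")
  case True
  then show ?thesis by (simp add: psd_kernel_def)
next
  case False
  then have x: "x \<in> units G" using A(2) by (auto simp: range_fibre_def)
  have Finv: "F (ginv G g) = F g" for g using F by (simp add: negative_type_def)
  have Fx: "F x = 0" using F x by (simp add: negative_type_def)
  have rA: "rng G g = x" if "g \<in> A" for g using A(2) that by (auto simp: range_fibre_def)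
  show ?thesis
  proof (rule psd_kernel_exp_neg[OF A(1) _ _ t, where d = F])
    fix i j assume "i \<in> A" "j \<in> A"
    then have "ginv G (gmult G (ginv G i) j) = gmult G (ginv G j) i"
      by (simp add: inv_mult_inv rA)
    then show "F (gmult G (ginv G i) j) = F (gmult G (ginv G j) i)"
      using Finv[of "gmult G (ginv G i) j"] by simp
  next
    fix c :: "'g \<Rightarrow> real"
    define n where "n = card A"
    obtain \<gamma>0 where g0: "bij_betw \<gamma>0 {..<n} A"
      using ex_bij_betw_nat_finite[OF A(1)] unfolding n_def atLeast0LessThan by blast
    \<comment> \<open>The index \<open>n\<close>, just beyond the enumeration of \<open>A\<close>,
      stands for the added base point.\<close>
    define \<gamma> where "\<gamma> i = (if i < n then \<gamma>0 i else x)" for i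
    define a where "a i = (if i < n then c (\<gamma>0 i) else - sum c A)" for i
    have gA: "\<gamma>0 i \<in> A" if "i < n" for i using g0 that by (auto dest: bij_betw_apply)
    have re: "(\<Sum>i<n. u (\<gamma>0 i)) = sum u A" for u :: "'g \<Rightarrow> real"
      by (rule sum.reindex_bij_betw[OF g0])
    have "(\<Sum>i<Suc n. a i) = 0" using re[of c] by (simp add: a_def)
    moreover have "\<forall>i<Suc n. \<forall>j<Suc n. rng G (\<gamma> i) = rng G (\<gamma> j)"
      using rA gA unit_simps(1)[OF x] by (auto simp: \<gamma>_def)
    ultimately have "(\<Sum>i<Suc n. \<Sum>j<Suc n. a i * a j * F (gmult G (ginv G (\<gamma> i)) (\<gamma> j))) \<le> 0"
      using F unfolding negative_type_def by blast
    also have "(\<Sum>i<Suc n. \<Sum>j<Suc n. a i * a j * F (gmult G (ginv G (\<gamma> i)) (\<gamma> j))) =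
       (\<Sum>i<n. \<Sum>j<n. c (\<gamma>0 i) * c (\<gamma>0 j) * F (gmult G (ginv G (\<gamma>0 i)) (\<gamma>0 j)))
       - sum c A * (\<Sum>i<n. c (\<gamma>0 i) * F (\<gamma>0 i)) - sum c A * (\<Sum>i<n. c (\<gamma>0 i) * F (\<gamma>0 i))"
    proof -
      have 1: "F (gmult G (ginv G (\<gamma>0 i)) x) = F (\<gamma>0 i)" "F (gmult G (ginv G x) (\<gamma>0 i)) = F (\<gamma>0 i)"
        if "i < n" for i
        using rA[OF gA[OF that]] mult_src_right[of "ginv G (\<gamma>0 i)"] rng_mult_left[of "\<gamma>0 i"]
        by (simp_all add: src_inv unit_simps[OF x] Finv)
      have 2: "F (gmult G (ginv G x) x) = 0"
        using rng_mult_left[of x] by (simp add: unit_simps[OF x] Fx)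
      have split: "(\<Sum>i<Suc n. \<Sum>j<Suc n. T i j) =
          (\<Sum>i<n. \<Sum>j<n. T i j) + (\<Sum>i<n. T i n) + (\<Sum>j<n. T n j) + T n n" for T :: "nat \<Rightarrow> nat \<Rightarrow> real"
        by (simp add: sum.distrib)
      show ?thesis
        unfolding split by (simp add: a_def \<gamma>_def 1 2 sum_distrib_left sum_negf mult.left_commute mult.commute)
    qed
    also have "(\<Sum>i<n. \<Sum>j<n. c (\<gamma>0 i) * c (\<gamma>0 j) * F (gmult G (ginv G (\<gamma>0 i)) (\<gamma>0 j))) =
        (\<Sum>i\<in>A. \<Sum>j\<in>A. c i * c j * F (gmult G (ginv G i) j))"
      using re[of "\<lambda>i. \<Sum>j\<in>A. c i * c j * F (gmult G (ginv G i) j)"]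
        re[of "\<lambda>j. c i * c j * F (gmult G (ginv G i) j)" for i] by simp
    also have "(\<Sum>i<n. c (\<gamma>0 i) * F (\<gamma>0 i)) = (\<Sum>i\<in>A. c i * F i)"
      by (rule re)
    finally show "(\<Sum>i\<in>A. \<Sum>j\<in>A. c i * c j * F (gmult G (ginv G i) j)) \<le>
        2 * (\<Sum>i\<in>A. c i) * (\<Sum>i\<in>A. c i * F i)" by simp
  qed
qed

text \<open>Left translation by \<open>g\<close> is a bijection between the two fibres, so
  finiteness spreads along orbits.\<close>

lemma (in groupoid) finite_range_fibre:
  "finite (range_fibre G (rng G g)) \<Longrightarrow> finite (range_fibre G (src G g))"
  using bij_betw_finite[OF bij_betw_mult] by blast

theorem theorem6p1:
  fixes G :: "'g::t2_space groupoid_ops"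
  assumes "etale_groupoid G"
    and "locally_compact_space (euclidean :: 'g topology)"
    and "compact (units G)"
    and "minimal_groupoid G"
    and "property_T G"
    and "aT_menable G"
    and "\<exists>\<mu>. invariant_probability G \<mu>"
  shows "finite (UNIV :: 'g set)"
proof -
  obtain M where M: "invariant_probability G M" using assms(7) by blast
  interpret measured_etale G M
    using assms(1,3) M by (simp add: measured_etale_def etale_t2_def etale_t2_axioms_def measured_etale_axioms_def)
  obtain K c where kp0: "kazhdan_pair TYPE(nat \<Rightarrow> 'g \<Rightarrow> complex) G K c"
    using assms(5) by (auto simp: property_T_def)
  \<comment> \<open>The completion consists of functionals on functions, so the constants are needed
    for Hilbert spaces in that type.\<close>
  have kp: "kazhdan_pair TYPE(('g \<Rightarrow> complex) \<Rightarrow> complex) G K c"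
    by (rule kazhdan_pair_universal[OF assms(1,3) kp0])
  then have K: "compact K" and c: "c > 0" by (auto simp: kazhdan_pair_def)
  obtain F :: "'g \<Rightarrow> real" where F0: "\<And>g. F g \<ge> 0" and Fc: "continuous_on UNIV F"
    and proper: "\<And>C. compact C \<Longrightarrow> C \<subseteq> {0..} \<Longrightarrow> compact (F -` C)" and neg: "negative_type G F"
    using assms(6) unfolding aT_menable_def by blast
  \<comment> \<open>\<open>Q\<close> consists of the quotients at which \<open>\<phi>\<close> has to
    be close to \<open>1\<close>. It is compact, so \<open>F\<close> has a bound \<open>B\<close> on
    it, and \<open>1 - exp (- y) \<le> y\<close> shows that \<open>t * B = (c / 64)^2\<close> is
    small enough.\<close>
  define Q where "Q = (\<lambda>(b, k). gmult G (ginv G b) k) `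
    ((K \<union> units G) \<times> (K \<union> units G) \<inter> {(b, k). rng G b = rng G k})"
  have "compact (F ` Q)"
    unfolding Q_def using K compact_units
    by (intro compact_continuous_image continuous_on_subset[OF Fc] compact_inv_mult) auto
  then have "bounded (F ` Q)" by (rule compact_imp_bounded)
  then obtain B where B: "B > 0" "\<And>g. g \<in> Q \<Longrightarrow> F g \<le> B"
    unfolding bounded_pos by fastforce
  define t where "t = (c / 64)\<^sup>2 / B"
  have t: "t > 0" using c B by (simp add: t_def)
  interpret positive_type_function G M "\<lambda>g. exp (- t * F g)"
  proof
    show "continuous_on UNIV (\<lambda>g. exp (- t * F g))" by (intro continuous_intros Fc)
    show "exp (- t * F x) = 1" if "x \<in> units G" for x using neg that by (simp add: negative_type_def)
    show "exp (- t * F (ginv G g)) = exp (- t * F g)" for g using neg by (simp add: negative_type_def)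
    show "0 \<le> exp (- t * F g)" for g by simp
    show "exp (- t * F g) \<le> 1" for g using t F0[of g] by simp
    show "psd_kernel A (\<lambda>g h. exp (- t * F (gmult G (ginv G g) h)))"
      if "finite A" "A \<subseteq> range_fibre G x" for A x
      by (rule negative_type_psd[OF neg that]) (use t in simp)
  qed
  have "\<exists>x\<in>units G. finite (range_fibre G x)"
  proof (rule kazhdan_infinite_fibres[OF assms(2) kp])
    fix b k assume bk: "b \<in> K \<union> units G" "k \<in> K \<union> units G" "rng G b = rng G k"
    have "1 - exp (- t * F (gmult G (ginv G b) k)) \<le> t * F (gmult G (ginv G b) k)"
      using exp_ge_add_one_self[of "- t * F (gmult G (ginv G b) k)"] by simp
    also have "\<dots> \<le> t * B"
    proof (rule mult_left_mono[OF B(2)])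
      show "gmult G (ginv G b) k \<in> Q"
        unfolding Q_def using bk by (intro image_eqI[of _ _ "(b, k)"]) auto
    qed (use t in simp)
    also have "\<dots> = (c / 64)\<^sup>2" using B(1) by (simp add: t_def)
    finally show "1 - exp (- t * F (gmult G (ginv G b) k)) \<le> (c / 64)\<^sup>2" .
  next
    \<comment> \<open>The set where \<open>\<phi> \<ge> 1 / 2\<close> is a sublevel set of
      \<open>F\<close>, compact because \<open>F\<close> is proper.\<close>
    show "compact (F -` {0..ln 2 / t})" by (rule proper) auto
    show "exp (- t * F g) \<le> 1 / 2" if "g \<notin> F -` {0..ln 2 / t}" for g
    proof -
      have "ln 2 < t * F g" using that F0[of g] t by (simp add: field_simps)
      then have "exp (- t * F g) \<le> exp (- ln 2)" by simp
      then show ?thesis by (simp add: exp_minus inverse_eq_divide)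
    qed
  qed
  then obtain x where x: "x \<in> units G" "finite (range_fibre G x)" by blast
  have "finite (src G ` range_fibre G x)" using x(2) by simp
  \<comment> \<open>A finite set is closed in a Hausdorff space, so a dense finite orbit exhausts
    the unit space.\<close>
  then have "closure (src G ` range_fibre G x) = src G ` range_fibre G x"
    by (intro closure_closed finite_imp_closed)
  then have orbit: "units G \<subseteq> src G ` range_fibre G x"
    using assms(4) x(1) unfolding minimal_groupoid_def by metis
  have fin: "finite (range_fibre G y)" if "y \<in> units G" for y
  proof -
    have "y \<in> src G ` range_fibre G x" using orbit that by blast
    then obtain g where "rng G g = x" "y = src G g" by (auto simp: range_fibre_def)
    then show ?thesis using finite_range_fibre[of g] x(2) by simp
  qed
  have "finite (units G)" using orbit x(2) finite_subset by blast
  then have "finite (\<Union>y\<in>units G. range_fibre G y)" using fin by blast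
  moreover have "(\<Union>y\<in>units G. range_fibre G y) = UNIV" by (auto simp: range_fibre_def)
  ultimately show ?thesis by simp
qed

end
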